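(* In the setting of the context (the resolution $\widetilde\pi:(\widetilde X,\widetilde E)\to X_0$ of a real analytic surface $X_0$ in a real analytic Riemannian manifold $(M_0,\mathbf g_0)$), let $\widetilde a$ be a regular point of $\widetilde E$, and let $r,s,t$ be the non-negative integers attached to $\widetilde a$ by $\mathcal M_1=u^r$, $\mathcal M_2=u^s$, $s\ge r$, and $\mu_1\wedge\mu_2={\rm Unit}\cdot u^t\,\mathrm du\wedge\mathrm dv$. For each integer $\rho\ge 2s+2t+1$ there exist local coordinates $(u,v)$ centered at $\widetilde a$ and adapted to $\widetilde E$ (that is, $(\widetilde E,\widetilde a)=\{u=0\}$) such that $$\widetilde\pi^*\mathbf g_0=\lambda_1u^{2r}\,\mathrm du\otimes\mathrm du+\lambda_2u^{2s+2t}\,\mathrm dv\otimes\mathrm dv+u^\rho h\,(\mathrm du\otimes\mathrm dv+\mathrm dv\otimes\mathrm du)$$ for positive analytic units $\lambda_1,\lambda_2$ and an analytic function germ $h$ at $\widetilde a$.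
   Context: Let $M_0$ be a connected real analytic manifold of dimension $N$ with a real analytic Riemannian metric $\mathbf g_0$, and $X_0\subset M_0$ a closed real analytic subset with no connected component of dimension other than $2$, with singular locus $Y_0$, carrying a real analytic space structure given by a coherent ideal sheaf. A resolution of singularities $\sigma:(X,E)\to(X_0,Y_0)$ (a locally finite composition of geometrically admissible blowings-up, $X$ a smooth analytic surface, $E$ a simple normal crossing divisor) is Gauss regular if the map $\underline b\mapsto[T_{\sigma(\underline b)}X_0]$, defined on $X\setminus E$, extends analytically to $X$ with values in the Grassmann bundle of $TM_0$; it then defines a rank-two analytic sub-bundle $T^\sigma X_0\subset\sigma^*TM_0$, with fiber-metric $\mathbf g^\sigma:=(\mathbf g_0\circ\sigma)|_{T^\sigma X_0}$, and $D\sigma$ induces $\Delta\sigma:TX\to T^\sigma X_0$. $\sigma_1:(X_1,E_1)\to X_0$ is a Gauss regular resolution such that every point of $X_1$ has a neighbourhood with analytic sections $\omega_1,\omega_2$ of $(T^{\sigma_1}X_0)^\vee$ with orthogonal kernels and $\mathbf g^{\sigma_1}=\omega_1\otimes\omega_1+\omega_2\otimes\omega_2$. $\widetilde\pi=\sigma_1\circ\widetilde\beta:(\widetilde X,\widetilde E)\to X_0$, with $\widetilde\beta$ a locally finite sequence of point blowings-up, is the resolution provided by the paper's main monomialization theorem: near each point $\widetilde a\in\widetilde X$, the pull-backs to $\widetilde X$ of the forms $\theta_i:=\omega_i\circ\widetilde\beta$ are $\theta_i\circ\Delta\widetilde\pi=\mathcal M_i\mu_i$ ($i=1,2$), with $\mathcal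 M_i$ a monomial in $\widetilde E$ and $\mu_i$ an analytic $1$-form generating a foliation with only singularities adapted to $\widetilde E$, and $\mu_1\wedge\mu_2={\rm Unit}\cdot\mathcal M_{1,2}\,\mathrm du\wedge\mathrm dv$ with $\mathcal M_{1,2}$ a monomial in $\widetilde E$. Thus $\widetilde\pi^*\mathbf g_0$ (the analytic extension of the pull-back of $\mathbf g_0|_{X_0}$) equals $\mathcal M_1^2\mu_1\otimes\mu_1+\mathcal M_2^2\mu_2\otimes\mu_2$ near $\widetilde a$. Here a unit is a nowhere vanishing analytic germ. Convention: at a regular point $\widetilde a$ of $\widetilde E$ (only one component of $\widetilde E$ through $\widetilde a$, $\widetilde E=\{u=0\}$), the forms are labelled so that $\mathcal M_1=u^r$, $\mathcal M_2=u^s$, $s\ge r$, and $\mu_1(\widetilde a)\ne0$. Adapted foliation: a form $b\,\mathrm dx-a\,\mathrm dy$ generates a foliation if $\dim_{\mathbb R}\mathcal O/(a,b)<\infty$. A singular point is simple if in some centered coordinates a generator is $\lambda y\,\mathrm dx-\mu x\,\mathrm dy+\theta$, $\mu\ne0$, $\lambda/\mu\notin\mathbb Q_{>0}$, coefficients of $\theta$ in $\mathfrak m^2$. The foliation is adapted to a normal crossing divisor $D$ if all singular points are simple, all components of $D$ through a singular point are invariant (unions of leaves), at smooth points of $D$ regular for the foliation $D$ is either invariant or normal crossing with the leaf, and at corners of $D$ regular for the foliation one component is invariant and the other normal crossing with it.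
   Formalization: Adds the hypothesis that if the leaf of μ₁ through ã is transverse to Ẽ then r = s and t = 0; without it the claim fails, e.g. on the cuspidal edge x² = y³ in ℝ³ (μ₁ = dz, r = t = 0, s = 1). *)

theory Defs
  imports "HOL-Analysis.Analysis"
begin

section \<open>Real analytic functions and manifolds\<close>

definition real_analytic_at :: "(real^'n::finite \<Rightarrow> real) \<Rightarrow> real^'n \<Rightarrow> bool" where
  "real_analytic_at f x \<longleftrightarrow>
     (\<exists>(c :: ('n \<Rightarrow> nat) \<Rightarrow> real) r. r > 0 \<and>
        (\<forall>y\<in>ball x r. ((\<lambda>\<alpha>. c \<alpha> * (\<Prod>i\<in>UNIV. (y $ i - x $ i) ^ \<alpha> i)) has_sum f y) UNIV))"

text \<open>The points of a manifold are those of \<open>topspace (mtop M)\<close>; a coordinate system \<open>(U, \<phi>)\<close> is only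
  meaningful on \<open>U\<close>, and functions and maps are total functions of which only the values on
  the relevant open sets matter.\<close>

record ('a, 'n::finite) mfd =
  mtop :: "'a topology"
  atlas :: "('a set \<times> ('a \<Rightarrow> real^'n)) set"

abbreviation pts :: "('a, 'n::finite) mfd \<Rightarrow> 'a set" where
  "pts M \<equiv> topspace (mtop M)"

text \<open>Membership in the maximal analytic atlas generated by \<open>atlas M\<close>.\<close>

definition chart :: "('a, 'n::finite) mfd \<Rightarrow> 'a set \<Rightarrow> ('a \<Rightarrow> real^'n) \<Rightarrow> bool" where
  "chart M U \<phi> \<longleftrightarrow>
     openin (mtop M) U \<and> open (\<phi> ` U) \<and>
     homeomorphic_map (subtopology (mtop M) U) (top_of_set (\<phi> ` U)) \<phi> \<and>
     (\<forall>(V, \<psi>)\<in>atlas M. \<forall>p\<in>U \<inter> V. \<forall>i.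
        real_analytic_at (\<lambda>x. \<phi> (inv_into V \<psi> x) $ i) (\<psi> p) \<and>
        real_analytic_at (\<lambda>x. \<psi> (inv_into U \<phi> x) $ i) (\<phi> p))"

definition analytic_manifold :: "('a, 'n::finite) mfd \<Rightarrow> bool" where
  "analytic_manifold M \<longleftrightarrow>
     Hausdorff_space (mtop M) \<and> second_countable (mtop M) \<and>
     (\<forall>(U, \<phi>)\<in>atlas M. chart M U \<phi>) \<and> (\<Union>(U, \<phi>)\<in>atlas M. U) = pts M"

definition chart_at :: "('a, 'n::finite) mfd \<Rightarrow> 'a \<Rightarrow> 'a set \<Rightarrow> ('a \<Rightarrow> real^'n) \<Rightarrow> bool" where
  "chart_at M p U \<phi> \<longleftrightarrow> chart M U \<phi> \<and> p \<in> U \<and> \<phi> p = 0"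

definition near :: "('a, 'n::finite) mfd \<Rightarrow> 'a \<Rightarrow> ('a \<Rightarrow> bool) \<Rightarrow> bool" where
  "near M p P \<longleftrightarrow> (\<exists>W. openin (mtop M) W \<and> p \<in> W \<and> (\<forall>q\<in>W. P q))"

definition analytic_at :: "('a, 'n::finite) mfd \<Rightarrow> ('a \<Rightarrow> real) \<Rightarrow> 'a \<Rightarrow> bool" where
  "analytic_at M f p \<longleftrightarrow> p \<in> pts M \<and>
     (\<forall>(U, \<phi>)\<in>atlas M. p \<in> U \<longrightarrow> real_analytic_at (\<lambda>x. f (inv_into U \<phi> x)) (\<phi> p))"

definition analytic_map ::
  "('a, 'n::finite) mfd \<Rightarrow> 'a set \<Rightarrow> ('b, 'k::finite) mfd \<Rightarrow> ('a \<Rightarrow> 'b) \<Rightarrow> bool" where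
  "analytic_map M W M' f \<longleftrightarrow>
     continuous_map (subtopology (mtop M) W) (mtop M') f \<and>
     (\<forall>p\<in>W. \<forall>(V, \<psi>)\<in>atlas M'. f p \<in> V \<longrightarrow> (\<forall>i. analytic_at M (\<lambda>q. \<psi> (f q) $ i) p))"

definition analytic_iso ::
  "('a, 'n::finite) mfd \<Rightarrow> 'a set \<Rightarrow> ('b, 'k::finite) mfd \<Rightarrow> 'b set \<Rightarrow> ('a \<Rightarrow> 'b) \<Rightarrow> bool" where
  "analytic_iso M W M' W' f \<longleftrightarrow>
     bij_betw f W W' \<and> analytic_map M W M' f \<and> analytic_map M' W' M (inv_into W f)"


section \<open>Tangent vectors and tensors\<close>

text \<open>A tangent vector at \<open>p\<close> is a directional derivative, acting on functions that are
  analytic at \<open>p\<close> (and normalised to \<open>0\<close> on all other functions, so that equality of tangent vectors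
  is equality of HOL functions). For a function \<open>u\<close>, the value of \<open>du\<close> on \<open>\<xi>\<close> is \<open>\<xi> u\<close>.\<close>

type_synonym 'a tvec = "('a \<Rightarrow> real) \<Rightarrow> real"

definition chart_vector ::
  "('a, 'n::finite) mfd \<Rightarrow> 'a set \<Rightarrow> ('a \<Rightarrow> real^'n) \<Rightarrow> 'a \<Rightarrow> real^'n \<Rightarrow> 'a tvec" where
  "chart_vector M U \<phi> p v =
     (\<lambda>f. if analytic_at M f p
          then frechet_derivative (\<lambda>x. f (inv_into U \<phi> x)) (at (\<phi> p)) v else 0)"

definition tangent_space :: "('a, 'n::finite) mfd \<Rightarrow> 'a \<Rightarrow> 'a tvec set" where
  "tangent_space M p =
     {chart_vector M U \<phi> p v | U \<phi> v. (U, \<phi>) \<in> atlas M \<and> p \<in> U}"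

definition lincomb :: "real \<Rightarrow> 'a tvec \<Rightarrow> real \<Rightarrow> 'a tvec \<Rightarrow> 'a tvec" where
  "lincomb x \<xi> y \<eta> = (\<lambda>f. x * \<xi> f + y * \<eta> f)"

definition linear_form_on :: "'a tvec set \<Rightarrow> ('a tvec \<Rightarrow> real) \<Rightarrow> bool" where
  "linear_form_on T \<omega> \<longleftrightarrow>
     (\<forall>\<xi>\<in>T. \<forall>\<eta>\<in>T. \<forall>x y. \<omega> (lincomb x \<xi> y \<eta>) = x * \<omega> \<xi> + y * \<omega> \<eta>)"

definition pushforward ::
  "('b, 'k::finite) mfd \<Rightarrow> ('a \<Rightarrow> 'b) \<Rightarrow> 'a \<Rightarrow> 'a tvec \<Rightarrow> 'b tvec" where
  "pushforward M' f p \<xi> = (\<lambda>g. if analytic_at M' g (f p) then \<xi> (\<lambda>x. g (f x)) else 0)"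

definition riemannian_metric ::
  "('a, 'n::finite) mfd \<Rightarrow> ('a \<Rightarrow> 'a tvec \<Rightarrow> 'a tvec \<Rightarrow> real) \<Rightarrow> bool" where
  "riemannian_metric M g \<longleftrightarrow>
     (\<forall>p\<in>pts M. \<forall>\<xi>\<in>tangent_space M p.
        linear_form_on (tangent_space M p) (g p \<xi>) \<and>
        (\<forall>\<eta>\<in>tangent_space M p. g p \<xi> \<eta> = g p \<eta> \<xi>) \<and>
        (\<xi> \<noteq> (\<lambda>_. 0) \<longrightarrow> g p \<xi> \<xi> > 0)) \<and>
     (\<forall>(U, \<phi>)\<in>atlas M. \<forall>p\<in>U. \<forall>v w.
        analytic_at M (\<lambda>q. g q (chart_vector M U \<phi> q v) (chart_vector M U \<phi> q w)) p)"

definition pullback_metric ::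
  "('b, 'k::finite) mfd \<Rightarrow> ('b \<Rightarrow> 'b tvec \<Rightarrow> 'b tvec \<Rightarrow> real) \<Rightarrow> ('a \<Rightarrow> 'b)
     \<Rightarrow> 'a \<Rightarrow> 'a tvec \<Rightarrow> 'a tvec \<Rightarrow> real" where
  "pullback_metric M' g f p \<xi> \<eta> = g (f p) (pushforward M' f p \<xi>) (pushforward M' f p \<eta>)"

definition analytic_one_form ::
  "('a, 'n::finite) mfd \<Rightarrow> 'a set \<Rightarrow> ('a \<Rightarrow> 'a tvec \<Rightarrow> real) \<Rightarrow> bool" where
  "analytic_one_form M W \<mu> \<longleftrightarrow>
     (\<forall>p\<in>W. linear_form_on (tangent_space M p) (\<mu> p)) \<and>
     (\<forall>(U, \<phi>)\<in>atlas M. \<forall>p\<in>U \<inter> W. \<forall>v. analytic_at M (\<lambda>q. \<mu> q (chart_vector M U \<phi> q v)) p)"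

definition vanishes_at :: "('a, 'n::finite) mfd \<Rightarrow> ('a \<Rightarrow> 'a tvec \<Rightarrow> real) \<Rightarrow> 'a \<Rightarrow> bool" where
  "vanishes_at M \<mu> p \<longleftrightarrow> (\<forall>\<xi>\<in>tangent_space M p. \<mu> p \<xi> = 0)"


section \<open>Analytic subsets, submanifolds and normal crossings\<close>

text \<open>A coherent ideal sheaf, given by its stalks \<open>\<I> p\<close> (sets of representatives of germs). Since the
  structure sheaf is coherent (Oka), an ideal sheaf is coherent iff it is locally finitely
  generated.\<close>

definition coherent_ideal_sheaf ::
  "('a, 'n::finite) mfd \<Rightarrow> ('a \<Rightarrow> ('a \<Rightarrow> real) set) \<Rightarrow> bool" where
  "coherent_ideal_sheaf M \<I> \<longleftrightarrow>
     (\<forall>p\<in>pts M. \<exists>W F. openin (mtop M) W \<and> p \<in> W \<and> finite F \<and>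
        (\<forall>q\<in>W. (\<forall>f\<in>F. analytic_at M f q) \<and>
           \<I> q = {g. \<exists>h. (\<forall>f\<in>F. analytic_at M (h f) q) \<and>
                        near M q (\<lambda>x. g x = (\<Sum>f\<in>F. h f x * f x))}))"

definition zero_set :: "('a, 'n::finite) mfd \<Rightarrow> ('a \<Rightarrow> ('a \<Rightarrow> real) set) \<Rightarrow> 'a set" where
  "zero_set M \<I> = {p\<in>pts M. \<forall>f\<in>\<I> p. f p = 0}"

definition submanifold_at :: "('a, 'n::finite) mfd \<Rightarrow> 'a set \<Rightarrow> nat \<Rightarrow> 'a \<Rightarrow> bool" where
  "submanifold_at M S k p \<longleftrightarrow>
     (\<exists>U \<phi> I. chart_at M p U \<phi> \<and> card I = k \<and> S \<inter> U = {q\<in>U. \<forall>i. i \<notin> I \<longrightarrow> \<phi> q $ i = 0})"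

definition has_dimension :: "('a, 'n::finite) mfd \<Rightarrow> 'a set \<Rightarrow> nat \<Rightarrow> bool" where
  "has_dimension M X d \<longleftrightarrow>
     (\<exists>S\<subseteq>X. S \<noteq> {} \<and> (\<forall>p\<in>S. submanifold_at M S d p)) \<and>
     (\<forall>S\<subseteq>X. \<forall>e. S \<noteq> {} \<and> (\<forall>p\<in>S. submanifold_at M S e p) \<longrightarrow> e \<le> d)"

definition analytic_surface_in ::
  "('a, 'n::finite) mfd \<Rightarrow> ('a \<Rightarrow> ('a \<Rightarrow> real) set) \<Rightarrow> 'a set \<Rightarrow> bool" where
  "analytic_surface_in M \<I> X \<longleftrightarrow>
     coherent_ideal_sheaf M \<I> \<and> closedin (mtop M) X \<and> X = zero_set M \<I> \<and>
     (\<forall>K\<in>connected_components_of (subtopology (mtop M) X). has_dimension M K 2)"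

definition singular_locus :: "('a, 'n::finite) mfd \<Rightarrow> 'a set \<Rightarrow> 'a set" where
  "singular_locus M X = {p\<in>X. \<not> submanifold_at M X 2 p}"

text \<open>At a point where \<open>X\<close> is a submanifold this is its tangent space.\<close>

definition tangent_to :: "('a, 'n::finite) mfd \<Rightarrow> 'a set \<Rightarrow> 'a \<Rightarrow> 'a tvec set" where
  "tangent_to M X p =
     {\<xi>\<in>tangent_space M p.
        \<forall>f. analytic_at M f p \<and> near M p (\<lambda>q. q \<in> X \<longrightarrow> f q = 0) \<longrightarrow> \<xi> f = 0}"

text \<open>In the next two definitions \<open>I\<close> is the set of those coordinates of the chart whose zero sets are
  the components of the divisor through the centre of the chart.\<close>

definition divisor_chart ::
  "('a, 'n::finite) mfd \<Rightarrow> 'a set \<Rightarrow> 'a \<Rightarrow> 'a set \<Rightarrow> ('a \<Rightarrow> real^'n) \<Rightarrow> 'n set \<Rightarrow> bool" where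
  "divisor_chart M E p U \<phi> I \<longleftrightarrow>
     chart_at M p U \<phi> \<and> E \<inter> U = {q\<in>U. \<exists>i\<in>I. \<phi> q $ i = 0}"

definition snc_divisor :: "('a, 'n::finite) mfd \<Rightarrow> 'a set \<Rightarrow> bool" where
  "snc_divisor M E \<longleftrightarrow>
     (\<exists>\<H>. E = \<Union>\<H> \<and>
        (\<forall>H\<in>\<H>. H \<noteq> {} \<and> closedin (mtop M) H \<and> connectedin (mtop M) H) \<and>
        (\<forall>p\<in>pts M. \<exists>U \<phi> \<iota>. chart_at M p U \<phi> \<and> inj_on \<iota> {H\<in>\<H>. p \<in> H} \<and>
           (\<forall>H\<in>\<H>. H \<inter> U = (if p \<in> H then {q\<in>U. \<phi> q $ \<iota> H = 0} else {}))))"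

definition monomial_in :: "('a \<Rightarrow> real^'n::finite) \<Rightarrow> 'n set \<Rightarrow> ('n \<Rightarrow> nat) \<Rightarrow> 'a \<Rightarrow> real" where
  "monomial_in \<phi> I e q = (\<Prod>i\<in>I. (\<phi> q $ i) ^ e i)"


section \<open>Blowings-up and resolutions\<close>

text \<open>The \<open>i\<close>-th chart of the blowing-up of the subspace where the coordinates indexed by \<open>I\<close> vanish.\<close>

definition blowup_coord :: "'n set \<Rightarrow> 'n \<Rightarrow> real^'n::finite \<Rightarrow> real^'n" where
  "blowup_coord I i y = (\<chi> j. if j \<in> I \<and> j \<noteq> i then y $ i * y $ j else y $ j)"

definition blowing_up ::
  "('a, 'n::finite) mfd \<Rightarrow> 'a set \<Rightarrow> ('b, 'n) mfd \<Rightarrow> ('b \<Rightarrow> 'a) \<Rightarrow> bool" where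
  "blowing_up M C M' \<beta> \<longleftrightarrow>
     analytic_map M' (pts M') M \<beta> \<and> proper_map (mtop M') (mtop M) \<beta> \<and>
     analytic_iso M' {q\<in>pts M'. \<beta> q \<notin> C} M (pts M - C) \<beta> \<and>
     (\<forall>p\<in>C. \<exists>U \<phi> I V \<psi>. chart_at M p U \<phi> \<and> I \<noteq> {} \<and>
        C \<inter> U = {q\<in>U. \<forall>i\<in>I. \<phi> q $ i = 0} \<and>
        (\<Union>i\<in>I. V i) = {q\<in>pts M'. \<beta> q \<in> U} \<and>
        (\<forall>i\<in>I. chart M' (V i) (\<psi> i) \<and>
           \<psi> i ` V i = {y. blowup_coord I i y \<in> \<phi> ` U} \<and>
           (\<forall>q\<in>V i. \<phi> (\<beta> q) = blowup_coord I i (\<psi> i q))))"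

text \<open>Closed, smooth, contained in \<open>X\<close>, and having only normal crossings with \<open>D\<close>.\<close>

definition admissible_center ::
  "('a, 'n::finite) mfd \<Rightarrow> 'a set \<Rightarrow> 'a set \<Rightarrow> 'a set \<Rightarrow> bool" where
  "admissible_center M X D C \<longleftrightarrow>
     closedin (mtop M) C \<and> C \<subseteq> X \<and>
     (\<forall>p\<in>C. \<exists>U \<phi> I J. divisor_chart M D p U \<phi> J \<and> C \<inter> U = {q\<in>U. \<forall>i\<in>I. \<phi> q $ i = 0})"

primrec composite :: "(nat \<Rightarrow> 'a \<Rightarrow> 'a) \<Rightarrow> nat \<Rightarrow> 'a \<Rightarrow> 'a" where
  "composite \<beta> 0 = id"
| "composite \<beta> (Suc j) = composite \<beta> j \<circ> \<beta> j"

text \<open>A sequence of blowings-up \<open>\<beta> j\<close> of \<open>M j\<close> with center \<open>C j\<close>, with strict transforms \<open>X j\<close> and total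
  exceptional divisors \<open>D j\<close>. Finite sequences are included, since the blowing-up with empty
  center is an isomorphism.\<close>

definition blowup_sequence ::
  "(nat \<Rightarrow> ('a, 'n::finite) mfd) \<Rightarrow> (nat \<Rightarrow> 'a set) \<Rightarrow> (nat \<Rightarrow> 'a set) \<Rightarrow> (nat \<Rightarrow> 'a set)
     \<Rightarrow> (nat \<Rightarrow> 'a \<Rightarrow> 'a) \<Rightarrow> bool" where
  "blowup_sequence M X D C \<beta> \<longleftrightarrow>
     (\<forall>j. analytic_manifold (M j) \<and> admissible_center (M j) (X j) (D j) (C j) \<and>
          blowing_up (M j) (C j) (M (Suc j)) (\<beta> j) \<and>
          X (Suc j) = mtop (M (Suc j)) closure_of {q\<in>pts (M (Suc j)). \<beta> j q \<in> X j - C j} \<and>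
          D (Suc j) = {q\<in>pts (M (Suc j)). \<beta> j q \<in> D j \<union> C j})"

definition analytic_embedding ::
  "('b, 'k::finite) mfd \<Rightarrow> 'b set \<Rightarrow> ('a, 'n::finite) mfd \<Rightarrow> 'a set \<Rightarrow> ('b \<Rightarrow> 'a) \<Rightarrow> bool" where
  "analytic_embedding S W M W' f \<longleftrightarrow>
     analytic_map S W M f \<and>
     homeomorphic_map (subtopology (mtop S) W) (subtopology (mtop M) W') f \<and>
     (\<forall>p\<in>W. \<forall>\<xi>\<in>tangent_space S p. pushforward M f p \<xi> = (\<lambda>_. 0) \<longrightarrow> \<xi> = (\<lambda>_. 0))"

text \<open>The sequence is locally finite, and \<open>S\<close>, with the divisor \<open>E\<close> and the projections \<open>\<tau> j\<close>, is the
  resulting final strict transform: over each relatively compact open subset \<open>V\<close> of \<open>M 0\<close> it is, through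
  \<open>\<tau> j\<close>, the \<open>j\<close>-th strict transform for all large \<open>j\<close>.\<close>

definition blowup_limit ::
  "(nat \<Rightarrow> ('a, 'n::finite) mfd) \<Rightarrow> (nat \<Rightarrow> 'a set) \<Rightarrow> (nat \<Rightarrow> 'a set) \<Rightarrow> (nat \<Rightarrow> 'a set)
     \<Rightarrow> (nat \<Rightarrow> 'a \<Rightarrow> 'a) \<Rightarrow> ('b, 'k::finite) mfd \<Rightarrow> 'b set \<Rightarrow> (nat \<Rightarrow> 'b \<Rightarrow> 'a) \<Rightarrow> bool" where
  "blowup_limit M X D C \<beta> S E \<tau> \<longleftrightarrow>
     E \<subseteq> pts S \<and>
     (\<forall>j. analytic_map S (pts S) (M j) (\<tau> j) \<and> (\<forall>p\<in>pts S. \<beta> j (\<tau> (Suc j) p) = \<tau> j p)) \<and>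
     (\<forall>V. openin (mtop (M 0)) V \<and> compactin (mtop (M 0)) (mtop (M 0) closure_of V) \<longrightarrow>
        (\<exists>n. \<forall>j\<ge>n.
           (\<forall>q\<in>C j. composite \<beta> j q \<notin> V) \<and>
           analytic_embedding S {p\<in>pts S. \<tau> 0 p \<in> V} (M j) {q\<in>X j. composite \<beta> j q \<in> V} (\<tau> j) \<and>
           (\<forall>p\<in>pts S. \<tau> 0 p \<in> V \<longrightarrow> (p \<in> E \<longleftrightarrow> \<tau> j p \<in> D j))))"

text \<open>Embedded resolution: a blowing-up of \<open>X\<^sub>0\<close> is the restriction to the strict transform of the
  blowing-up of the ambient manifold with the same center. Choosing the ambient manifolds on
  the type \<open>'m\<close> is harmless for reasons of cardinality.\<close>

definition resolution_of_surface ::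
  "('m, 'n::finite) mfd \<Rightarrow> 'm set \<Rightarrow> ('x, 2) mfd \<Rightarrow> 'x set \<Rightarrow> ('x \<Rightarrow> 'm) \<Rightarrow> bool" where
  "resolution_of_surface M\<^sub>0 X\<^sub>0 S E \<sigma> \<longleftrightarrow>
     analytic_manifold S \<and> snc_divisor S E \<and> \<sigma> ` pts S \<subseteq> X\<^sub>0 \<and>
     E = {p\<in>pts S. \<sigma> p \<in> singular_locus M\<^sub>0 X\<^sub>0} \<and>
     (\<exists>M X D C \<beta> \<tau>. blowup_sequence M X D C \<beta> \<and> blowup_limit M X D C \<beta> S E \<tau> \<and>
        M 0 = M\<^sub>0 \<and> X 0 = X\<^sub>0 \<and> D 0 = {} \<and> \<tau> 0 = \<sigma> \<and>
        (\<forall>j. composite \<beta> j ` C j \<subseteq> singular_locus M\<^sub>0 X\<^sub>0))"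

definition point_blowings_up ::
  "('x, 2) mfd \<Rightarrow> 'x set \<Rightarrow> ('y, 2) mfd \<Rightarrow> 'y set \<Rightarrow> ('y \<Rightarrow> 'x) \<Rightarrow> bool" where
  "point_blowings_up S\<^sub>1 E\<^sub>1 S E b \<longleftrightarrow>
     analytic_manifold S \<and> snc_divisor S E \<and>
     (\<exists>M X D C \<beta> \<tau>. blowup_sequence M X D C \<beta> \<and> blowup_limit M X D C \<beta> S E \<tau> \<and>
        M 0 = S\<^sub>1 \<and> X 0 = pts S\<^sub>1 \<and> D 0 = E\<^sub>1 \<and> \<tau> 0 = b \<and> (\<forall>j. \<exists>p. C j \<subseteq> {p}))"


section \<open>Gauss regularity\<close>

definition analytic_section_along ::
  "('x, 'k::finite) mfd \<Rightarrow> ('m, 'n::finite) mfd \<Rightarrow> ('x \<Rightarrow> 'm) \<Rightarrow> 'x set \<Rightarrow> ('x \<Rightarrow> 'm tvec) \<Rightarrow> bool" where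
  "analytic_section_along S M\<^sub>0 \<sigma> W e \<longleftrightarrow>
     (\<forall>p\<in>W. e p \<in> tangent_space M\<^sub>0 (\<sigma> p) \<and>
        (\<forall>(V, \<psi>)\<in>atlas M\<^sub>0. \<sigma> p \<in> V \<longrightarrow>
           (\<forall>i. analytic_at S (\<lambda>q. e q (\<lambda>m. \<psi> m $ i)) p)))"

text \<open>\<open>T\<close> is the sub-bundle of \<open>\<sigma>\<^sup>*TM\<^sub>0\<close> extending \<open>b \<mapsto> T\<^bsub>\<sigma>(b)\<^esub>X\<^sub>0\<close>: analyticity of a map into the Grassmann
  bundle of planes means that the plane is locally spanned by an analytic frame.\<close>

definition gauss_extension ::
  "('m, 'n::finite) mfd \<Rightarrow> 'm set \<Rightarrow> ('x, 2) mfd \<Rightarrow> 'x set \<Rightarrow> ('x \<Rightarrow> 'm) \<Rightarrow> ('x \<Rightarrow> 'm tvec set) \<Rightarrow> bool" where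
  "gauss_extension M\<^sub>0 X\<^sub>0 S E \<sigma> T \<longleftrightarrow>
     (\<forall>b\<in>pts S - E. T b = tangent_to M\<^sub>0 X\<^sub>0 (\<sigma> b)) \<and>
     (\<forall>b\<in>pts S. \<exists>W e1 e2. openin (mtop S) W \<and> b \<in> W \<and>
        analytic_section_along S M\<^sub>0 \<sigma> W e1 \<and> analytic_section_along S M\<^sub>0 \<sigma> W e2 \<and>
        (\<forall>p\<in>W. T p = {lincomb x (e1 p) y (e2 p) | x y. True} \<and>
           (\<forall>x y. lincomb x (e1 p) y (e2 p) = (\<lambda>_. 0) \<longrightarrow> x = 0 \<and> y = 0)))"

definition gauss_regular_resolution ::
  "('m, 'n::finite) mfd \<Rightarrow> 'm set \<Rightarrow> ('x, 2) mfd \<Rightarrow> 'x set \<Rightarrow> ('x \<Rightarrow> 'm) \<Rightarrow> ('x \<Rightarrow> 'm tvec set) \<Rightarrow> bool" where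
  "gauss_regular_resolution M\<^sub>0 X\<^sub>0 S E \<sigma> T \<longleftrightarrow>
     resolution_of_surface M\<^sub>0 X\<^sub>0 S E \<sigma> \<and> gauss_extension M\<^sub>0 X\<^sub>0 S E \<sigma> T"

definition analytic_dual_section ::
  "('m, 'n::finite) mfd \<Rightarrow> ('x, 2) mfd \<Rightarrow> ('x \<Rightarrow> 'm) \<Rightarrow> ('x \<Rightarrow> 'm tvec set) \<Rightarrow> 'x set
     \<Rightarrow> ('x \<Rightarrow> 'm tvec \<Rightarrow> real) \<Rightarrow> bool" where
  "analytic_dual_section M\<^sub>0 S \<sigma> T W \<omega> \<longleftrightarrow>
     (\<forall>p\<in>W. linear_form_on (T p) (\<omega> p)) \<and>
     (\<forall>W'\<subseteq>W. \<forall>e. openin (mtop S) W' \<and> analytic_section_along S M\<^sub>0 \<sigma> W' e \<and>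
        (\<forall>p\<in>W'. e p \<in> T p) \<longrightarrow> (\<forall>p\<in>W'. analytic_at S (\<lambda>q. \<omega> q (e q)) p))"

definition orthogonal_coframe ::
  "('m, 'n::finite) mfd \<Rightarrow> ('m \<Rightarrow> 'm tvec \<Rightarrow> 'm tvec \<Rightarrow> real) \<Rightarrow> ('x, 2) mfd \<Rightarrow> ('x \<Rightarrow> 'm)
     \<Rightarrow> ('x \<Rightarrow> 'm tvec set) \<Rightarrow> 'x set \<Rightarrow> ('x \<Rightarrow> 'm tvec \<Rightarrow> real) \<Rightarrow> ('x \<Rightarrow> 'm tvec \<Rightarrow> real) \<Rightarrow> bool" where
  "orthogonal_coframe M\<^sub>0 g\<^sub>0 S \<sigma> T W \<omega>1 \<omega>2 \<longleftrightarrow>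
     openin (mtop S) W \<and>
     analytic_dual_section M\<^sub>0 S \<sigma> T W \<omega>1 \<and> analytic_dual_section M\<^sub>0 S \<sigma> T W \<omega>2 \<and>
     (\<forall>p\<in>W. \<forall>\<xi>\<in>T p. \<forall>\<eta>\<in>T p.
        (\<omega>1 p \<xi> = 0 \<and> \<omega>2 p \<eta> = 0 \<longrightarrow> g\<^sub>0 (\<sigma> p) \<xi> \<eta> = 0) \<and>
        g\<^sub>0 (\<sigma> p) \<xi> \<eta> = \<omega>1 p \<xi> * \<omega>1 p \<eta> + \<omega>2 p \<xi> * \<omega>2 p \<eta>)"


section \<open>Adapted foliations\<close>

text \<open>Finite codimension of the ideal of coefficients: finitely many germs \<open>B\<close> span the quotient.\<close>

definition generates_foliation ::
  "('a, 2) mfd \<Rightarrow> ('a \<Rightarrow> 'a tvec \<Rightarrow> real) \<Rightarrow> 'a \<Rightarrow> bool" where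
  "generates_foliation S \<mu> p \<longleftrightarrow>
     (\<forall>(U, \<phi>)\<in>atlas S. p \<in> U \<longrightarrow>
        (\<exists>B. finite B \<and> (\<forall>f\<in>B. analytic_at S f p) \<and>
          (\<forall>f. analytic_at S f p \<longrightarrow>
            (\<exists>c h k. analytic_at S h p \<and> analytic_at S k p \<and>
              near S p (\<lambda>q. f q = (\<Sum>g\<in>B. c g * g q)
                 + h q * \<mu> q (chart_vector S U \<phi> q (axis 1 1))
                 + k q * \<mu> q (chart_vector S U \<phi> q (axis 2 1)))))))"

definition simple_singularity ::
  "('a, 2) mfd \<Rightarrow> ('a \<Rightarrow> 'a tvec \<Rightarrow> real) \<Rightarrow> 'a \<Rightarrow> bool" where
  "simple_singularity S \<mu> p \<longleftrightarrow>
     (\<exists>U \<phi> c a b (l::real) (m::real). chart_at S p U \<phi> \<and> m \<noteq> 0 \<and> \<not> (l / m \<in> \<rat> \<and> l / m > 0) \<and>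
        analytic_at S c p \<and> c p \<noteq> 0 \<and>
        (\<forall>f\<in>{a, b}. analytic_at S f p \<and> f p = 0 \<and> (\<forall>\<xi>\<in>tangent_space S p. \<xi> f = 0)) \<and>
        near S p (\<lambda>q. \<forall>\<xi>\<in>tangent_space S q.
           c q * \<mu> q \<xi> = (l * \<phi> q $ 2 + a q) * \<xi> (\<lambda>x. \<phi> x $ 1)
                        + (- m * \<phi> q $ 1 + b q) * \<xi> (\<lambda>x. \<phi> x $ 2)))"

text \<open>The smooth curve \<open>H\<close> is a union of leaves iff it is everywhere tangent to the kernel of \<open>\<mu>\<close>.\<close>

definition invariant_curve ::
  "('a, 2) mfd \<Rightarrow> 'a set \<Rightarrow> ('a \<Rightarrow> 'a tvec \<Rightarrow> real) \<Rightarrow> bool" where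
  "invariant_curve S H \<mu> \<longleftrightarrow> (\<forall>q\<in>H. \<forall>\<xi>\<in>tangent_to S H q. \<mu> q \<xi> = 0)"

text \<open>The curve \<open>H\<close> has a normal crossing at \<open>p\<close> with the leaf through \<open>p\<close>, whose tangent line is the
  kernel of \<open>\<mu> p\<close>.\<close>

definition crosses_leaf ::
  "('a, 2) mfd \<Rightarrow> 'a set \<Rightarrow> ('a \<Rightarrow> 'a tvec \<Rightarrow> real) \<Rightarrow> 'a \<Rightarrow> bool" where
  "crosses_leaf S H \<mu> p \<longleftrightarrow> (\<exists>\<xi>\<in>tangent_to S H p. \<mu> p \<xi> \<noteq> 0)"

definition adapted_at ::
  "('a, 2) mfd \<Rightarrow> 'a set \<Rightarrow> ('a \<Rightarrow> 'a tvec \<Rightarrow> real) \<Rightarrow> 'a \<Rightarrow> bool" where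
  "adapted_at S E \<mu> p \<longleftrightarrow>
     (\<exists>U \<phi> I H. divisor_chart S E p U \<phi> I \<and> (\<forall>i\<in>I. H i = {q\<in>U. \<phi> q $ i = 0}) \<and>
        (if vanishes_at S \<mu> p
         then simple_singularity S \<mu> p \<and> (\<forall>i\<in>I. invariant_curve S (H i) \<mu>)
         else (\<forall>i. I = {i} \<longrightarrow> invariant_curve S (H i) \<mu> \<or> crosses_leaf S (H i) \<mu> p) \<and>
              (\<forall>i j. i \<noteq> j \<and> I = {i, j} \<longrightarrow>
                 invariant_curve S (H i) \<mu> \<and> crosses_leaf S (H j) \<mu> p \<or>
                 invariant_curve S (H j) \<mu> \<and> crosses_leaf S (H i) \<mu> p)))"

definition adapted_foliation_on ::
  "('a, 2) mfd \<Rightarrow> 'a set \<Rightarrow> 'a set \<Rightarrow> ('a \<Rightarrow> 'a tvec \<Rightarrow> real) \<Rightarrow> bool" where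
  "adapted_foliation_on S E W \<mu> \<longleftrightarrow>
     analytic_one_form S W \<mu> \<and> (\<forall>p\<in>W. generates_foliation S \<mu> p \<and> adapted_at S E \<mu> p)"


section \<open>Monomialization\<close>

text \<open>The presentation \<open>\<theta>\<^sub>i \<circ> \<Delta>\<pi> = \<M>\<^sub>i \<mu>\<^sub>i\<close> near \<open>a\<close>, where \<open>\<pi> = \<sigma> \<circ> b\<close>, \<open>\<theta>\<^sub>i = \<omega>\<^sub>i \<circ> b\<close>, in coordinates \<open>\<phi> = (u, v)\<close>
  centered at \<open>a\<close> in which the divisor is the product of the coordinates indexed by \<open>I\<close>; the
  functions \<open>d1\<close>, \<open>d2\<close>, \<open>d12\<close> are the exponents of the monomials \<open>\<M>\<^sub>1\<close>, \<open>\<M>\<^sub>2\<close>, \<open>\<M>\<^sub>1\<^sub>,\<^sub>2\<close>.\<close>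

definition monomial_presentation ::
  "('m, 'n::finite) mfd \<Rightarrow> ('m \<Rightarrow> 'm tvec \<Rightarrow> 'm tvec \<Rightarrow> real)
     \<Rightarrow> ('x, 2) mfd \<Rightarrow> ('x \<Rightarrow> 'm) \<Rightarrow> ('x \<Rightarrow> 'm tvec set)
     \<Rightarrow> ('y, 2) mfd \<Rightarrow> 'y set \<Rightarrow> ('y \<Rightarrow> 'x)
     \<Rightarrow> 'y \<Rightarrow> 'y set \<Rightarrow> ('y \<Rightarrow> real^2) \<Rightarrow> 2 set
     \<Rightarrow> ('y \<Rightarrow> 'y tvec \<Rightarrow> real) \<Rightarrow> ('y \<Rightarrow> 'y tvec \<Rightarrow> real)
     \<Rightarrow> (2 \<Rightarrow> nat) \<Rightarrow> (2 \<Rightarrow> nat) \<Rightarrow> (2 \<Rightarrow> nat) \<Rightarrow> bool" where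
  "monomial_presentation M\<^sub>0 g\<^sub>0 S\<^sub>1 \<sigma> T S E b a U \<phi> I \<mu>1 \<mu>2 d1 d2 d12 \<longleftrightarrow>
     divisor_chart S E a U \<phi> I \<and>
     adapted_foliation_on S E U \<mu>1 \<and> adapted_foliation_on S E U \<mu>2 \<and>
     (\<exists>W \<omega>1 \<omega>2. orthogonal_coframe M\<^sub>0 g\<^sub>0 S\<^sub>1 \<sigma> T W \<omega>1 \<omega>2 \<and> b ` U \<subseteq> W \<and>
        (\<forall>q\<in>U. \<forall>\<xi>\<in>tangent_space S q.
           \<omega>1 (b q) (pushforward M\<^sub>0 (\<sigma> \<circ> b) q \<xi>) = monomial_in \<phi> I d1 q * \<mu>1 q \<xi> \<and>
           \<omega>2 (b q) (pushforward M\<^sub>0 (\<sigma> \<circ> b) q \<xi>) = monomial_in \<phi> I d2 q * \<mu>2 q \<xi>)) \<and>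
     (\<exists>\<epsilon>. \<forall>q\<in>U. analytic_at S \<epsilon> q \<and> \<epsilon> q \<noteq> 0 \<and>
        (\<forall>\<xi>\<in>tangent_space S q. \<forall>\<eta>\<in>tangent_space S q.
           \<mu>1 q \<xi> * \<mu>2 q \<eta> - \<mu>1 q \<eta> * \<mu>2 q \<xi> =
           \<epsilon> q * monomial_in \<phi> I d12 q *
             (\<xi> (\<lambda>x. \<phi> x $ 1) * \<eta> (\<lambda>x. \<phi> x $ 2) - \<eta> (\<lambda>x. \<phi> x $ 1) * \<xi> (\<lambda>x. \<phi> x $ 2))))"

definition monomialized_everywhere ::
  "('m, 'n::finite) mfd \<Rightarrow> ('m \<Rightarrow> 'm tvec \<Rightarrow> 'm tvec \<Rightarrow> real)
     \<Rightarrow> ('x, 2) mfd \<Rightarrow> ('x \<Rightarrow> 'm) \<Rightarrow> ('x \<Rightarrow> 'm tvec set)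
     \<Rightarrow> ('y, 2) mfd \<Rightarrow> 'y set \<Rightarrow> ('y \<Rightarrow> 'x) \<Rightarrow> bool" where
  "monomialized_everywhere M\<^sub>0 g\<^sub>0 S\<^sub>1 \<sigma> T S E b \<longleftrightarrow>
     (\<forall>a\<in>pts S. \<exists>U \<phi> I \<mu>1 \<mu>2 d1 d2 d12.
        monomial_presentation M\<^sub>0 g\<^sub>0 S\<^sub>1 \<sigma> T S E b a U \<phi> I \<mu>1 \<mu>2 d1 d2 d12)"

text \<open>The normal form
  \<open>\<kappa> = l1 u\<^sup>m du \<otimes> du + l2 u\<^sup>n dv \<otimes> dv + u\<^sup>\<rho> h (du \<otimes> dv + dv \<otimes> du)\<close> near \<open>a\<close>, in
  coordinates \<open>\<phi> = (u, v)\<close> centered at \<open>a\<close> with \<open>E = {u = 0}\<close>. For \<open>m = 2 r\<close>, \<open>n = 2 s + 2 t\<close>, \<open>\<rho> > n\<close>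
  it forces the foliation of \<open>\<mu>\<^sub>1\<close> not to cross \<open>E\<close> at \<open>a\<close>, unless \<open>r = s\<close> and \<open>t = 0\<close>: otherwise
  \<open>\<kappa> / u\<^sup>2\<^sup>r\<close> has rank one along \<open>E\<close>, with kernel that of \<open>\<mu>\<^sub>1\<close> (as computed from the monomial
  presentation) and \<open>T E\<close> (as computed from the normal form). The crossing case does occur when \<open>X\<^sub>0\<close> has a curve of singular
  points: for \<open>x\<^sup>2 = y\<^sup>3\<close> in \<open>\<real>\<^sup>3\<close>, normalised by \<open>(\<tau>, z) \<mapsto> (\<tau>\<^sup>3, \<tau>\<^sup>2, z)\<close>, one has \<open>\<mu>\<^sub>1 = dz\<close>,
  \<open>E = {\<tau> = 0}\<close>, \<open>r = t = 0\<close>, \<open>s = 1\<close>.\<close>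

definition normal_form_at ::
  "('y, 2) mfd \<Rightarrow> 'y set \<Rightarrow> ('y \<Rightarrow> 'y tvec \<Rightarrow> 'y tvec \<Rightarrow> real) \<Rightarrow> 'y \<Rightarrow> nat \<Rightarrow> nat \<Rightarrow> nat \<Rightarrow> bool" where
  "normal_form_at S E \<kappa> a m n \<rho> \<longleftrightarrow>
     (\<exists>U \<phi> l1 l2 h. divisor_chart S E a U \<phi> {1} \<and>
        (\<forall>q\<in>U. analytic_at S l1 q \<and> analytic_at S l2 q \<and> analytic_at S h q \<and>
           l1 q > 0 \<and> l2 q > 0 \<and>
           (\<forall>\<xi>\<in>tangent_space S q. \<forall>\<eta>\<in>tangent_space S q.
              let u = (\<lambda>x. \<phi> x $ 1); v = (\<lambda>x. \<phi> x $ 2) in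
              \<kappa> q \<xi> \<eta> = l1 q * u q ^ m * (\<xi> u * \<eta> u) + l2 q * u q ^ n * (\<xi> v * \<eta> v)
                + u q ^ \<rho> * h q * (\<xi> u * \<eta> v + \<xi> v * \<eta> u))))"

end

theory Submission
  imports Defs
begin

text \<open>Write the pulled-back metric as \<open>u\<^sup>2\<^sup>r (P du\<^sup>2 + 2 F du dv + Q dv\<^sup>2)\<close>. If \<open>r = s\<close> and \<open>t = 0\<close>, the
  bracket is positive definite; keep \<open>u\<close> and replace \<open>v\<close> by a first integral of \<open>\<partial>\<^sub>u - (F / Q) \<partial>\<^sub>v\<close>.
  Otherwise the divisor is invariant for \<open>\<mu>\<^sub>1\<close>, so that \<open>P\<close> is a unit and \<open>F\<close> vanishes on the divisor;
  keep \<open>v\<close> and replace \<open>u\<close> by a first integral of \<open>\<partial>\<^sub>v - (F / P) \<partial>\<^sub>u\<close>, a field that is tangent to the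
  divisor. In both cases the mixed term disappears completely, so \<open>h = 0\<close> serves for every \<open>\<rho>\<close>, and the
  second diagonal coefficient is read off from \<open>P Q - F\<^sup>2 = u\<^sup>2\<^sup>(\<^sup>s\<^sup>-\<^sup>r\<^sup>+\<^sup>t\<^sup>) \<epsilon>\<^sup>2\<close>. Analytic first integrals come from
  Picard iteration in the Banach algebras of power series with finite weighted \<open>l\<^sup>1\<close> norm.\<close>

section \<open>Bounded power series\<close>

text \<open>Which coordinate must move is forced. Put \<open>s = r + k\<close>, so that the bracket
  is the square of \<open>\<mu>1\<close> plus \<open>u ^ (2 * k)\<close> times the square of
  \<open>\<mu>2\<close>. When it is nondegenerate, \<open>F\<close> need not vanish on the divisor,
  and moving \<open>u\<close> could destroy the equation of the divisor; moving \<open>v\<close> is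
  harmless. When it degenerates, \<open>Q\<close> vanishes on the divisor, so only \<open>P\<close>
  can be the pivot and \<open>u\<close> has to move. The new \<open>u\<close> still cuts out the
  divisor because \<open>F\<close> vanishes there: for \<open>k > 0\<close> this comes from the
  \<open>v\<close>-component of \<open>\<mu>1\<close>, and for \<open>k = 0\<close> one has
  \<open>t > 0\<close>, so that the determinant of the two forms vanishes on the divisor and takes
  the \<open>v\<close>-component of \<open>\<mu>2\<close> with it. The coframe describes the metric
  on tangent planes of the surface only off the divisor; the formula crosses the divisor by
  continuity of its coefficients. On the analytic side, a norm at a fixed radius controls integrals
  and substitutions but not derivatives. Derivatives therefore come from division by an added
  variable, and local inverses from a second differential equation.\<close>

definition multi_power :: "real^'n::finite \<Rightarrow> ('n \<Rightarrow> nat) \<Rightarrow> real" where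
  "multi_power y \<alpha> = (\<Prod>i\<in>UNIV. (y $ i) ^ \<alpha> i)"

definition multi_degree :: "('n::finite \<Rightarrow> nat) \<Rightarrow> nat" where
  "multi_degree \<alpha> = (\<Sum>i\<in>UNIV. \<alpha> i)"

definition cube :: "real \<Rightarrow> (real^'n::finite) set" where
  "cube r = {y. \<forall>i. \<bar>y $ i\<bar> \<le> r}"

text \<open>\<open>f\<close> is the sum, on the closed cube of radius \<open>r\<close>, of a power series whose \<open>l\<^sup>1\<close> norm with weights
  \<open>r\<^sup>|\<^sup>\<alpha>\<^sup>|\<close> is at most \<open>N\<close>.\<close>

definition ps_bounded :: "real \<Rightarrow> (real^'n::finite \<Rightarrow> real) \<Rightarrow> real \<Rightarrow> bool" where
  "ps_bounded r f N \<longleftrightarrow> r > 0 \<and>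
     (\<exists>c S. ((\<lambda>\<alpha>. \<bar>c \<alpha>\<bar> * r ^ multi_degree \<alpha>) has_sum S) UNIV \<and> S \<le> N \<and>
        (\<forall>y\<in>cube r. ((\<lambda>\<alpha>. c \<alpha> * multi_power y \<alpha>) has_sum f y) UNIV))"

lemma multi_power_add: "multi_power y (\<lambda>i. \<alpha> i + \<beta> i) = multi_power y \<alpha> * multi_power y \<beta>"
  by (simp add: multi_power_def power_add prod.distrib)

lemma multi_degree_add: "multi_degree (\<lambda>i. \<alpha> i + \<beta> i) = multi_degree \<alpha> + multi_degree \<beta>"
  by (simp add: multi_degree_def sum.distrib)

lemma multi_power_bound:
  assumes "y \<in> cube r" shows "\<bar>multi_power y \<alpha>\<bar> \<le> r ^ multi_degree \<alpha>"
proof -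
  have "\<bar>multi_power y \<alpha>\<bar> = (\<Prod>i\<in>UNIV. \<bar>y $ i\<bar> ^ \<alpha> i)" by (simp add: multi_power_def abs_prod power_abs)
  also have "\<dots> \<le> (\<Prod>i\<in>UNIV. r ^ \<alpha> i)"
    using assms by (intro prod_mono) (auto simp: cube_def power_mono)
  also have "\<dots> = r ^ multi_degree \<alpha>" by (simp add: multi_degree_def power_sum)
  finally show ?thesis .
qed

lemma ps_bounded_pos: "ps_bounded r f N \<Longrightarrow> r > 0" by (simp add: ps_bounded_def)

lemma ps_boundedE:
  assumes "ps_bounded r f N"
  obtains c S where "((\<lambda>\<alpha>. \<bar>c \<alpha>\<bar> * r ^ multi_degree \<alpha>) has_sum S) UNIV" "S \<le> N" "r > 0"
    "\<And>y. y \<in> cube r \<Longrightarrow> ((\<lambda>\<alpha>. c \<alpha> * multi_power y \<alpha>) has_sum f y) UNIV"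
  using assms by (auto simp: ps_bounded_def)

lemma ps_bounded_cong:
  assumes "ps_bounded r f N" "\<And>y. y \<in> cube r \<Longrightarrow> f y = g y" shows "ps_bounded r g N"
proof -
  obtain c S where c: "((\<lambda>\<alpha>. \<bar>c \<alpha>\<bar> * r ^ multi_degree \<alpha>) has_sum S) UNIV" "S \<le> N" "r > 0"
    "\<And>y. y \<in> cube r \<Longrightarrow> ((\<lambda>\<alpha>. c \<alpha> * multi_power y \<alpha>) has_sum f y) UNIV"
    by (rule ps_boundedE[OF assms(1)]) (rule that; assumption)
  then have "((\<lambda>\<alpha>. c \<alpha> * multi_power y \<alpha>) has_sum g y) UNIV" if "y \<in> cube r" for y
    using assms(2)[OF that] that by metis
  then show ?thesis unfolding ps_bounded_def using c(1-3) by blast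
qed

lemma ps_bounded_mono: "ps_bounded r f N \<Longrightarrow> N \<le> N' \<Longrightarrow> ps_bounded r f N'"
  unfolding ps_bounded_def by (meson order_trans)

lemma cube_mono: "r \<le> R \<Longrightarrow> cube r \<subseteq> cube R"
  by (auto simp: cube_def intro: order_trans)

lemma ps_bounded_bound:
  assumes "ps_bounded r f N" "y \<in> cube r" shows "\<bar>f y\<bar> \<le> N"
proof -
  obtain c S where c: "((\<lambda>\<alpha>. \<bar>c \<alpha>\<bar> * r ^ multi_degree \<alpha>) has_sum S) UNIV" "S \<le> N" "r > 0"
    "((\<lambda>\<alpha>. c \<alpha> * multi_power y \<alpha>) has_sum f y) UNIV"
    by (rule ps_boundedE[OF assms(1)]) (use assms(2) in blast)
  have 1: "\<bar>c \<alpha> * multi_power y \<alpha>\<bar> \<le> \<bar>c \<alpha>\<bar> * r ^ multi_degree \<alpha>" for \<alpha>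
    using multi_power_bound[OF assms(2), of \<alpha>] by (simp add: abs_mult mult_left_mono)
  have "f y \<le> S" by (rule has_sum_mono[OF c(4) c(1)]) (use 1 in \<open>auto simp: abs_le_iff\<close>)
  moreover have "- f y \<le> S"
    by (rule has_sum_mono[OF has_sum_cmult_right[OF c(4), of "-1", simplified] c(1)])
      (use 1 in \<open>auto simp: abs_le_iff\<close>)
  ultimately show ?thesis using c(2) by linarith
qed

lemma ps_bounded_nonneg: "ps_bounded r f N \<Longrightarrow> N \<ge> 0"
  using ps_bounded_bound[of r f N 0] ps_bounded_pos[of r f N] by (auto simp: cube_def)

text \<open>The exponents \<open>e i\<close> may repeat, so products and compositions need no formula for their
  coefficients.\<close>

lemma ps_bounded_collect:
  fixes e :: "'i \<Rightarrow> ('n::finite \<Rightarrow> nat)"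
  assumes r: "r > 0" and S: "((\<lambda>i. \<bar>c i\<bar> * r ^ multi_degree (e i)) has_sum S) I" "S \<le> N"
    and f: "\<And>y. y \<in> cube r \<Longrightarrow> ((\<lambda>i. c i * multi_power y (e i)) has_sum f y) I"
  shows "ps_bounded r f N"
proof -
  \<comment> \<open>The coefficient of \<alpha> in the collected series is the sum of
    \<open>c\<close> over the fibre \<open>J \<alpha>\<close>. The triangle inequality inside each
    fibre keeps the weighted norm below \<open>S\<close>, and summing over
    \<open>Sigma UNIV J\<close> merely reindexes \<open>I\<close>.\<close>
  define J where "J = (\<lambda>\<alpha>. {i\<in>I. e i = \<alpha>})"
  have bij: "bij_betw snd (Sigma UNIV J) I"
    by (auto simp: J_def bij_betw_def inj_on_def image_iff)
  have tr: "((\<lambda>p. g (snd p)) has_sum s) (Sigma UNIV J)" if "(g has_sum s) I" for g :: "'i \<Rightarrow> real" and s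
    using that has_sum_reindex_bij_betw[OF bij] by blast
  have abs: "(\<lambda>i. \<bar>c i\<bar>) summable_on J \<alpha>" for \<alpha>
  proof -
    have "(\<lambda>i. \<bar>c i\<bar> * r ^ multi_degree (e i)) summable_on J \<alpha>"
      using S(1) by (rule summable_on_subset_banach[OF has_sum_imp_summable]) (auto simp: J_def)
    then have "(\<lambda>i. \<bar>c i\<bar> * r ^ multi_degree \<alpha>) summable_on J \<alpha>"
      by (rule summable_on_cong[THEN iffD1, rotated]) (auto simp: J_def)
    then show ?thesis using r by (simp add: summable_on_cmult_left')
  qed
  then have sm: "c summable_on J \<alpha>" for \<alpha>
    using summable_on_iff_abs_summable_on_real[of c "J \<alpha>"] by (auto simp: real_norm_def[abs_def])
  define C where "C = (\<lambda>\<alpha>. infsum c (J \<alpha>))"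
  define A where "A = (\<lambda>\<alpha>. infsum (\<lambda>i. \<bar>c i\<bar>) (J \<alpha>))"
  have CA: "\<bar>C \<alpha>\<bar> \<le> A \<alpha>" for \<alpha>
    using norm_infsum_bound[of c "J \<alpha>"] abs[of \<alpha>] by (simp add: C_def A_def)
  have AS: "((\<lambda>\<alpha>. A \<alpha> * r ^ multi_degree \<alpha>) has_sum S) UNIV"
  proof (rule has_sum_SigmaD[OF tr[OF S(1)]])
    fix \<alpha>
    have "((\<lambda>i. \<bar>c i\<bar> * r ^ multi_degree \<alpha>) has_sum (A \<alpha> * r ^ multi_degree \<alpha>)) (J \<alpha>)"
      unfolding A_def by (intro has_sum_cmult_left has_sum_infsum abs)
    then show "((\<lambda>i. \<bar>c (snd (\<alpha>, i))\<bar> * r ^ multi_degree (e (snd (\<alpha>, i)))) has_sum (A \<alpha> * r ^ multi_degree \<alpha>)) (J \<alpha>)"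
      by (rule has_sum_cong[THEN iffD1, rotated]) (auto simp: J_def)
  qed
  have le: "\<bar>C \<alpha>\<bar> * r ^ multi_degree \<alpha> \<le> A \<alpha> * r ^ multi_degree \<alpha>" for \<alpha>
    using CA r by (simp add: mult_right_mono)
  have "(\<lambda>\<alpha>. \<bar>C \<alpha>\<bar> * r ^ multi_degree \<alpha>) summable_on UNIV"
    by (rule summable_on_comparison_test[OF has_sum_imp_summable[OF AS]]) (use le r in auto)
  then obtain S' where S': "((\<lambda>\<alpha>. \<bar>C \<alpha>\<bar> * r ^ multi_degree \<alpha>) has_sum S') UNIV"
    by (auto simp: summable_on_def)
  have "S' \<le> S" by (rule has_sum_mono[OF S' AS]) (use le in auto)
  moreover have "((\<lambda>\<alpha>. C \<alpha> * multi_power y \<alpha>) has_sum f y) UNIV" if "y \<in> cube r" for y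
  proof (rule has_sum_SigmaD[OF tr[OF f[OF that]]])
    fix \<alpha>
    have "((\<lambda>i. c i * multi_power y \<alpha>) has_sum (C \<alpha> * multi_power y \<alpha>)) (J \<alpha>)"
      unfolding C_def by (intro has_sum_cmult_left has_sum_infsum sm)
    then show "((\<lambda>i. c (snd (\<alpha>, i)) * multi_power y (e (snd (\<alpha>, i)))) has_sum (C \<alpha> * multi_power y \<alpha>)) (J \<alpha>)"
      by (rule has_sum_cong[THEN iffD1, rotated]) (auto simp: J_def)
  qed
  moreover have "S' \<le> N" using \<open>S' \<le> S\<close> S(2) by simp
  ultimately show ?thesis unfolding ps_bounded_def using r S' by blast
qed

lemma real_summable_on_comparison:
  fixes f g :: "'a \<Rightarrow> real"
  assumes "g summable_on A" "\<And>x. x \<in> A \<Longrightarrow> \<bar>f x\<bar> \<le> g x"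
  shows "f summable_on A"
proof -
  have "(\<lambda>x. \<bar>f x\<bar>) summable_on A"
    by (rule summable_on_comparison_test[OF assms(1)]) (use assms(2) in auto)
  then show ?thesis
    using summable_on_iff_abs_summable_on_real[of f A] by (simp add: real_norm_def[abs_def])
qed

text \<open>Completeness of the norm: when the norms \<open>N i\<close> are summable, the monomials
  of all \<open>f i\<close> together form an absolutely summable family, which can be collected by
  exponent. The limit \<open>h\<close> need only be known pointwise. Products, substitutions, the
  geometric series and the Picard limit all rest on this.\<close>

lemma ps_bounded_has_sum:
  assumes r: "r > 0" and F: "\<And>i. i \<in> I \<Longrightarrow> ps_bounded r (f i) (N i)" and N: "(N has_sum S) I"
    and h: "\<And>y. y \<in> cube r \<Longrightarrow> ((\<lambda>i. f i y) has_sum h y) I"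
  shows "ps_bounded r h S"
proof -
  define P where "P = (\<lambda>i p. ((\<lambda>\<alpha>. \<bar>fst p \<alpha>\<bar> * r ^ multi_degree \<alpha>) has_sum snd p) UNIV \<and> snd p \<le> N i \<and>
        (\<forall>y\<in>cube r. ((\<lambda>\<alpha>. fst p \<alpha> * multi_power y \<alpha>) has_sum f i y) UNIV))"
  have "\<forall>i\<in>I. \<exists>p. P i p"
    using F by (simp add: ps_bounded_def P_def split_paired_Ex)
  then obtain p where "\<forall>i\<in>I. P i (p i)" by (rule bchoice[THEN exE])
  moreover define c T where "c = (\<lambda>i. fst (p i))" and "T = (\<lambda>i. snd (p i))"
  ultimately have c: "\<And>i. i \<in> I \<Longrightarrow> ((\<lambda>\<alpha>. \<bar>c i \<alpha>\<bar> * r ^ multi_degree \<alpha>) has_sum T i) UNIV"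
    "\<And>i. i \<in> I \<Longrightarrow> T i \<le> N i"
    "\<And>i y. i \<in> I \<Longrightarrow> y \<in> cube r \<Longrightarrow> ((\<lambda>\<alpha>. c i \<alpha> * multi_power y \<alpha>) has_sum f i y) UNIV"
    by (auto simp: P_def)
  have T0: "0 \<le> T i" if "i \<in> I" for i
    using r by (intro has_sum_nonneg[OF c(1)[OF that]]) auto
  have Tsm: "T summable_on I"
    by (rule summable_on_comparison_test[OF has_sum_imp_summable[OF N]]) (use c T0 in auto)
  have T: "(T has_sum infsum T I) I" using Tsm by simp
  have le: "infsum T I \<le> S" by (rule has_sum_mono[OF T N]) (use c in auto)
  have abs: "(\<lambda>p. \<bar>c (fst p) (snd p)\<bar> * r ^ multi_degree (snd p)) summable_on (Sigma I (\<lambda>_. UNIV))"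
    by (rule summable_on_SigmaI[where g=T]) (use c(1) Tsm r in auto)
  show ?thesis
  proof (rule ps_bounded_collect[OF r _ le, where I = "Sigma I (\<lambda>_. UNIV)" and c = "\<lambda>p. c (fst p) (snd p)" and e = snd])
    show "((\<lambda>p. \<bar>c (fst p) (snd p)\<bar> * r ^ multi_degree (snd p)) has_sum infsum T I) (Sigma I (\<lambda>_. UNIV))"
      by (rule has_sum_SigmaI[where g = T, OF _ T abs]) (use c(1) in auto)
    fix y :: "real^'b" assume y: "y \<in> cube r"
    show "((\<lambda>p. c (fst p) (snd p) * multi_power y (snd p)) has_sum h y) (Sigma I (\<lambda>_. UNIV))"
    proof (rule has_sum_SigmaI[where g = "\<lambda>i. f i y"])
      show "(\<lambda>p. c (fst p) (snd p) * multi_power y (snd p)) summable_on (Sigma I (\<lambda>_. UNIV))"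
        by (rule real_summable_on_comparison[OF abs])
          (use multi_power_bound[OF y] in \<open>auto simp: abs_mult mult_left_mono\<close>)
    qed (use c(3) y h in auto)
  qed
qed

section \<open>The algebra operations and their effect on the norm\<close>

lemma ps_bounded_monom:
  assumes "r > 0" shows "ps_bounded r (\<lambda>y. a * multi_power y \<alpha>) (\<bar>a\<bar> * r ^ multi_degree \<alpha>)"
  by (rule ps_bounded_collect[where I = "{()}" and c = "\<lambda>_. a" and e = "\<lambda>_. \<alpha>"])
    (use assms in \<open>auto intro: has_sum_finiteI\<close>)

lemma ps_bounded_const: "r > 0 \<Longrightarrow> ps_bounded r (\<lambda>y. a) \<bar>a\<bar>"
  using ps_bounded_monom[of r a "\<lambda>_. 0"] by (simp add: multi_power_def multi_degree_def)

lemma multi_power_single: "multi_power y (\<lambda>j. if j = i then n else 0) = (y $ i) ^ n"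
  by (simp add: multi_power_def if_distrib[of "\<lambda>n. _ ^ n"] cong: if_cong)

lemma multi_degree_single: "multi_degree (\<lambda>j. if j = i then n else 0) = n"
  by (simp add: multi_degree_def)

lemma ps_bounded_coord: "r > 0 \<Longrightarrow> ps_bounded r (\<lambda>y. y $ i) r"
  using ps_bounded_monom[of r 1 "\<lambda>j. if j = i then 1 else 0"] by (simp add: multi_power_single multi_degree_single)

lemma ps_bounded_sum:
  assumes "finite I" "r > 0" "\<And>i. i \<in> I \<Longrightarrow> ps_bounded r (f i) (N i)"
  shows "ps_bounded r (\<lambda>y. \<Sum>i\<in>I. f i y) (\<Sum>i\<in>I. N i)"
  by (rule ps_bounded_has_sum[OF assms(2,3)]) (use assms(1) in \<open>auto intro: has_sum_finiteI\<close>)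

lemma ps_bounded_add:
  assumes "ps_bounded r f M" "ps_bounded r g N" shows "ps_bounded r (\<lambda>y. f y + g y) (M + N)"
proof -
  have "ps_bounded r (\<lambda>y. \<Sum>b\<in>UNIV. (if b then f else g) y) (\<Sum>b\<in>UNIV. if b then M else N)"
    by (rule ps_bounded_sum) (use assms ps_bounded_pos in auto)
  then show ?thesis by (simp add: UNIV_bool add.commute)
qed

lemma ps_bounded_monom_mult:
  assumes "ps_bounded r f N" shows "ps_bounded r (\<lambda>y. a * multi_power y \<alpha> * f y) (\<bar>a\<bar> * r ^ multi_degree \<alpha> * N)"
proof -
  obtain c S where c: "((\<lambda>\<beta>. \<bar>c \<beta>\<bar> * r ^ multi_degree \<beta>) has_sum S) UNIV" "S \<le> N" "r > 0"
    "\<And>y. y \<in> cube r \<Longrightarrow> ((\<lambda>\<beta>. c \<beta> * multi_power y \<beta>) has_sum f y) UNIV"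
    by (rule ps_boundedE[OF assms(1)]) (rule that; assumption)
  show ?thesis
  proof (rule ps_bounded_collect[where I = UNIV and c = "\<lambda>\<beta>. a * c \<beta>" and e = "\<lambda>\<beta> i. \<alpha> i + \<beta> i"])
    show "((\<lambda>\<beta>. \<bar>a * c \<beta>\<bar> * r ^ multi_degree (\<lambda>i. \<alpha> i + \<beta> i)) has_sum (\<bar>a\<bar> * r ^ multi_degree \<alpha> * S)) UNIV"
      using has_sum_cmult_right[OF c(1), of "\<bar>a\<bar> * r ^ multi_degree \<alpha>"]
      by (simp add: multi_degree_add power_add abs_mult mult_ac)
    show "((\<lambda>\<beta>. a * c \<beta> * multi_power y (\<lambda>i. \<alpha> i + \<beta> i)) has_sum (a * multi_power y \<alpha> * f y)) UNIV"
      if "y \<in> cube r" for y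
      using has_sum_cmult_right[OF c(4)[OF that], of "a * multi_power y \<alpha>"]
      by (simp add: multi_power_add mult_ac)
  qed (use c in \<open>auto intro: mult_left_mono\<close>)
qed

text \<open>Submultiplicativity without a Cauchy product: only \<open>f\<close> is expanded, and the
  product is the convergent sum of the monomial multiples of \<open>g\<close>, whose norms
  \<open>ps_bounded_monom_mult\<close> controls.\<close>

lemma ps_bounded_mult:
  assumes "ps_bounded r f M" "ps_bounded r g N" shows "ps_bounded r (\<lambda>y. f y * g y) (M * N)"
proof -
  obtain c S where c: "((\<lambda>\<beta>. \<bar>c \<beta>\<bar> * r ^ multi_degree \<beta>) has_sum S) UNIV" "S \<le> M" "r > 0"
    "\<And>y. y \<in> cube r \<Longrightarrow> ((\<lambda>\<beta>. c \<beta> * multi_power y \<beta>) has_sum f y) UNIV"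
    by (rule ps_boundedE[OF assms(1)]) (rule that; assumption)
  have "ps_bounded r (\<lambda>y. f y * g y) (S * N)"
    by (rule ps_bounded_has_sum[OF c(3) ps_bounded_monom_mult[OF assms(2)] has_sum_cmult_left[OF c(1)] has_sum_cmult_left[OF c(4)]])
  then show ?thesis by (rule ps_bounded_mono) (use c ps_bounded_nonneg[OF assms(2)] in \<open>auto intro: mult_right_mono\<close>)
qed

lemma ps_bounded_cmult: "ps_bounded r f N \<Longrightarrow> ps_bounded r (\<lambda>y. a * f y) (\<bar>a\<bar> * N)"
  using ps_bounded_mult[OF ps_bounded_const] ps_bounded_pos by blast

lemma ps_bounded_diff:
  assumes "ps_bounded r f M" "ps_bounded r g N" shows "ps_bounded r (\<lambda>y. f y - g y) (M + N)"
  using ps_bounded_add[OF assms(1) ps_bounded_cmult[OF assms(2), of "-1"]] by simp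

lemma ps_bounded_power: "ps_bounded r f N \<Longrightarrow> ps_bounded r (\<lambda>y. f y ^ n) (N ^ n)"
proof (induction n)
  case 0 then show ?case using ps_bounded_const[of r 1] ps_bounded_pos by auto
next
  case (Suc n) then show ?case using ps_bounded_mult[of r f N "\<lambda>y. f y ^ n" "N ^ n"] by simp
qed

lemma ps_bounded_prod:
  assumes "finite I" "r > 0" "\<And>i. i \<in> I \<Longrightarrow> ps_bounded r (f i) (N i)"
  shows "ps_bounded r (\<lambda>y. \<Prod>i\<in>I. f i y) (\<Prod>i\<in>I. N i)"
  using assms
proof (induction I rule: finite_induct)
  case empty then show ?case using ps_bounded_const[of r 1] by simp
next
  case (insert x F) then show ?case
    using ps_bounded_mult[of r "f x" "N x" "\<lambda>y. \<Prod>i\<in>F. f i y" "\<Prod>i\<in>F. N i"] by simp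
qed

text \<open>A monomial of degree \<open>d\<close> in the components of \<open>h\<close> has norm at
  most \<open>R ^ d\<close>, which is exactly the weight it carries in the norm of \<open>F\<close>;
  so substitution does not increase the norm. Smaller cubes, translations and restriction to graphs
  are all instances.\<close>

lemma ps_bounded_compose:
  fixes F :: "real^'k::finite \<Rightarrow> real" and h :: "real^'n::finite \<Rightarrow> real^'k"
  assumes F: "ps_bounded R F M" and r: "r > 0" and h: "\<And>k. ps_bounded r (\<lambda>y. h y $ k) (N k)" "\<And>k. N k \<le> R"
  shows "ps_bounded r (\<lambda>y. F (h y)) M"
proof -
  obtain c S where c: "((\<lambda>\<beta>. \<bar>c \<beta>\<bar> * R ^ multi_degree \<beta>) has_sum S) UNIV" "S \<le> M" "R > 0"
    "\<And>y. y \<in> cube R \<Longrightarrow> ((\<lambda>\<beta>. c \<beta> * multi_power y \<beta>) has_sum F y) UNIV"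
    by (rule ps_boundedE[OF F]) (rule that; assumption)
  have hR: "ps_bounded r (\<lambda>y. h y $ k) R" for k by (rule ps_bounded_mono[OF h(1) h(2)])
  have "ps_bounded r (\<lambda>y. F (h y)) S"
  proof (rule ps_bounded_has_sum[OF r _ c(1)])
    fix \<beta> :: "'k \<Rightarrow> nat"
    have "ps_bounded r (\<lambda>y. \<Prod>k\<in>UNIV. (h y $ k) ^ \<beta> k) (\<Prod>k\<in>UNIV. R ^ \<beta> k)"
      by (rule ps_bounded_prod) (use r ps_bounded_power[OF hR] in auto)
    then have "ps_bounded r (\<lambda>y. multi_power (h y) \<beta>) (R ^ multi_degree \<beta>)"
      by (simp add: multi_power_def multi_degree_def power_sum)
    then show "ps_bounded r (\<lambda>y. c \<beta> * multi_power (h y) \<beta>) (\<bar>c \<beta>\<bar> * R ^ multi_degree \<beta>)"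
      by (rule ps_bounded_cmult)
  next
    fix y :: "real^'n" assume "y \<in> cube r"
    then have "h y \<in> cube R" using ps_bounded_bound[OF hR] by (auto simp: cube_def)
    then show "((\<lambda>\<beta>. c \<beta> * multi_power (h y) \<beta>) has_sum F (h y)) UNIV" by (rule c(4))
  qed
  then show ?thesis by (rule ps_bounded_mono) (rule c)
qed

lemma ps_bounded_restrict: "ps_bounded R f M \<Longrightarrow> 0 < r \<Longrightarrow> r \<le> R \<Longrightarrow> ps_bounded r f M"
  using ps_bounded_compose[of R f M r "\<lambda>y. y" "\<lambda>_. r"] ps_bounded_coord by blast

lemma multi_power_zero: "multi_power 0 \<alpha> = (if \<alpha> = (\<lambda>_. 0) then 1 else 0)"
  by (auto simp: multi_power_def power_0_left prod_zero_iff fun_eq_iff)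

text \<open>Without a constant term every monomial has degree at least one, so shrinking the radius
  from \<open>R\<close> to \<open>r\<close> gains the factor \<open>r / R\<close>. This is how
  functions vanishing at the origin become small in norm.\<close>

lemma ps_bounded_scale:
  fixes f :: "real^'n::finite \<Rightarrow> real"
  assumes F: "ps_bounded R f M" and r: "0 < r" "r \<le> R" and f0: "f 0 = 0"
  shows "ps_bounded r f (M * r / R)"
proof -
  obtain c S where c: "((\<lambda>\<beta>. \<bar>c \<beta>\<bar> * R ^ multi_degree \<beta>) has_sum S) UNIV" "S \<le> M" "R > 0"
    "\<And>y. y \<in> cube R \<Longrightarrow> ((\<lambda>\<beta>. c \<beta> * multi_power y \<beta>) has_sum f y) UNIV"
    by (rule ps_boundedE[OF F]) (rule that; assumption)
  have "((\<lambda>\<beta>. c \<beta> * multi_power 0 \<beta>) has_sum c (\<lambda>_. 0)) UNIV"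
    by (rule has_sum_finite_neutralI[where B = "{\<lambda>_. 0}"]) (auto simp: multi_power_zero)
  moreover have "((\<lambda>\<beta>. c \<beta> * multi_power 0 \<beta>) has_sum f 0) UNIV"
    by (rule c(4)) (use c in \<open>auto simp: cube_def\<close>)
  ultimately have c0: "c (\<lambda>_. 0) = 0" using f0 has_sum_unique by metis
  have le: "\<bar>c \<beta>\<bar> * r ^ multi_degree \<beta> \<le> \<bar>c \<beta>\<bar> * R ^ multi_degree \<beta> * (r / R)" for \<beta>
  proof (cases "\<beta> = (\<lambda>_. 0)")
    case False
    then have "multi_degree \<beta> > 0" by (auto simp: multi_degree_def fun_eq_iff sum_nonneg_eq_0_iff intro: ccontr)
    then obtain m where m: "multi_degree \<beta> = Suc m" by (cases "multi_degree \<beta>") auto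
    have "r ^ m \<le> R ^ m" using r by (simp add: power_mono)
    then show ?thesis using c(3) r m by (auto simp: mult_left_mono)
  qed (simp add: c0)
  have sS: "((\<lambda>\<beta>. \<bar>c \<beta>\<bar> * R ^ multi_degree \<beta> * (r / R)) has_sum (S * (r / R))) UNIV"
    by (rule has_sum_cmult_left[OF c(1)])
  have "(\<lambda>\<beta>. \<bar>c \<beta>\<bar> * r ^ multi_degree \<beta>) summable_on UNIV"
    by (rule summable_on_comparison_test[OF has_sum_imp_summable[OF sS]]) (use le r in auto)
  then obtain T where T: "((\<lambda>\<beta>. \<bar>c \<beta>\<bar> * r ^ multi_degree \<beta>) has_sum T) UNIV" by (auto simp: summable_on_def)
  have "T \<le> S * (r / R)" by (rule has_sum_mono[OF T sS]) (use le in auto)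
  also have "\<dots> \<le> M * (r / R)" using c r by (intro mult_right_mono) auto
  finally have "T \<le> M * r / R" by simp
  then show ?thesis
    unfolding ps_bounded_def using T r c(4) cube_mono[OF r(2)] by blast
qed

lemma ps_bounded_shift:
  assumes "ps_bounded R f M" "\<And>i. \<bar>x $ i\<bar> \<le> R - r" "r > 0"
  shows "ps_bounded r (\<lambda>y. f (x + y)) M"
proof (rule ps_bounded_compose[OF assms(1,3)])
  show "ps_bounded r (\<lambda>y. (x + y) $ k) (\<bar>x $ k\<bar> + r)" for k
    using ps_bounded_add[OF ps_bounded_const ps_bounded_coord, OF assms(3) assms(3), of "x $ k" k] by simp
  show "\<bar>x $ k\<bar> + r \<le> R" for k using assms(2)[of k] by simp
qed

text \<open>Division with remainder by a coordinate, read off the series: the monomials containing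
  \<open>y $ i\<close> are split off, and lowering that exponent by one costs the factor
  \<open>1 / R\<close>. Unlike differentiation, this does not shrink the radius.\<close>

lemma ps_bounded_hadamard:
  fixes f :: "real^'n::finite \<Rightarrow> real"
  assumes F: "ps_bounded R f M"
  obtains g where "ps_bounded R g (M / R)"
    "\<And>y. y \<in> cube R \<Longrightarrow> f y = f (\<chi> j. if j = i then 0 else y $ j) + y $ i * g y"
proof -
  obtain c S where c: "((\<lambda>\<beta>. \<bar>c \<beta>\<bar> * R ^ multi_degree \<beta>) has_sum S) UNIV" "S \<le> M" "R > 0"
    "\<And>y. y \<in> cube R \<Longrightarrow> ((\<lambda>\<beta>. c \<beta> * multi_power y \<beta>) has_sum f y) UNIV"
    by (rule ps_boundedE[OF F]) (rule that; assumption)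
  define I where "I = {\<beta> :: 'n \<Rightarrow> nat. \<beta> i > 0}"
  define e where "e = (\<lambda>(\<beta>::'n \<Rightarrow> nat) j. if j = i then \<beta> j - 1 else \<beta> j)"
  have split: "\<beta> = (\<lambda>j. (if j = i then 1 else 0) + e \<beta> j)" if "\<beta> \<in> I" for \<beta>
    using that by (auto simp: I_def e_def fun_eq_iff)
  have mp: "multi_power y \<beta> = y $ i * multi_power y (e \<beta>)" if "\<beta> \<in> I" for y \<beta>
    by (subst split[OF that], subst multi_power_add) (simp add: multi_power_single)
  have md: "multi_degree \<beta> = Suc (multi_degree (e \<beta>))" if "\<beta> \<in> I" for \<beta>
    by (subst split[OF that], subst multi_degree_add) (simp add: multi_degree_single)
  have cI: "(\<lambda>\<beta>. \<bar>c \<beta>\<bar> * R ^ multi_degree \<beta>) summable_on I"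
    by (rule summable_on_subset_banach[OF has_sum_imp_summable[OF c(1)]]) auto
  then obtain T where T: "((\<lambda>\<beta>. \<bar>c \<beta>\<bar> * R ^ multi_degree \<beta>) has_sum T) I" by (auto simp: summable_on_def)
  have "T \<le> S" by (rule has_sum_mono2[OF T c(1)]) (use c in auto)
  have "((\<lambda>\<beta>. \<bar>c \<beta>\<bar> * R ^ multi_degree \<beta> * (1 / R)) has_sum (T * (1 / R))) I"
    by (rule has_sum_cmult_left[OF T])
  then have T': "((\<lambda>\<beta>. \<bar>c \<beta>\<bar> * R ^ multi_degree (e \<beta>)) has_sum (T / R)) I"
    by (subst (asm) has_sum_cong[where g = "\<lambda>\<beta>. \<bar>c \<beta>\<bar> * R ^ multi_degree (e \<beta>)"]) (use md c(3) in auto)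
  define g where "g = (\<lambda>y. infsum (\<lambda>\<beta>. c \<beta> * multi_power y (e \<beta>)) I)"
  have gs: "((\<lambda>\<beta>. c \<beta> * multi_power y (e \<beta>)) has_sum g y) I" if "y \<in> cube R" for y
  proof -
    have "(\<lambda>\<beta>. c \<beta> * multi_power y (e \<beta>)) summable_on I"
      by (rule real_summable_on_comparison[OF has_sum_imp_summable[OF T']])
        (use multi_power_bound[OF that] in \<open>auto simp: abs_mult mult_left_mono\<close>)
    then show ?thesis unfolding g_def by (rule has_sum_infsum)
  qed
  have "ps_bounded R g (M / R)"
    by (rule ps_bounded_collect[OF c(3) T' _ gs]) (use \<open>T \<le> S\<close> c in \<open>auto simp: divide_right_mono\<close>)
  moreover have "f y = f (\<chi> j. if j = i then 0 else y $ j) + y $ i * g y" if y: "y \<in> cube R" for y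
  proof -
    let ?y = "\<chi> j. if j = i then 0 else y $ j"
    have y': "?y \<in> cube R" using y c(3) by (auto simp: cube_def)
    have 1: "((\<lambda>\<beta>. c \<beta> * multi_power y \<beta>) has_sum (y $ i * g y)) I"
      using has_sum_cmult_right[OF gs[OF y], of "y $ i"]
      by (subst has_sum_cong[where g = "\<lambda>\<beta>. y $ i * (c \<beta> * multi_power y (e \<beta>))"]) (use mp in auto)
    have 0: "multi_power ?y \<beta> = (if \<beta> \<in> I then 0 else multi_power y \<beta>)" for \<beta>
    proof (cases "\<beta> \<in> I")
      case True then show ?thesis using mp[OF True, of ?y] by simp
    next
      case False then show ?thesis
        by (auto simp: multi_power_def I_def intro!: prod.cong)
    qed
    have 2: "((\<lambda>\<beta>. c \<beta> * multi_power y \<beta>) has_sum (f ?y)) (UNIV - I)"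
      using c(4)[OF y'] by (rule has_sum_cong_neutral[THEN iffD1, rotated -1]) (auto simp: 0)
    have "((\<lambda>\<beta>. c \<beta> * multi_power y \<beta>) has_sum (f ?y + y $ i * g y)) ((UNIV - I) \<union> I)"
      by (rule has_sum_Un_disjoint[OF 2 1]) auto
    then show ?thesis using c(4)[OF y] has_sum_unique by simp blast
  qed
  ultimately show ?thesis by (rule that)
qed

section \<open>Real analytic functions\<close>

lemma open_cube: "open {y :: real^'n::finite. \<forall>i. \<bar>y $ i\<bar> < r}"
proof -
  have "{y :: real^'n. \<forall>i. \<bar>y $ i\<bar> < r} = (\<Inter>i. {y. \<bar>y $ i\<bar> < r})" by auto
  also have "open \<dots>"
    by (intro open_INT) (auto intro!: open_Collect_less continuous_intros)
  finally show ?thesis .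
qed

lemma eventually_cube:
  fixes x :: "real^'n::finite"
  assumes "r > 0" shows "eventually (\<lambda>y. y - x \<in> cube r) (nhds x)"
proof -
  have "open ((\<lambda>y. y - x) -` {y. \<forall>i. \<bar>y $ i\<bar> < r})"
    by (intro open_vimage open_cube continuous_intros)
  then show ?thesis
    unfolding eventually_nhds using assms by (intro exI conjI) (auto simp: cube_def less_imp_le)
qed

text \<open>The definition of analyticity speaks of a Euclidean ball and of convergence alone; this
  criterion trades the ball for a cube and convergence for a norm bound, after which all estimates
  are in norm.\<close>

lemma real_analytic_at_iff_ps_bounded:
  fixes x :: "real^'n::finite"
  shows "real_analytic_at f x \<longleftrightarrow> (\<exists>r N. ps_bounded r (\<lambda>y. f (x + y)) N)"
proof
  assume "real_analytic_at f x"
  then obtain c R where R: "R > 0"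
    "\<And>y. y \<in> ball x R \<Longrightarrow> ((\<lambda>\<alpha>. c \<alpha> * (\<Prod>i\<in>UNIV. (y $ i - x $ i) ^ \<alpha> i)) has_sum f y) UNIV"
    unfolding real_analytic_at_def by blast
  \<comment> \<open>The Euclidean norm is at most \<open>CARD('n)\<close> times the largest
    coordinate, so a cube of this radius fits into the ball; the \<open>+ 1\<close> makes the
    inequality strict.\<close>
  define r where "r = R / (real CARD('n) + 1)"
  have r: "r > 0" using R(1) by (simp add: r_def)
  have cb: "norm y < R" if "y \<in> cube r" for y :: "real^'n"
  proof -
    have "norm y \<le> (\<Sum>i\<in>UNIV. \<bar>y $ i\<bar>)" by (rule norm_le_l1_cart)
    also have "\<dots> \<le> (\<Sum>i\<in>(UNIV::'n set). r)" using that by (intro sum_mono) (auto simp: cube_def)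
    also have "\<dots> = real CARD('n) * r" by simp
    also have "\<dots> < R" using R(1) by (simp add: r_def field_simps)
    finally show ?thesis .
  qed
  have s: "((\<lambda>\<alpha>. c \<alpha> * multi_power y \<alpha>) has_sum f (x + y)) UNIV" if "y \<in> cube r" for y
    using R(2)[of "x + y"] cb[OF that] by (simp add: multi_power_def dist_norm)
  \<comment> \<open>At this corner of the cube each monomial equals its weight
    \<open>r ^ multi_degree \<alpha>\<close>, and unconditional summability of reals is absolute.
    Convergence at this single point is therefore already the norm bound.\<close>
  let ?v = "\<chi> i. r :: real^'n"
  have "?v \<in> cube r" using r by (auto simp: cube_def)
  from s[OF this] have "(\<lambda>\<alpha>. c \<alpha> * multi_power ?v \<alpha>) summable_on UNIV" by (rule has_sum_imp_summable)
  then have "(\<lambda>\<alpha>. norm (c \<alpha> * multi_power ?v \<alpha>)) summable_on UNIV"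
    by (rule summable_on_iff_abs_summable_on_real[THEN iffD1])
  then have "(\<lambda>\<alpha>. \<bar>c \<alpha>\<bar> * r ^ multi_degree \<alpha>) summable_on UNIV"
    using r by (simp add: abs_mult multi_power_def multi_degree_def power_sum abs_prod power_abs)
  then obtain S where "((\<lambda>\<alpha>. \<bar>c \<alpha>\<bar> * r ^ multi_degree \<alpha>) has_sum S) UNIV" by (auto simp: summable_on_def)
  with s r have "ps_bounded r (\<lambda>y. f (x + y)) S" unfolding ps_bounded_def by blast
  then show "\<exists>r N. ps_bounded r (\<lambda>y. f (x + y)) N" by blast
next
  assume "\<exists>r N. ps_bounded r (\<lambda>y. f (x + y)) N"
  then obtain r N where p: "ps_bounded r (\<lambda>y. f (x + y)) N" by blast
  obtain c S where c: "((\<lambda>\<alpha>. \<bar>c \<alpha>\<bar> * r ^ multi_degree \<alpha>) has_sum S) UNIV" "S \<le> N" "r > 0"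
    "\<And>y. y \<in> cube r \<Longrightarrow> ((\<lambda>\<alpha>. c \<alpha> * multi_power y \<alpha>) has_sum f (x + y)) UNIV"
    by (rule ps_boundedE[OF p]) (rule that; assumption)
  show "real_analytic_at f x"
    unfolding real_analytic_at_def
  proof (intro exI conjI ballI)
    fix y assume "y \<in> ball x r"
    then have "norm (y - x) < r" by (simp add: dist_norm norm_minus_commute)
    then have "y - x \<in> cube r" using component_le_norm_cart[of "y - x"]
      by (auto simp: cube_def intro: order_trans less_imp_le)
    from c(4)[OF this] show "((\<lambda>\<alpha>. c \<alpha> * (\<Prod>i\<in>UNIV. (y $ i - x $ i) ^ \<alpha> i)) has_sum f y) UNIV"
      by (simp add: multi_power_def)
  qed (rule c(3))
qed

lemma real_analytic_atI: "ps_bounded r (\<lambda>y. f (x + y)) N \<Longrightarrow> real_analytic_at f x"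
  unfolding real_analytic_at_iff_ps_bounded by (intro exI)

lemma real_analytic_at_cong:
  assumes "real_analytic_at f x" "eventually (\<lambda>y. f y = g y) (nhds x)"
  shows "real_analytic_at g x"
proof -
  obtain c r where r: "r > 0" "\<forall>y\<in>ball x r. ((\<lambda>\<alpha>. c \<alpha> * (\<Prod>i\<in>UNIV. (y $ i - x $ i) ^ \<alpha> i)) has_sum f y) UNIV"
    using assms(1) unfolding real_analytic_at_def by blast
  obtain d where d: "d > 0" "\<And>y. dist y x < d \<Longrightarrow> f y = g y"
    using assms(2) unfolding eventually_nhds_metric by blast
  have "\<forall>y\<in>ball x (min r d). ((\<lambda>\<alpha>. c \<alpha> * (\<Prod>i\<in>UNIV. (y $ i - x $ i) ^ \<alpha> i)) has_sum g y) UNIV"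
  proof
    fix y assume "y \<in> ball x (min r d)"
    then have y: "y \<in> ball x r" "f y = g y" using d(2)[of y] by (auto simp: dist_commute)
    from r(2)[rule_format, OF y(1)] show "((\<lambda>\<alpha>. c \<alpha> * (\<Prod>i\<in>UNIV. (y $ i - x $ i) ^ \<alpha> i)) has_sum g y) UNIV"
      unfolding y(2) .
  qed
  then show ?thesis unfolding real_analytic_at_def using r(1) d(1)
    by (intro exI[of _ c] exI[of _ "min r d"]) auto
qed

text \<open>Continuity in norm: once the value at \<open>x\<close> is removed,
  \<open>ps_bounded_scale\<close> makes the norm, and not just the supremum, smaller than
  \<open>e\<close> on every sufficiently small cube.\<close>

lemma real_analytic_at_small:
  assumes "real_analytic_at f x" "e > 0"
  obtains r where "r > 0" "\<And>s. 0 < s \<Longrightarrow> s \<le> r \<Longrightarrow> ps_bounded s (\<lambda>y. f (x + y) - f x) e"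
proof -
  obtain R M where M: "ps_bounded R (\<lambda>y. f (x + y)) M" using assms(1) real_analytic_at_iff_ps_bounded by blast
  have R: "R > 0" using ps_bounded_pos[OF M] .
  define K where "K = M + \<bar>f x\<bar>"
  have K: "ps_bounded R (\<lambda>y. f (x + y) - f x) K"
    using ps_bounded_diff[OF M ps_bounded_const[OF R]] by (simp add: K_def)
  have K0: "K \<ge> 0" using ps_bounded_nonneg[OF K] .
  define r where "r = min R (e * R / (K + 1))"
  have r: "r > 0" "r \<le> R" using R K0 assms(2) by (auto simp: r_def)
  have "r \<le> e * R / (K + 1)" by (simp add: r_def)
  then have r3: "r * (K + 1) \<le> e * R" using K0 by (subst (asm) pos_le_divide_eq) auto
  show ?thesis
  proof (rule that[OF r(1)])
    fix s assume s: "0 < s" "s \<le> r"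
    have "ps_bounded s (\<lambda>y. f (x + y) - f x) (K * s / R)"
      by (rule ps_bounded_scale[OF K]) (use s r in auto)
    moreover have "K * s / R \<le> e"
    proof -
      have "K * s \<le> K * r" using s K0 by (intro mult_left_mono) auto
      also have "\<dots> \<le> e * R" using r r3 by (simp add: algebra_simps)
      finally show ?thesis using R by (simp add: field_simps)
    qed
    ultimately show "ps_bounded s (\<lambda>y. f (x + y) - f x) e" by (rule ps_bounded_mono)
  qed
qed

lemma real_analytic_at_imp_isCont:
  assumes "real_analytic_at f x" shows "isCont f x"
  unfolding continuous_at_eps_delta
proof (intro allI impI)
  fix e :: real assume "e > 0"
  then obtain r where r: "r > 0" "ps_bounded r (\<lambda>y. f (x + y) - f x) (e / 2)"
    using real_analytic_at_small[OF assms, of "e/2"] by (metis half_gt_zero order_refl)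
  have "eventually (\<lambda>y. y - x \<in> cube r) (nhds x)" by (rule eventually_cube[OF r(1)])
  then have "eventually (\<lambda>y. dist (f y) (f x) < e) (nhds x)"
  proof eventually_elim
    case (elim y)
    from ps_bounded_bound[OF r(2) elim] show ?case using \<open>e > 0\<close> by (simp add: dist_real_def)
  qed
  then show "\<exists>d>0. \<forall>x'. dist x' x < d \<longrightarrow> dist (f x') (f x) < e"
    unfolding eventually_nhds_metric by blast
qed

lemma real_analytic_at_eventually:
  assumes "real_analytic_at f x" shows "eventually (real_analytic_at f) (nhds x)"
proof -
  obtain R M where M: "ps_bounded R (\<lambda>y. f (x + y)) M" using assms real_analytic_at_iff_ps_bounded by blast
  have R: "R > 0" using ps_bounded_pos[OF M] .
  have "eventually (\<lambda>y. y - x \<in> cube (R/2)) (nhds x)" by (rule eventually_cube) (use R in simp)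
  then show ?thesis
  proof eventually_elim
    case (elim y)
    have "ps_bounded (R/2) (\<lambda>z. f (x + ((y - x) + z))) M"
      by (rule ps_bounded_shift[OF M]) (use elim R in \<open>auto simp: cube_def\<close>)
    then have "ps_bounded (R/2) (\<lambda>z. f (y + z)) M" by (simp add: add.assoc[symmetric])
    then show ?case by (rule real_analytic_atI)
  qed
qed

section \<open>Closure properties of analytic functions\<close>

lemma real_analytic_at_const [simp]: "real_analytic_at (\<lambda>_. c) x"
  using ps_bounded_const[of 1 c] by (intro real_analytic_atI) auto

text \<open>Recentring at \<open>h x\<close> and shrinking the cube until the components of
  \<open>h - h x\<close> have norm at most the radius of \<open>F\<close> reduces this to
  substitution of series.\<close>

lemma real_analytic_at_compose:
  fixes F :: "real^'k::finite \<Rightarrow> real" and h :: "real^'n::finite \<Rightarrow> real^'k"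
  assumes F: "real_analytic_at F (h x)" and h: "\<And>k. real_analytic_at (\<lambda>y. h y $ k) x"
  shows "real_analytic_at (\<lambda>y. F (h y)) x"
proof -
  obtain R M where M: "ps_bounded R (\<lambda>y. F (h x + y)) M" using F real_analytic_at_iff_ps_bounded by blast
  have R: "R > 0" using ps_bounded_pos[OF M] .
  have "\<exists>r>0. \<forall>s. 0 < s \<longrightarrow> s \<le> r \<longrightarrow> ps_bounded s (\<lambda>y. h (x + y) $ k - h x $ k) R" for k
    using real_analytic_at_small[OF h R] by metis
  then obtain r where r: "\<And>k. r k > 0"
    "\<And>k s. 0 < s \<Longrightarrow> s \<le> r k \<Longrightarrow> ps_bounded s (\<lambda>y. h (x + y) $ k - h x $ k) R" by metis
  define s where "s = Min (range r)"
  have s: "s > 0" "\<And>k. s \<le> r k" using r(1) by (auto simp: s_def)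
  have "ps_bounded s (\<lambda>y. F (h x + (\<chi> k. h (x + y) $ k - h x $ k))) M"
    by (rule ps_bounded_compose[OF M s(1), where N = "\<lambda>_. R"]) (use r(2)[OF s] in auto)
  moreover have "h x + (\<chi> k. h (x + y) $ k - h x $ k) = h (x + y)" for y
    by (simp add: vec_eq_iff)
  ultimately show ?thesis by (intro real_analytic_atI) simp
qed

lemma real_analytic_at_common_radius:
  assumes "real_analytic_at f x" "real_analytic_at g x"
  obtains r M N where "ps_bounded r (\<lambda>y. f (x + y)) M" "ps_bounded r (\<lambda>y. g (x + y)) N"
proof -
  obtain R M where M: "ps_bounded R (\<lambda>y. f (x + y)) M" using assms(1) real_analytic_at_iff_ps_bounded by blast
  obtain S N where N: "ps_bounded S (\<lambda>y. g (x + y)) N" using assms(2) real_analytic_at_iff_ps_bounded by blast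
  show ?thesis
    by (rule that[of "min R S" M N]; rule ps_bounded_restrict[OF M] ps_bounded_restrict[OF N])
      (use ps_bounded_pos[OF M] ps_bounded_pos[OF N] in auto)
qed

lemma real_analytic_at_add:
  "real_analytic_at f x \<Longrightarrow> real_analytic_at g x \<Longrightarrow> real_analytic_at (\<lambda>y. f y + g y) x"
  by (rule real_analytic_at_common_radius, assumption, assumption, rule real_analytic_atI, rule ps_bounded_add)

lemma real_analytic_at_mult:
  "real_analytic_at f x \<Longrightarrow> real_analytic_at g x \<Longrightarrow> real_analytic_at (\<lambda>y. f y * g y) x"
  by (rule real_analytic_at_common_radius, assumption, assumption, rule real_analytic_atI, rule ps_bounded_mult)

lemma real_analytic_at_uminus:
  fixes f :: "real^'n::finite \<Rightarrow> real"
  shows "real_analytic_at f x \<Longrightarrow> real_analytic_at (\<lambda>y. - f y) x"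
  using real_analytic_at_mult[OF real_analytic_at_const[of "-1" x], of f] by simp

lemma real_analytic_at_power:
  "real_analytic_at f x \<Longrightarrow> real_analytic_at (\<lambda>y. f y ^ n) x"
proof (induction n)
  case (Suc n) then show ?case using real_analytic_at_mult[of f x "\<lambda>y. f y ^ n"] by simp
qed simp

lemma real_analytic_at_coord: "real_analytic_at (\<lambda>y. y $ i) (x :: real^'n::finite)"
proof (rule real_analytic_atI)
  show "ps_bounded 1 (\<lambda>y. (x + y) $ i) (\<bar>x $ i\<bar> + 1)"
    using ps_bounded_add[OF ps_bounded_const ps_bounded_coord, of 1 "x $ i" i] by simp
qed

lemma real_analytic_at_inverse:
  fixes f :: "real^'n::finite \<Rightarrow> real"
  assumes f: "real_analytic_at f x" and f0: "f x \<noteq> 0"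
  shows "real_analytic_at (\<lambda>y. inverse (f y)) x"
proof -
  have "\<bar>f x\<bar> / 2 > 0" using f0 by simp
  from real_analytic_at_small[OF f this] obtain r where r: "r > 0"
    "ps_bounded r (\<lambda>y. f (x + y) - f x) (\<bar>f x\<bar> / 2)" by (metis order_refl)
  \<comment> \<open>Near \<open>x\<close> the function is \<open>f x * (1 - q)\<close> with
    \<open>q\<close> of norm at most 1/2, so its inverse is a geometric series of norm at most 2, up
    to the constant \<open>inverse (f x)\<close>.\<close>
  define q where "q = (\<lambda>y. - (1 / f x) * (f (x + y) - f x))"
  have q: "ps_bounded r q (1 / 2)" using ps_bounded_cmult[OF r(2), of "- (1 / f x)"] f0 by (simp add: q_def)
  have "ps_bounded r (\<lambda>y. inverse (1 - q y)) 2"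
  proof (rule ps_bounded_has_sum[OF r(1), where I = UNIV])
    show "ps_bounded r (\<lambda>y. q y ^ n) ((1/2) ^ n)" for n by (rule ps_bounded_power[OF q])
    show "((\<lambda>n. (1/2) ^ n :: real) has_sum 2) UNIV"
      using geometric_sums[of "1/2 :: real"] by (intro sums_nonneg_imp_has_sum) auto
    fix y :: "real^'n" assume "y \<in> cube r"
    from ps_bounded_bound[OF q this] have 1: "\<bar>q y\<bar> < 1" by simp
    then show "((\<lambda>n. q y ^ n) has_sum inverse (1 - q y)) UNIV"
      using geometric_sums[of "q y"]
      by (intro norm_summable_imp_has_sum) (auto simp: power_abs inverse_eq_divide intro!: summable_geometric)
  qed
  from ps_bounded_cmult[OF this, of "inverse (f x)"]
  have "ps_bounded r (\<lambda>y. inverse (f x) * inverse (1 - q y)) (\<bar>inverse (f x)\<bar> * 2)" .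
  moreover have "inverse (f x) * inverse (1 - q y) = inverse (f (x + y))" for y
    using f0 by (simp add: q_def inverse_mult_distrib[symmetric] field_simps del: inverse_mult_distrib)
  ultimately show ?thesis by (intro real_analytic_atI) simp
qed

lemma real_analytic_at_divide:
  "real_analytic_at f x \<Longrightarrow> real_analytic_at g x \<Longrightarrow> g x \<noteq> 0 \<Longrightarrow> real_analytic_at (\<lambda>y. f y / g y) x"
  unfolding divide_inverse by (intro real_analytic_at_mult real_analytic_at_inverse)

text \<open>Hadamard division by one coordinate after another writes \<open>f y\<close> as
  \<open>f 0\<close> plus the sum of the \<open>y $ i * g i y\<close> with every \<open>g i\<close>
  continuous at 0; the derivative is then read off from the values \<open>g i 0\<close>.\<close>

lemma ps_bounded_has_derivative_at_0:
  fixes f :: "real^'n::finite \<Rightarrow> real"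
  assumes "ps_bounded R f M" shows "\<exists>D. (f has_derivative D) (at 0)"
proof -
  have "\<exists>g. (\<forall>i. \<exists>K. ps_bounded R (g i) K) \<and>
      (\<forall>y\<in>cube R. f y = f (\<chi> j. if j \<in> S then 0 else y $ j) + (\<Sum>i\<in>S. y $ i * g i y))" for S :: "'n set"
    using finite[of S]
  proof (induction S rule: finite_induct)
    case empty
    show ?case using ps_bounded_const[OF ps_bounded_pos[OF assms]] by (intro exI[of _ "\<lambda>_ _. 0"]) auto
  next
    case (insert i S)
    then obtain g where g: "\<And>i. \<exists>K. ps_bounded R (g i) K"
      "\<And>y. y \<in> cube R \<Longrightarrow> f y = f (\<chi> j. if j \<in> S then 0 else y $ j) + (\<Sum>i\<in>S. y $ i * g i y)" by blast
    let ?f = "\<lambda>y. f (\<chi> j. if j \<in> S then 0 else y $ j)"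
    have "ps_bounded R (\<lambda>y. if j \<in> S then 0 else y $ j) R" for j
      using ps_bounded_coord[OF ps_bounded_pos[OF assms]] ps_bounded_mono[OF ps_bounded_const[OF ps_bounded_pos[OF assms]], of 0 R] ps_bounded_pos[OF assms]
      by (cases "j \<in> S") auto
    then have "ps_bounded R ?f M"
      by (intro ps_bounded_compose[OF assms ps_bounded_pos[OF assms], where N = "\<lambda>_. R"]) auto
    from ps_bounded_hadamard[OF this, of i] obtain h where h: "ps_bounded R h (M / R)"
      "\<And>y. y \<in> cube R \<Longrightarrow> ?f y = ?f (\<chi> j. if j = i then 0 else y $ j) + y $ i * h y" by blast
    have eq: "(\<chi> j. if j \<in> S then 0 else (\<chi> j. if j = i then 0 else y $ j) $ j)
       = (\<chi> j. if j \<in> insert i S then 0 else y $ j)" for y :: "real^'n"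
      by (auto simp: vec_eq_iff)
    have "(\<Sum>k\<in>S. y $ k * (g(i := h)) k y) = (\<Sum>k\<in>S. y $ k * g k y)" for y
      using insert.hyps by (intro sum.cong) auto
    then have sm: "(\<Sum>k\<in>insert i S. y $ k * (g(i := h)) k y) = y $ i * h y + (\<Sum>k\<in>S. y $ k * g k y)" for y
      using insert.hyps by simp
    show ?case
    proof (intro exI[of _ "g(i := h)"] conjI allI ballI)
      fix k show "\<exists>K. ps_bounded R ((g(i := h)) k) K" using g(1) h(1) by (cases "k = i") auto
    next
      fix y :: "real^'n" assume y: "y \<in> cube R"
      show "f y = f (\<chi> j. if j \<in> insert i S then 0 else y $ j) + (\<Sum>k\<in>insert i S. y $ k * (g(i := h)) k y)"
        using g(2)[OF y] h(2)[OF y] unfolding eq sm by linarith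
    qed
  qed
  from this[of UNIV] obtain g where g: "\<And>i. \<exists>K. ps_bounded R (g i) K"
    "\<And>y. y \<in> cube R \<Longrightarrow> f y = f 0 + (\<Sum>i\<in>UNIV. y $ i * g i y)"
    by (auto simp: zero_vec_def[symmetric])
  have gc: "isCont (g i) 0" for i
    using g(1)[of i] real_analytic_atI[of R "g i" 0] by (auto intro: real_analytic_at_imp_isCont)
  have d: "((\<lambda>y. y $ i * g i y) has_derivative (\<lambda>v. v $ i * g i 0)) (at 0)" for i
    unfolding has_derivative_at
  proof
    show "bounded_linear (\<lambda>v::real^'n. v $ i * g i 0)"
      by (intro bounded_linear_mult_const bounded_linear_vec_nth)
    have "((\<lambda>h. g i h - g i 0) \<longlongrightarrow> 0) (at 0)" using gc[of i] by (simp add: isCont_def LIM_zero)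
    then have t: "((\<lambda>h. norm (g i h - g i 0)) \<longlongrightarrow> 0) (at 0)" by (rule tendsto_norm_zero)
    have b: "norm (norm ((0 + h) $ i * g i (0 + h) - 0 $ i * g i 0 - h $ i * g i 0) / norm h) \<le> norm (g i h - g i 0)"
      for h :: "real^'n"
    proof -
      have "\<bar>h $ i\<bar> * \<bar>g i h - g i 0\<bar> \<le> norm h * \<bar>g i h - g i 0\<bar>"
        by (intro mult_right_mono component_le_norm_cart) auto
      then show ?thesis
        by (cases "h = 0") (auto simp: right_diff_distrib[symmetric] abs_mult divide_le_eq mult.commute)
    qed
    show "(\<lambda>h. norm ((0 + h) $ i * g i (0 + h) - 0 $ i * g i 0 - h $ i * g i 0) / norm h) \<midarrow>0\<rightarrow> 0"
      by (rule Lim_null_comparison[OF always_eventually[OF allI[OF b]] t])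
  qed
  have D: "((\<lambda>y. f 0 + (\<Sum>i\<in>UNIV. y $ i * g i y)) has_derivative (\<lambda>v. 0 + (\<Sum>i\<in>UNIV. v $ i * g i 0))) (at 0)"
    by (intro has_derivative_add has_derivative_sum has_derivative_const d)
  have E: "eventually (\<lambda>y. f 0 + (\<Sum>i\<in>UNIV. y $ i * g i y) = f y) (nhds 0)"
    using eventually_cube[OF ps_bounded_pos[OF assms], of 0] by eventually_elim (simp add: g(2)[symmetric])
  then have "eventually (\<lambda>y. f 0 + (\<Sum>i\<in>UNIV. y $ i * g i y) = f y) (at 0)"
    by (simp add: eventually_at_filter eventually_mono)
  from has_derivative_transform_eventually[OF D this]
  have "(f has_derivative (\<lambda>v. 0 + (\<Sum>i\<in>UNIV. v $ i * g i 0))) (at 0)" by simp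
  then show ?thesis by blast
qed

lemma real_analytic_at_differentiable:
  assumes "real_analytic_at f x" shows "f differentiable (at x)"
proof -
  obtain R M where M: "ps_bounded R (\<lambda>y. f (x + y)) M" using assms real_analytic_at_iff_ps_bounded by blast
  obtain D where D: "((\<lambda>y. f (x + y)) has_derivative D) (at 0)"
    using ps_bounded_has_derivative_at_0[OF M] by blast
  have "((\<lambda>z. z - x) has_derivative (\<lambda>v. v)) (at x)" by (auto intro!: derivative_eq_intros)
  from has_derivative_compose[OF this, of "\<lambda>y. f (x + y)" D] D
  have "(f has_derivative D) (at x)" by simp
  then show ?thesis by (auto simp: differentiable_def)
qed

lemma real_analytic_at_has_derivative:
  "real_analytic_at f x \<Longrightarrow> (f has_derivative frechet_derivative f (at x)) (at x)"
  by (rule frechet_derivative_works[THEN iffD1, OF real_analytic_at_differentiable])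

text \<open>\<open>f (x + t e\<^sub>i)\<close> is analytic in the variables \<open>(x, t)\<close>, indexed by \<open>'n option\<close>; Hadamard division by \<open>t\<close>
  gives the partial derivative as an analytic function, without differentiating series.\<close>

lemma real_analytic_at_partial_exists:
  fixes f :: "real^'n::finite \<Rightarrow> real"
  assumes "real_analytic_at f x"
  shows "\<exists>g. real_analytic_at g x \<and>
    eventually (\<lambda>y. ((\<lambda>t. f (y + t *\<^sub>R axis i 1)) has_real_derivative g y) (at 0)) (nhds x)"
proof -
  obtain R M where M: "ps_bounded R (\<lambda>y. f (x + y)) M" using assms real_analytic_at_iff_ps_bounded by blast
  have R: "R > 0" "R / 2 > 0" using ps_bounded_pos[OF M] by auto
  define s where "s = (\<lambda>z :: real^('n option). (\<chi> j. z $ Some j + (if j = i then z $ None else 0)) :: real^'n)"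
  have "ps_bounded (R/2) (\<lambda>z. s z $ k) (R/2 + R/2)" for k
    using ps_bounded_add[OF ps_bounded_coord ps_bounded_coord, OF R(2) R(2), of "Some k" None]
      ps_bounded_mono[OF ps_bounded_coord[OF R(2), of "Some k"], of "R/2 + R/2"] R
    by (cases "k = i") (auto simp: s_def)
  then have "ps_bounded (R/2) (\<lambda>z. f (x + s z)) M"
    by (intro ps_bounded_compose[OF M R(2), where N = "\<lambda>_. R/2 + R/2"]) auto
  from ps_bounded_hadamard[OF this, of None] obtain g where g: "ps_bounded (R/2) g (M / (R/2))"
    "\<And>z. z \<in> cube (R/2) \<Longrightarrow> f (x + s z) = f (x + s (\<chi> j. if j = None then 0 else z $ j)) + z $ None * g z" by blast
  define e where "e = (\<lambda>(y :: real^'n) t. (\<chi> k. case k of None \<Rightarrow> t | Some j \<Rightarrow> y $ j) :: real^('n option))"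
  have se: "s (e y t) = y + t *\<^sub>R axis i 1" for y t
    by (auto simp: s_def e_def vec_eq_iff axis_def)
  have e0: "(\<chi> j. if j = None then 0 else e y t $ j) = e y 0" for y t
    by (auto simp: e_def vec_eq_iff split: option.split)
  have ec: "e y t \<in> cube r \<longleftrightarrow> y \<in> cube r \<and> \<bar>t\<bar> \<le> r" for y t r
    by (auto simp: cube_def e_def split: option.splits) 
  have f: "f (x + y + t *\<^sub>R axis i 1) = f (x + y) + t * g (e y t)" if "y \<in> cube (R/2)" "\<bar>t\<bar> \<le> R/2" for y t
    using g(2)[of "e y t"] that unfolding e0 ec se by (simp add: e_def add.assoc)
  define D where "D = (\<lambda>z. g (e (z - x) 0))"
  have "ps_bounded (R/2) (\<lambda>y. e y 0 $ k) (R/2)" for k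
    using ps_bounded_coord[OF R(2)] ps_bounded_mono[OF ps_bounded_const[OF R(2)], of 0 "R/2"] R by (cases k) (auto simp: e_def)
  then have "ps_bounded (R/2) (\<lambda>y. g (e y 0)) (M / (R/2))"
    by (intro ps_bounded_compose[OF g(1) R(2), where N = "\<lambda>_. R/2"]) auto
  then have "real_analytic_at D x" by (intro real_analytic_atI) (simp add: D_def)
  moreover have "eventually (\<lambda>z. ((\<lambda>t. f (z + t *\<^sub>R axis i 1)) has_real_derivative D z) (at 0)) (nhds x)"
    using eventually_cube[of "R/4" x]
  proof (rule eventually_mono)
    fix z assume z: "z - x \<in> cube (R/4)"
    define y where "y = z - x"
    have y: "y \<in> cube (R/4)" "y \<in> cube (R/2)" using z cube_mono[of "R/4" "R/2"] R by (auto simp: y_def)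
    \<comment> \<open>With \<open>y\<close> in the cube of radius \<open>R/4\<close>, the quotient
      \<open>g\<close> can be recentred at \<open>e y 0\<close> and keep the radius
      \<open>R/4\<close> inside its own cube of radius \<open>R/2\<close>. Only its continuity there
      is wanted.\<close>
    have "ps_bounded (R/4) (\<lambda>w. g (e y 0 + w)) (M / (R/2))"
      by (rule ps_bounded_shift[OF g(1)]) (use y R in \<open>auto simp: cube_def e_def split: option.split\<close>)
    then have "isCont g (e y 0)" by (intro real_analytic_at_imp_isCont real_analytic_atI)
    moreover have "isCont (e y) 0"
      unfolding e_def isCont_def by (rule tendsto_vec_lambda) (auto split: option.split intro!: tendsto_intros)
    ultimately have c: "isCont (\<lambda>t. g (e y t)) 0" by (rule continuous_at_compose[unfolded o_def, rotated])
    show "((\<lambda>t. f (z + t *\<^sub>R axis i 1)) has_real_derivative D z) (at 0)"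
      unfolding DERIV_def
    proof (rule Lim_transform_eventually)
      show "(\<lambda>t. g (e y t)) \<midarrow>0\<rightarrow> D z" using c by (simp add: isCont_def D_def y_def)
      have "eventually (\<lambda>t::real. \<bar>t\<bar> < R/2) (at 0)"
        unfolding eventually_at using R by (intro exI[of _ "R/2"]) (auto simp: dist_real_def)
      then show "\<forall>\<^sub>F t in at 0. g (e y t) = (f (z + (0 + t) *\<^sub>R axis i 1) - f (z + 0 *\<^sub>R axis i 1)) / t"
        using eventually_neq_at_within[of 0 "0::real" UNIV]
      proof eventually_elim
        case (elim t)
        then show ?case using f[OF y(2), of t] by (simp add: y_def)
      qed
    qed
  qed (use R in simp)
  ultimately show ?thesis by blast
qed

text \<open>The analytic quotient is a directional derivative on a whole neighbourhood, where
  uniqueness of derivatives identifies it with the Frechet derivative.\<close>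

lemma real_analytic_at_frechet_axis:
  fixes f :: "real^'n::finite \<Rightarrow> real"
  assumes "real_analytic_at f x"
  shows "real_analytic_at (\<lambda>y. frechet_derivative f (at y) (axis i 1)) x"
proof -
  obtain g where g: "real_analytic_at g x"
    "eventually (\<lambda>y. ((\<lambda>t. f (y + t *\<^sub>R axis i 1)) has_real_derivative g y) (at 0)) (nhds x)"
    using real_analytic_at_partial_exists[OF assms] by blast
  from g(2) real_analytic_at_eventually[OF assms]
  have "eventually (\<lambda>y. g y = frechet_derivative f (at y) (axis i 1)) (nhds x)"
  proof eventually_elim
    case (elim y)
    have "((\<lambda>t. y + t *\<^sub>R axis i 1) has_derivative (\<lambda>t. t *\<^sub>R axis i 1)) (at 0)"
      by (auto intro!: derivative_eq_intros)
    from has_derivative_compose[OF this, of f "frechet_derivative f (at y)"] real_analytic_at_has_derivative[OF elim(2)]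
    have "((\<lambda>t. f (y + t *\<^sub>R axis i 1)) has_derivative (\<lambda>t. frechet_derivative f (at y) (t *\<^sub>R axis i 1))) (at 0)"
      by simp
    from has_derivative_unique[OF this] elim(1)[unfolded has_field_derivative_def]
    have "(\<lambda>t. frechet_derivative f (at y) (t *\<^sub>R axis i 1)) = (*) (g y)" by blast
    from fun_cong[OF this, of 1] show ?case by simp
  qed
  then show ?thesis by (rule real_analytic_at_cong[OF g(1)])
qed

text \<open>The remainder of Hadamard division is \<open>f\<close> at the projection of
  \<open>y\<close> to the hyperplane. Projection does not increase the norm, so the projected point
  stays where \<open>f\<close> is known to vanish.\<close>

lemma real_analytic_at_divisible:
  fixes f :: "real^'n::finite \<Rightarrow> real"
  assumes "real_analytic_at f 0" "eventually (\<lambda>y. y $ i = 0 \<longrightarrow> f y = 0) (nhds 0)"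
  obtains g where "real_analytic_at g 0" "eventually (\<lambda>y. f y = y $ i * g y) (nhds 0)"
proof -
  obtain R M where M: "ps_bounded R (\<lambda>y. f (0 + y)) M" using assms(1) real_analytic_at_iff_ps_bounded by blast
  from ps_bounded_hadamard[OF this, of i] obtain g where g: "ps_bounded R g (M / R)"
    "\<And>y. y \<in> cube R \<Longrightarrow> f y = f (\<chi> j. if j = i then 0 else y $ j) + y $ i * g y" by auto
  have "real_analytic_at g 0" using g(1) by (intro real_analytic_atI) simp
  moreover have "eventually (\<lambda>y. f y = y $ i * g y) (nhds 0)"
  proof -
    obtain d where d: "d > 0" "\<And>y. dist y 0 < d \<Longrightarrow> y $ i = 0 \<Longrightarrow> f y = 0"
      using assms(2) unfolding eventually_nhds_metric by blast
    have "eventually (\<lambda>y::real^'n. dist y 0 < d) (nhds 0)"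
      using d(1) eventually_nhds_metric by blast
    with eventually_cube[OF ps_bounded_pos[OF M], of 0] show ?thesis
    proof eventually_elim
      case (elim y)
      let ?y = "\<chi> j. if j = i then 0 else y $ j"
      have "norm ?y \<le> norm y" by (rule norm_le_componentwise_cart) simp
      then have "f ?y = 0" using elim(2) by (intro d(2)) auto
      then show ?case using g(2)[of y] elim(1) by simp
    qed
  qed
  ultimately show ?thesis by (rule that)
qed

section \<open>Analytic ordinary differential equations with parameters\<close>

definition vec_upd :: "real^'n::finite \<Rightarrow> 'n \<Rightarrow> real \<Rightarrow> real^'n" where
  "vec_upd y i t = (\<chi> j. if j = i then t else y $ j)"

lemma vec_upd_nth [simp]: "vec_upd y i t $ j = (if j = i then t else y $ j)"
  by (simp add: vec_upd_def)

lemma vec_upd_vec_upd [simp]: "vec_upd (vec_upd y i s) i t = vec_upd y i t"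
  by (simp add: vec_eq_iff)

lemma vec_upd_self [simp]: "vec_upd y i (y $ i) = y"
  by (simp add: vec_eq_iff)

lemma vec_upd_cube: "y \<in> cube r \<Longrightarrow> \<bar>t\<bar> \<le> r \<Longrightarrow> vec_upd y i t \<in> cube r"
  by (auto simp: cube_def)

text \<open>Termwise differentiation by the Weierstrass test. The sums \<open>U\<close> and
  \<open>V\<close> are prescribed, since in the applications both are functions already at hand; a
  closed interval is allowed for \<open>S\<close>, with one-sided derivatives at its ends.\<close>

lemma has_real_derivative_sums:
  fixes u :: "nat \<Rightarrow> real \<Rightarrow> real"
  assumes S: "convex S" "t \<in> S"
    and d: "\<And>n s. s \<in> S \<Longrightarrow> (u n has_real_derivative u' n s) (at s within S)"
    and b: "\<And>n s. s \<in> S \<Longrightarrow> \<bar>u' n s\<bar> \<le> B n" "summable B"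
    and U: "\<And>s. s \<in> S \<Longrightarrow> (\<lambda>n. u n s) sums U s" and V: "\<And>s. s \<in> S \<Longrightarrow> (\<lambda>n. u' n s) sums V s"
  shows "(U has_real_derivative V t) (at t within S)"
proof -
  have lim: "uniform_limit S (\<lambda>n s. \<Sum>i<n. u' i s) V sequentially"
  proof -
    have "uniform_limit S (\<lambda>n s. \<Sum>i<n. u' i s) (\<lambda>s. suminf (\<lambda>i. u' i s)) sequentially"
      by (rule Weierstrass_m_test[OF _ b(2)]) (use b(1) in auto)
    then show ?thesis
      by (rule uniform_limit_cong'[THEN iffD1, rotated -1]) (use V in \<open>auto simp: sums_iff\<close>)
  qed
  have sm: "summable (\<lambda>n. u n t)" using U[OF S(2)] by (simp add: sums_iff)
  obtain g where g: "\<And>s. s \<in> S \<Longrightarrow> (\<lambda>n. u n s) sums g s \<and> (g has_real_derivative V s) (at s within S)"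
    using has_field_derivative_series[OF S(1) d lim S(2) sm] by blast
  have eq: "U s = g s" if "s \<in> S" for s using sums_unique2 U[OF that] g[OF that] by blast
  show ?thesis
    using has_derivative_transform[OF S(2), of U g] eq g[OF S(2)] by (simp add: has_field_derivative_def)
qed

text \<open>The normalisation on the hyperplane \<open>y $ i = 0\<close> makes the antiderivative
  unique. Closed intervals, with derivatives within them, match the closed cubes on which the norm
  controls values.\<close>

definition antideriv_on :: "real \<Rightarrow> 'n \<Rightarrow> (real^'n::finite \<Rightarrow> real) \<Rightarrow> (real^'n \<Rightarrow> real) \<Rightarrow> bool" where
  "antideriv_on r i f G \<longleftrightarrow> (\<forall>y\<in>cube r. y $ i = 0 \<longrightarrow> G y = 0) \<and>
     (\<forall>y\<in>cube r. \<forall>t\<in>{-r..r}. ((\<lambda>s. G (vec_upd y i s)) has_real_derivative f (vec_upd y i t)) (at t within {-r..r}))"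

lemma antideriv_on_unique:
  assumes "antideriv_on r i f F" "antideriv_on r i f G" "y \<in> cube r"
  shows "F y = G y"
proof -
  have r: "0 \<le> r" using assms(3) by (auto simp: cube_def intro: order_trans[OF abs_ge_zero])
  have "\<exists>c. \<forall>t\<in>{-r..r}. F (vec_upd y i t) - G (vec_upd y i t) = c"
  proof (rule has_field_derivative_zero_constant)
    fix t assume "t \<in> {-r..r}"
    then have "((\<lambda>s. F (vec_upd y i s) - G (vec_upd y i s)) has_real_derivative (f (vec_upd y i t) - f (vec_upd y i t))) (at t within {-r..r})"
      using assms by (intro DERIV_diff) (auto simp: antideriv_on_def)
    then show "((\<lambda>s. F (vec_upd y i s) - G (vec_upd y i s)) has_real_derivative 0) (at t within {-r..r})" by simp
  qed simp
  then obtain c where c: "\<And>t. t \<in> {-r..r} \<Longrightarrow> F (vec_upd y i t) - G (vec_upd y i t) = c" by blast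
  have "vec_upd y i 0 \<in> cube r" using assms(3) r by (intro vec_upd_cube) auto
  then have "F (vec_upd y i 0) = 0" "G (vec_upd y i 0) = 0" using assms(1,2) by (auto simp: antideriv_on_def)
  then have "c = 0" using c[of 0] r by simp
  moreover have "y $ i \<in> {-r..r}" using assms(3) by (auto simp: cube_def abs_le_iff minus_le_iff)
  ultimately show ?thesis using c[of "y $ i"] by simp
qed

text \<open>Termwise integration divides each coefficient by the new exponent and raises the degree
  by one, so the norm grows at most by the factor \<open>r\<close>. For small \<open>r\<close> this
  factor makes the Picard operator a contraction.\<close>

lemma ps_bounded_antideriv_exists:
  fixes f :: "real^'n::finite \<Rightarrow> real"
  assumes F: "ps_bounded r f N"
  obtains G where "ps_bounded r G (r * N)" "antideriv_on r i f G"
proof -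
  obtain c S where c: "((\<lambda>\<beta>. \<bar>c \<beta>\<bar> * r ^ multi_degree \<beta>) has_sum S) UNIV" "S \<le> N" "r > 0"
    "\<And>y. y \<in> cube r \<Longrightarrow> ((\<lambda>\<beta>. c \<beta> * multi_power y \<beta>) has_sum f y) UNIV"
    by (rule ps_boundedE[OF F]) (rule that; assumption)
  define e where "e = (\<lambda>(\<beta>::'n \<Rightarrow> nat) j. (if j = i then 1 else 0) + \<beta> j)"
  define c' where "c' = (\<lambda>\<beta>. c \<beta> / (real (\<beta> i) + 1))"
  have mp: "multi_power y (e \<beta>) = y $ i * multi_power y \<beta>" for y \<beta>
    unfolding e_def by (subst multi_power_add) (simp add: multi_power_single)
  have md: "multi_degree (e \<beta>) = Suc (multi_degree \<beta>)" for \<beta>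
    unfolding e_def by (subst multi_degree_add) (simp add: multi_degree_single)
  have c'c: "\<bar>c' \<beta>\<bar> \<le> \<bar>c \<beta>\<bar>" for \<beta> by (auto simp: c'_def divide_le_eq mult_le_cancel_left1)
  have bd: "\<bar>c' \<beta>\<bar> * r ^ multi_degree (e \<beta>) \<le> r * (\<bar>c \<beta>\<bar> * r ^ multi_degree \<beta>)" for \<beta>
  proof -
    have "\<bar>c' \<beta>\<bar> * (r * r ^ multi_degree \<beta>) \<le> \<bar>c \<beta>\<bar> * (r * r ^ multi_degree \<beta>)"
      using c'c c(3) by (intro mult_right_mono) auto
    then show ?thesis by (simp add: md mult_ac)
  qed
  have rS: "((\<lambda>\<beta>. r * (\<bar>c \<beta>\<bar> * r ^ multi_degree \<beta>)) has_sum (r * S)) UNIV" by (rule has_sum_cmult_right[OF c(1)])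
  have "(\<lambda>\<beta>. \<bar>c' \<beta>\<bar> * r ^ multi_degree (e \<beta>)) summable_on UNIV"
    by (rule summable_on_comparison_test[OF has_sum_imp_summable[OF rS]]) (use bd c(3) in auto)
  then obtain T where T: "((\<lambda>\<beta>. \<bar>c' \<beta>\<bar> * r ^ multi_degree (e \<beta>)) has_sum T) UNIV" by (auto simp: summable_on_def)
  have "T \<le> r * S" by (rule has_sum_mono[OF T rS]) (use bd in auto)
  also have "\<dots> \<le> r * N" using c by simp
  finally have TN: "T \<le> r * N" .
  define G where "G = (\<lambda>y. infsum (\<lambda>\<beta>. c' \<beta> * multi_power y (e \<beta>)) UNIV)"
  have gs: "((\<lambda>\<beta>. c' \<beta> * multi_power y (e \<beta>)) has_sum G y) UNIV" if "y \<in> cube r" for y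
  proof -
    have "(\<lambda>\<beta>. c' \<beta> * multi_power y (e \<beta>)) summable_on UNIV"
      by (rule real_summable_on_comparison[OF has_sum_imp_summable[OF T]])
        (use multi_power_bound[OF that] in \<open>auto simp: abs_mult mult_left_mono\<close>)
    then show ?thesis unfolding G_def by (rule has_sum_infsum)
  qed
  have "ps_bounded r G (r * N)" by (rule ps_bounded_collect[OF c(3) T TN gs])
  moreover have "antideriv_on r i f G"
    unfolding antideriv_on_def
  proof (intro conjI ballI impI)
    fix y :: "real^'n" assume "y \<in> cube r" "y $ i = 0"
    then show "G y = 0" by (simp add: G_def mp)
  next
    fix y :: "real^'n" and t assume y: "y \<in> cube r" and t: "t \<in> {-r..r}"
    have cub: "vec_upd y i s \<in> cube r" if "s \<in> {-r..r}" for s using that y by (intro vec_upd_cube) auto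
    \<comment> \<open>\<open>has_real_derivative_sums\<close> is about sequences, so the
      multi-indices are enumerated; the constant ones already show that there are infinitely
      many.\<close>
    have "infinite (UNIV :: ('n \<Rightarrow> nat) set)"
      unfolding infinite_iff_countable_subset
      by (rule exI[of _ "\<lambda>n _. n"]) (auto simp: inj_on_def fun_eq_iff)
    then have b: "bij_betw (from_nat_into UNIV) UNIV (UNIV :: ('n \<Rightarrow> nat) set)"
      by (intro bij_betw_from_nat_into) auto
    define b where "b = (from_nat_into UNIV :: nat \<Rightarrow> 'n \<Rightarrow> nat)"
    have sums: "(\<lambda>n. g (b n)) sums s" if "(g has_sum s) UNIV" for g :: "('n \<Rightarrow> nat) \<Rightarrow> real" and s
      using that has_sum_reindex_bij_betw[OF b, of g s] unfolding b_def by (intro has_sum_imp_sums) simp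
    have mpu: "multi_power (vec_upd y i s) \<beta> = s ^ \<beta> i * (\<Prod>j\<in>UNIV-{i}. (y $ j) ^ \<beta> j)" for s \<beta>
      unfolding multi_power_def by (subst prod.remove[of UNIV i]) (auto intro!: prod.cong)
    show "((\<lambda>s. G (vec_upd y i s)) has_real_derivative f (vec_upd y i t)) (at t within {-r..r})"
    proof (rule has_real_derivative_sums[OF _ t, where u = "\<lambda>n s. c' (b n) * multi_power (vec_upd y i s) (e (b n))"
          and u' = "\<lambda>n s. c (b n) * multi_power (vec_upd y i s) (b n)" and B = "\<lambda>n. \<bar>c (b n)\<bar> * r ^ multi_degree (b n)"])
      fix n s assume s: "s \<in> {-r..r}"
      have eq: "c' \<beta> * multi_power (vec_upd y i s) (e \<beta>) = c' \<beta> * (\<Prod>j\<in>UNIV-{i}. (y $ j) ^ \<beta> j) * s ^ Suc (\<beta> i)" for \<beta> s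
        by (simp add: mp mpu)
      have "((\<lambda>s. c' \<beta> * (\<Prod>j\<in>UNIV-{i}. (y $ j) ^ \<beta> j) * s ^ Suc (\<beta> i)) has_real_derivative
          c \<beta> * multi_power (vec_upd y i s) \<beta>) (at s within {-r..r})" for \<beta>
        by (rule derivative_eq_intros refl)+ (auto simp: c'_def mpu field_simps)
      then show "((\<lambda>s. c' (b n) * multi_power (vec_upd y i s) (e (b n))) has_real_derivative c (b n) * multi_power (vec_upd y i s) (b n)) (at s within {-r..r})"
        unfolding eq .
      show "\<bar>c (b n) * multi_power (vec_upd y i s) (b n)\<bar> \<le> \<bar>c (b n)\<bar> * r ^ multi_degree (b n)"
        using multi_power_bound[OF cub[OF s]] by (simp add: abs_mult mult_left_mono)
    next
      show "summable (\<lambda>n. \<bar>c (b n)\<bar> * r ^ multi_degree (b n))" using sums[OF c(1)] by (simp add: sums_iff)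
      show "(\<lambda>n. c' (b n) * multi_power (vec_upd y i s) (e (b n))) sums G (vec_upd y i s)" if "s \<in> {-r..r}" for s
        by (rule sums[OF gs[OF cub[OF that]]])
      show "(\<lambda>n. c (b n) * multi_power (vec_upd y i s) (b n)) sums f (vec_upd y i s)" if "s \<in> {-r..r}" for s
        by (rule sums[OF c(4)[OF cub[OF that]]])
    qed simp
  qed
  ultimately show ?thesis by (rule that)
qed

text \<open>The iteration needs an operator. The arbitrary choice is harmless on the cube, where any
  two antiderivatives agree.\<close>

definition antideriv :: "real \<Rightarrow> 'n \<Rightarrow> (real^'n::finite \<Rightarrow> real) \<Rightarrow> real^'n \<Rightarrow> real" where
  "antideriv r i f = (SOME G. antideriv_on r i f G)"

lemma ps_bounded_antideriv:
  assumes "ps_bounded r f N"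
  shows "antideriv_on r i f (antideriv r i f)" "ps_bounded r (antideriv r i f) (r * N)"
proof -
  obtain G where G: "ps_bounded r G (r * N)" "antideriv_on r i f G" by (rule ps_bounded_antideriv_exists[OF assms])
  show 1: "antideriv_on r i f (antideriv r i f)" unfolding antideriv_def by (rule someI[of "antideriv_on r i f", OF G(2)])
  show "ps_bounded r (antideriv r i f) (r * N)"
    by (rule ps_bounded_cong[OF G(1)]) (rule antideriv_on_unique[OF G(2) 1])
qed

lemma antideriv_on_diff:
  assumes "antideriv_on r i f F" "antideriv_on r i g G"
  shows "antideriv_on r i (\<lambda>y. f y - g y) (\<lambda>y. F y - G y)"
  using assms by (auto simp: antideriv_on_def intro!: DERIV_diff)

lemma ps_bounded_antideriv_diff:
  assumes "ps_bounded r f M" "ps_bounded r g N" "ps_bounded r (\<lambda>y. f y - g y) K"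
  shows "ps_bounded r (\<lambda>y. antideriv r i f y - antideriv r i g y) (r * K)"
  by (rule ps_bounded_cong[OF ps_bounded_antideriv(2)[OF assms(3)]])
    (rule antideriv_on_unique[OF ps_bounded_antideriv(1)[OF assms(3)] antideriv_on_diff[OF ps_bounded_antideriv(1) ps_bounded_antideriv(1)]], (rule assms)+)

text \<open>The argument of the right-hand side of a differential equation: the slot
  \<open>None\<close> holds the value of the unknown, the slots \<open>Some j\<close> the
  independent variables, time included.\<close>

definition vec_join :: "real \<Rightarrow> real^'n::finite \<Rightarrow> real^('n option)" where
  "vec_join y x = (\<chi> k. case k of None \<Rightarrow> y | Some j \<Rightarrow> x $ j)"

lemma vec_join_nth [simp]: "vec_join y x $ None = y" "vec_join y x $ Some j = x $ j"
  by (simp_all add: vec_join_def)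

lemma ps_bounded_vec_join:
  assumes "ps_bounded R W M" "ps_bounded r \<phi> a" "a \<le> R" "r \<le> R"
  shows "ps_bounded r (\<lambda>x. W (vec_join (\<phi> x) x)) M"
proof (rule ps_bounded_compose[OF assms(1) ps_bounded_pos[OF assms(2)]])
  show "ps_bounded r (\<lambda>y. vec_join (\<phi> y) y $ k) R" for k
    using ps_bounded_mono[OF assms(2,3)] ps_bounded_mono[OF ps_bounded_coord[OF ps_bounded_pos[OF assms(2)]] assms(4)]
    by (cases k) auto
qed simp

text \<open>Hadamard division of \<open>W (y + d, x)\<close> by the extra variable \<open>d\<close>, the outer \<open>None\<close>.\<close>

lemma ps_bounded_lipschitz:
  fixes W :: "real^('n::finite option) \<Rightarrow> real"
  assumes W: "ps_bounded R W M" and p: "ps_bounded r \<phi> (R/4)" "ps_bounded r \<psi> (R/4)" "ps_bounded r (\<lambda>x. \<phi> x - \<psi> x) \<delta>" and r: "r \<le> R/4"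
  shows "ps_bounded r (\<lambda>x. W (vec_join (\<phi> x) x) - W (vec_join (\<psi> x) x)) (\<delta> * (2 * M / R))"
proof -
  have R: "R > 0" "R/2 > 0" using ps_bounded_pos[OF W] by auto
  have r0: "r > 0" using ps_bounded_pos[OF p(1)] .
  define s where "s = (\<lambda>z :: real^('n option option). (\<chi> k. z $ Some k + (if k = None then z $ None else 0)) :: real^('n option))"
  have "ps_bounded (R/2) (\<lambda>z. s z $ k) R" for k
    using ps_bounded_add[OF ps_bounded_coord ps_bounded_coord, OF R(2) R(2), of "Some k" None]
      ps_bounded_mono[OF ps_bounded_coord[OF R(2), of "Some k"], of R] R
    by (cases k) (auto simp: s_def)
  then have "ps_bounded (R/2) (\<lambda>z. W (s z)) M"
    by (intro ps_bounded_compose[OF W R(2), where N = "\<lambda>_. R"]) auto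
  \<comment> \<open>The added variable will receive \<open>\<phi> x - \<psi> x\<close>, of norm at
    most \<open>R/2\<close>; this is why both arguments are confined to \<open>R/4\<close>. Dividing
    by it costs \<open>1 / (R/2)\<close>, hence the Lipschitz constant
    \<open>2 * M / R\<close>.\<close>
  from ps_bounded_hadamard[OF this, of None] obtain H where H: "ps_bounded (R/2) H (M / (R/2))"
    "\<And>z. z \<in> cube (R/2) \<Longrightarrow> W (s z) = W (s (\<chi> j. if j = None then 0 else z $ j)) + z $ None * H z" by blast
  define q where "q = (\<lambda>x. vec_join (\<phi> x - \<psi> x) (vec_join (\<psi> x) x))"
  have q: "ps_bounded r (\<lambda>x. q x $ k) (R/2)" for k
  proof (cases k)
    case None then show ?thesis using ps_bounded_diff[OF p(1,2)] by (simp add: q_def)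
  next
    case (Some l)
    then show ?thesis
      using ps_bounded_mono[OF p(2), of "R/2"] ps_bounded_mono[OF ps_bounded_coord[OF r0], of "R/2"] r R
      by (cases l) (auto simp: q_def)
  qed
  have Hq: "ps_bounded r (\<lambda>x. H (q x)) (M / (R/2))"
    by (rule ps_bounded_compose[OF H(1) r0 q]) simp
  show ?thesis
  proof (rule ps_bounded_cong)
    show "ps_bounded r (\<lambda>x. (\<phi> x - \<psi> x) * H (q x)) (\<delta> * (2 * M / R))"
      using ps_bounded_mult[OF p(3) Hq] by (simp add: field_simps)
    fix x :: "real^'n" assume "x \<in> cube r"
    then have "q x \<in> cube (R/2)" using ps_bounded_bound[OF q] by (auto simp: cube_def)
    moreover have "s (q x) = vec_join (\<phi> x) x" "s (\<chi> j. if j = None then 0 else q x $ j) = vec_join (\<psi> x) x"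
      by (auto simp: vec_eq_iff s_def q_def vec_join_def split: option.split)
    ultimately show "(\<phi> x - \<psi> x) * H (q x) = W (vec_join (\<phi> x) x) - W (vec_join (\<psi> x) x)"
      using H(2)[of "q x"] by (simp add: q_def)
  qed
qed


text \<open>Picard iteration: the operator \<open>\<phi> \<mapsto> K + \<integral> W(\<phi>, \<cdot>)\<close> is a contraction for the weighted \<open>l\<^sup>1\<close> norm
  of the coefficients on a small cube.\<close>

lemma ps_bounded_ode:
  fixes W :: "real^('n::finite option) \<Rightarrow> real" and K :: "real^'n \<Rightarrow> real"
  assumes W: "ps_bounded R W M" and K: "ps_bounded R K N" "K 0 = 0" "\<And>y t. K (vec_upd y i t) = K y"
  obtains r \<Phi> A where "0 < r" "r \<le> R/4" "ps_bounded r \<Phi> A" "\<And>y. y \<in> cube r \<Longrightarrow> \<bar>\<Phi> y\<bar> \<le> R/4"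
    "\<And>y. y \<in> cube r \<Longrightarrow> y $ i = 0 \<Longrightarrow> \<Phi> y = K y"
    "\<And>y t. y \<in> cube r \<Longrightarrow> t \<in> {-r..r} \<Longrightarrow>
       ((\<lambda>s. \<Phi> (vec_upd y i s)) has_real_derivative W (vec_join (\<Phi> (vec_upd y i t)) (vec_upd y i t))) (at t within {-r..r})"
proof -
  have R: "R > 0" using ps_bounded_pos[OF W] .
  have M: "M \<ge> 0" and N: "N \<ge> 0" using ps_bounded_nonneg W K(1) by auto
  \<comment> \<open>The first bound is the room demanded by the Lipschitz estimate. The second gives
    the initial value \<open>K\<close> norm at most \<open>R/8\<close>, the third does the same for
    one integration of \<open>W\<close>, so that iterates stay within \<open>R/4\<close>; the third
    also makes the contraction factor \<open>r * (2 * M / R)\<close> at most 1/2. The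
    \<open>+ 1\<close> keeps the denominators positive.\<close>
  define r where "r = min (R/4) (min (R * R / (8 * (N + 1))) (R / (8 * (M + 1))))"
  have "r > 0" using R M N by (simp add: r_def)
  moreover have "r \<le> R/4" unfolding r_def by (rule min.cobounded1)
  ultimately have r: "r > 0" "r \<le> R/4" by auto
  have rN: "N * r / R \<le> R/8"
  proof -
    have "r \<le> R * R / (8 * (N + 1))" by (simp add: r_def)
    then have "r * (8 * (N + 1)) \<le> R * R" using N by (subst (asm) pos_le_divide_eq) auto
    then have "8 * (N * r) \<le> R * R" using r N by (simp add: algebra_simps)
    then show ?thesis using R by (simp add: field_simps)
  qed
  have rM: "r * M \<le> R/8"
  proof -
    have "r \<le> R / (8 * (M + 1))" by (simp add: r_def)
    then have "r * (8 * (M + 1)) \<le> R" using M by (subst (asm) pos_le_divide_eq) auto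
    then show ?thesis using r M by (simp add: algebra_simps)
  qed
  then have rL: "r * (2 * M / R) \<le> 1/2" using R by (simp add: field_simps)
  have K8: "ps_bounded r K (R/8)" by (rule ps_bounded_mono[OF ps_bounded_scale[OF K(1) r(1) _ K(2)] rN]) (use r R in auto)
  define w where "w = (\<lambda>\<phi> x. W (vec_join (\<phi> x) x))"
  have w: "ps_bounded r (w \<phi>) M" if "ps_bounded r \<phi> (R/4)" for \<phi>
    unfolding w_def by (rule ps_bounded_vec_join[OF W that]) (use r R in auto)
  define P where "P = rec_nat K (\<lambda>_ \<phi> y. K y + antideriv r i (w \<phi>) y)"
  have P0: "P 0 = K" and PS: "P (Suc n) = (\<lambda>y. K y + antideriv r i (w (P n)) y)" for n
    by (simp_all add: P_def)
  have P: "ps_bounded r (P n) (R/4)" for n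
  proof (induction n)
    case 0 then show ?case using ps_bounded_mono[OF K8] R by (simp add: P0)
  next
    case (Suc n)
    show ?case unfolding PS
      by (rule ps_bounded_mono[OF ps_bounded_add[OF K8 ps_bounded_antideriv(2)[OF w[OF Suc]]]]) (use rM in simp)
  qed
  define D where "D = (\<lambda>n y. P (Suc n) y - P n y)"
  have wD: "ps_bounded r (\<lambda>x. w (P (Suc n)) x - w (P n) x) (\<delta> * (2 * M / R))" if "ps_bounded r (D n) \<delta>" for n \<delta>
    unfolding w_def by (rule ps_bounded_lipschitz[OF W P P _ r(2)]) (use that in \<open>simp add: D_def\<close>)
  \<comment> \<open>The initial constant \<open>R/2\<close> is the sum of the bounds
    \<open>R/4\<close> of the first two iterates; each further step is halved by
    \<open>rL\<close>.\<close>
  have D: "ps_bounded r (D n) (R/2 * (1/2) ^ n)" for n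
  proof (induction n)
    case 0 show ?case using ps_bounded_diff[OF P P, of "Suc 0" 0] by (simp add: D_def)
  next
    case (Suc n)
    have "ps_bounded r (D (Suc n)) (r * (R/2 * (1/2) ^ n * (2 * M / R)))"
    proof (rule ps_bounded_cong)
      show "ps_bounded r (\<lambda>y. antideriv r i (w (P (Suc n))) y - antideriv r i (w (P n)) y) (r * (R/2 * (1/2) ^ n * (2 * M / R)))"
        by (rule ps_bounded_antideriv_diff[OF w[OF P] w[OF P] wD[OF Suc]])
    qed (simp add: D_def PS)
    moreover have "r * (R/2 * (1/2) ^ n * (2 * M / R)) \<le> R/2 * (1/2) ^ Suc n"
      using mult_left_mono[OF rL, of "R/2 * (1/2) ^ n"] R by (simp add: mult_ac)
    ultimately show ?case by (rule ps_bounded_mono)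
  qed
  have geo: "(\<lambda>n. R/2 * (1/2) ^ n) sums R"
    using sums_mult[OF geometric_sums[of "1/2 :: real"], of "R/2"] by simp
  have Db: "\<bar>D n y\<bar> \<le> R/2 * (1/2) ^ n" if "y \<in> cube r" for n y by (rule ps_bounded_bound[OF D that])
  have Dsm: "summable (\<lambda>n. \<bar>D n y\<bar>)" if "y \<in> cube r" for y
    by (rule summable_comparison_test'[OF sums_summable[OF geo]]) (use Db[OF that] in auto)
  define \<Psi> where "\<Psi> = (\<lambda>y. suminf (\<lambda>n. D n y))"
  have Ds: "(\<lambda>n. D n y) sums \<Psi> y" if "y \<in> cube r" for y
    unfolding \<Psi>_def by (rule summable_sums[OF summable_rabs_cancel[OF Dsm[OF that]]])
  have \<Psi>: "ps_bounded r \<Psi> R"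
  proof (rule ps_bounded_has_sum[OF r(1) D, where I = UNIV])
    show "((\<lambda>n. R/2 * (1/2) ^ n) has_sum R) UNIV"
      by (rule sums_nonneg_imp_has_sum[OF geo]) (use R in auto)
    show "((\<lambda>n. D n y) has_sum \<Psi> y) UNIV" if "y \<in> cube r" for y
      by (rule norm_summable_imp_has_sum[OF _ Ds[OF that]]) (use Dsm[OF that] in simp)
  qed
  define \<Phi> where "\<Phi> = (\<lambda>y. K y + \<Psi> y)"
  have lim: "(\<lambda>n. P n y) \<longlonglongrightarrow> \<Phi> y" if "y \<in> cube r" for y
  proof -
    have "(\<lambda>n. \<Sum>k<n. D k y) \<longlonglongrightarrow> \<Psi> y" using Ds[OF that] by (simp add: sums_def)
    moreover have "(\<Sum>k<n. D k y) = P n y - K y" for n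
      by (induction n) (auto simp: P0 D_def)
    ultimately have "(\<lambda>n. P n y - K y) \<longlonglongrightarrow> \<Psi> y" by simp
    from tendsto_add[OF tendsto_const[of "K y"] this] show ?thesis by (simp add: \<Phi>_def)
  qed
  \<comment> \<open>The norm bound obtained by summing the differences exceeds \<open>R\<close>, too
    much for evaluating \<open>W\<close>; the pointwise bound \<open>R/4\<close> is inherited from
    the iterates in the limit.\<close>
  have \<Phi>b: "\<bar>\<Phi> y\<bar> \<le> R/4" if "y \<in> cube r" for y
    by (rule LIMSEQ_le_const2[OF tendsto_rabs[OF lim[OF that]]]) (use ps_bounded_bound[OF P that] in blast)
  show ?thesis
  proof (rule that[OF r ps_bounded_add[OF K8 \<Psi>, folded \<Phi>_def] \<Phi>b])
    fix y assume y: "y \<in> cube r" "y $ i = 0"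
    have ad0: "antideriv r i (w (P n)) y = 0" for n
      using ps_bounded_antideriv(1)[OF w[OF P], of i n] y by (auto simp: antideriv_on_def)
    then have "P n y = K y" for n by (cases n) (auto simp: P0 PS)
    with lim[OF y(1)] show "\<Phi> y = K y" by (simp add: LIMSEQ_const_iff)
  next
    fix y :: "real^'n" and t assume y: "y \<in> cube r" and t: "t \<in> {-r..r}"
    have cub: "vec_upd y i s \<in> cube r" if "s \<in> {-r..r}" for s using that y by (intro vec_upd_cube) auto
    define g where "g = (\<lambda>n s. w (P n) (vec_upd y i s))"
    \<comment> \<open>The index 0 is special: \<open>P 0 = K\<close> is constant in direction
      \<open>i\<close> and contributes no derivative. With this convention the partial sums
      telescope to the right-hand side at the last iterate.\<close>
    define g' where "g' = (\<lambda>n s. case n of 0 \<Rightarrow> g 0 s | Suc m \<Rightarrow> g (Suc m) s - g m s)"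
    have dP: "((\<lambda>s. P (Suc n) (vec_upd y i s)) has_real_derivative g n s) (at s within {-r..r})" if "s \<in> {-r..r}" for n s
    proof -
      have "((\<lambda>s. K y + antideriv r i (w (P n)) (vec_upd y i s)) has_real_derivative 0 + g n s) (at s within {-r..r})"
        unfolding g_def using ps_bounded_antideriv(1)[OF w[OF P], of i n] y that
        by (intro DERIV_add DERIV_const) (auto simp: antideriv_on_def)
      then show ?thesis by (simp add: PS K(3))
    qed
    have tel: "(\<Sum>k<Suc n. g' k s) = g n s" for n s
      by (induction n) (auto simp: g'_def)
    have "((\<lambda>s. \<Psi> (vec_upd y i s)) has_real_derivative w \<Phi> (vec_upd y i t)) (at t within {-r..r})"
    proof (rule has_real_derivative_sums[OF _ t, where u = "\<lambda>n s. D n (vec_upd y i s)" and u' = g'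
          and V = "\<lambda>s. w \<Phi> (vec_upd y i s)"
          and B = "\<lambda>n. case n of 0 \<Rightarrow> M | Suc m \<Rightarrow> R/2 * (1/2) ^ m * (2 * M / R)"])
      fix n s assume s: "s \<in> {-r..r}"
      show "((\<lambda>s. D n (vec_upd y i s)) has_real_derivative g' n s) (at s within {-r..r})"
      proof (cases n)
        case 0
        show ?thesis using DERIV_diff[OF dP[OF s] DERIV_const[of "K y"], of 0] by (simp add: 0 D_def P0 K(3) g'_def)
      next
        case (Suc m)
        show ?thesis using DERIV_diff[OF dP[OF s] dP[OF s], of "Suc m" m] by (simp add: Suc D_def g'_def)
      qed
      show "\<bar>g' n s\<bar> \<le> (case n of 0 \<Rightarrow> M | Suc m \<Rightarrow> R/2 * (1/2) ^ m * (2 * M / R))"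
        using ps_bounded_bound[OF w[OF P] cub[OF s], of 0] ps_bounded_bound[OF wD[OF D] cub[OF s]]
        by (cases n) (auto simp: g'_def g_def)
      show "(\<lambda>n. D n (vec_upd y i s)) sums \<Psi> (vec_upd y i s)" by (rule Ds[OF cub[OF s]])
    next
      fix s assume s: "s \<in> {-r..r}"
      let ?x = "vec_upd y i s"
      have a: "\<bar>\<Phi> ?x\<bar> \<le> R/4" by (rule \<Phi>b[OF cub[OF s]])
      have b: "\<bar>?x $ j\<bar> \<le> R/4" for j
      using order_trans[OF cub[OF s, unfolded cube_def mem_Collect_eq, rule_format] r(2)] .
      \<comment> \<open>All coordinates of the argument are at most \<open>R/4\<close>, so a cube of
        radius \<open>R/2\<close> around it still lies in the domain of \<open>W\<close>. Hence
        \<open>W\<close> is continuous there and the limit may be taken inside it.\<close>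
      have "\<bar>vec_join (\<Phi> ?x) ?x $ k\<bar> \<le> R - R/2" for k
      proof (cases k)
        case None show ?thesis unfolding None vec_join_nth using a R by linarith
      next
        case (Some j) show ?thesis unfolding Some vec_join_nth using b[of j] R by linarith
      qed
      from ps_bounded_shift[OF W this] R have "isCont W (vec_join (\<Phi> ?x) ?x)"
        by (intro real_analytic_at_imp_isCont real_analytic_atI[where r = "R/2" and N = M]) auto
      moreover have "(\<lambda>n. vec_join (P n ?x) ?x) \<longlonglongrightarrow> vec_join (\<Phi> ?x) ?x"
        unfolding vec_join_def by (rule tendsto_vec_lambda) (use lim[OF cub[OF s]] in \<open>auto split: option.split\<close>)
      ultimately have "(\<lambda>n. g n s) \<longlonglongrightarrow> w \<Phi> ?x"
        unfolding g_def w_def by (rule isCont_tendsto_compose)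
      then have "(\<lambda>n. \<Sum>k<Suc n. g' k s) \<longlonglongrightarrow> w \<Phi> ?x" by (simp only: tel)
      then show "(\<lambda>n. g' n s) sums w \<Phi> ?x" unfolding sums_def by (rule LIMSEQ_imp_Suc)
    next
      have "summable (\<lambda>m. R/2 * (1/2) ^ m * (2 * M / R))"
        by (rule summable_mult2[OF sums_summable[OF geo]])
      then show "summable (\<lambda>n. case n of 0 \<Rightarrow> M | Suc m \<Rightarrow> R/2 * (1/2) ^ m * (2 * M / R))"
        by (subst summable_Suc_iff[symmetric]) simp
    qed simp
    from DERIV_add[OF DERIV_const[of "K y"] this]
    show "((\<lambda>s. \<Phi> (vec_upd y i s)) has_real_derivative W (vec_join (\<Phi> (vec_upd y i t)) (vec_upd y i t))) (at t within {-r..r})"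
      by (simp add: \<Phi>_def w_def K(3))
  qed
qed

section \<open>Straightening a vector field\<close>

definition ocube :: "real \<Rightarrow> (real^'n::finite) set" where
  "ocube r = {y. \<forall>i. \<bar>y $ i\<bar> < r}"

lemma open_ocube: "open (ocube r)" unfolding ocube_def by (rule open_cube)

lemma ocube_cube: "ocube r \<subseteq> cube r" by (auto simp: ocube_def cube_def less_imp_le)

lemma vec_upd_ocube: "y \<in> ocube r \<Longrightarrow> \<bar>t\<bar> < r \<Longrightarrow> vec_upd y i t \<in> ocube r"
  by (auto simp: ocube_def)

lemma eventually_nhds_ocube:
  assumes "eventually P (nhds (0::real^'n::finite))"
  obtains r where "r > 0" "\<And>y. y \<in> ocube r \<Longrightarrow> P y"
proof -
  obtain d where d: "d > 0" "\<And>y. dist y 0 < d \<Longrightarrow> P y"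
    using assms unfolding eventually_nhds_metric by blast
  define r where "r = d / real CARD('n)"
  show ?thesis
  proof (rule that[of r])
    show "r > 0" using d(1) by (simp add: r_def)
    fix y :: "real^'n" assume y: "y \<in> ocube r"
    have "norm y \<le> (\<Sum>i\<in>UNIV. \<bar>y $ i\<bar>)" by (rule norm_le_l1_cart)
    also have "\<dots> < (\<Sum>i\<in>(UNIV::'n set). r)" using y by (intro sum_strict_mono) (auto simp: ocube_def)
    also have "\<dots> = d" by (simp add: r_def)
    finally show "P y" by (intro d(2)) simp
  qed
qed

lemma ps_bounded_real_analytic:
  fixes f :: "real^'n::finite \<Rightarrow> real"
  assumes "ps_bounded r f N" "y \<in> ocube r" shows "real_analytic_at f y"
proof -
  define m where "m = Max (range (\<lambda>i. \<bar>y $ i\<bar>))"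
  have m: "\<bar>y $ i\<bar> \<le> m" for i by (simp add: m_def)
  have "m \<in> range (\<lambda>i. \<bar>y $ i\<bar>)" unfolding m_def by (rule Max_in) auto
  then have "m < r" using assms(2) by (auto simp: ocube_def)
  then have "ps_bounded (r - m) (\<lambda>z. f (y + z)) N" using m by (intro ps_bounded_shift[OF assms(1)]) auto
  then show ?thesis by (rule real_analytic_atI)
qed

lemma real_analytic_at_vec_isCont:
  fixes h :: "real^'k::finite \<Rightarrow> real^'n::finite"
  assumes "\<And>l. real_analytic_at (\<lambda>x. h x $ l) x" shows "isCont h x"
  unfolding isCont_def
proof (rule vec_tendstoI)
  fix l show "((\<lambda>x. h x $ l) \<longlongrightarrow> h x $ l) (at x)"
    using real_analytic_at_imp_isCont[OF assms] unfolding isCont_def .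
qed

lemma vec_upd_eq: "vec_upd y k s = y + (s - y $ k) *\<^sub>R axis k 1"
  by (auto simp: vec_eq_iff axis_def)

lemma vec_upd_has_derivative: "((\<lambda>s. vec_upd y k s) has_derivative (\<lambda>h. h *\<^sub>R axis k 1)) (at s)"
  unfolding vec_upd_eq by (auto intro!: derivative_eq_intros)

lemma has_real_derivative_axis:
  fixes f :: "real^'n::finite \<Rightarrow> real"
  assumes "real_analytic_at f y"
  shows "((\<lambda>s. f (vec_upd y k s)) has_real_derivative frechet_derivative f (at y) (axis k 1)) (at (y $ k))"
proof -
  have "((\<lambda>s. f (vec_upd y k s)) has_derivative (\<lambda>h. frechet_derivative f (at y) (h *\<^sub>R axis k 1))) (at (y $ k))"
    by (rule has_derivative_compose[OF vec_upd_has_derivative]) (use real_analytic_at_has_derivative[OF assms] in simp)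
  moreover have "(\<lambda>h. frechet_derivative f (at y) (h *\<^sub>R axis k 1)) = (*) (frechet_derivative f (at y) (axis k 1))"
    using linear_frechet_derivative[OF real_analytic_at_differentiable[OF assms]]
    by (auto simp: linear_scale mult.commute)
  ultimately show ?thesis by (simp add: has_field_derivative_def)
qed

lemma frechet_derivative_axis_unique:
  fixes f :: "real^'n::finite \<Rightarrow> real"
  assumes "real_analytic_at f y" "((\<lambda>s. f (vec_upd y k s)) has_real_derivative d) (at (y $ k))"
  shows "frechet_derivative f (at y) (axis k 1) = d"
  by (rule DERIV_unique[OF has_real_derivative_axis[OF assms(1)] assms(2)])

text \<open>Multiplication by the integrating factor \<open>exp (- G)\<close> makes \<open>f\<close>
  constant. This will show that the flow of a field tangent to a coordinate hyperplane preserves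
  it.\<close>

lemma linear_ode_zero:
  fixes f g :: "real \<Rightarrow> real"
  assumes f: "\<And>s. s \<in> {a..b} \<Longrightarrow> (f has_real_derivative f s * g s) (at s within {a..b})"
    and g: "continuous_on {a..b} g" and c: "c \<in> {a..b}" "f c = 0" and t: "t \<in> {a..b}"
  shows "f t = 0"
proof -
  define G where "G = (\<lambda>x. integral {a..x} g)"
  have G: "(G has_real_derivative g x) (at x within {a..b})" if "x \<in> {a..b}" for x
    unfolding G_def by (rule integral_has_real_derivative[OF g that])
  have "\<exists>C. \<forall>x\<in>{a..b}. f x * exp (- G x) = C"
  proof (rule has_field_derivative_zero_constant)
    fix x assume x: "x \<in> {a..b}"
    show "((\<lambda>x. f x * exp (- G x)) has_real_derivative 0) (at x within {a..b})"
      by (rule derivative_eq_intros f[OF x] G[OF x] refl)+ simp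
  qed simp
  then obtain C where C: "\<And>x. x \<in> {a..b} \<Longrightarrow> f x * exp (- G x) = C" by blast
  from C[OF c(1)] c(2) have "C = 0" by simp
  with C[OF t] show ?thesis by simp
qed

lemma isCont_imp_filterlim_nhds:
  "isCont f x \<Longrightarrow> f x = y \<Longrightarrow> filterlim f (nhds y) (nhds x)"
  unfolding isCont_def tendsto_at_iff_tendsto_nhds by simp

text \<open>\<Phi> is the \<open>i\<close>-th component of the flow of the field with components 1
  in direction \<open>k\<close> and \<open>w\<close> in direction \<open>i\<close>, started on the
  slice \<open>y $ k = 0\<close>: the coordinate \<open>k\<close> is time, \<open>y $ i\<close> the
  initial value, and the other coordinates are parameters.\<close>

lemma straightening_ode:
  fixes w :: "real^'n::finite \<Rightarrow> real"
  assumes ik: "i \<noteq> k" and w: "real_analytic_at w 0"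
  obtains r \<Phi> where "r > 0" "\<And>y. y \<in> ocube r \<Longrightarrow> real_analytic_at \<Phi> y"
    "\<And>y. y \<in> ocube r \<Longrightarrow> y $ k = 0 \<Longrightarrow> \<Phi> y = y $ i"
    "\<And>y. y \<in> ocube r \<Longrightarrow> frechet_derivative \<Phi> (at y) (axis k 1) = w (vec_upd y i (\<Phi> y))"
proof -
  \<comment> \<open>The field is to be evaluated at the moving point, so the coordinate
    \<open>i\<close> is overwritten by the unknown.\<close>
  define J where "J = (\<lambda>z :: real^('n option). vec_upd (\<chi> l. z $ Some l) i (z $ None))"
  have Jj: "J (vec_join y x) = vec_upd x i y" for y x by (simp add: J_def vec_eq_iff)
  have J0: "J 0 = 0" by (simp add: J_def vec_eq_iff)
  have "real_analytic_at (\<lambda>z. w (J z)) 0"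
  proof (rule real_analytic_at_compose)
    fix l show "real_analytic_at (\<lambda>z. J z $ l) 0"
      by (cases "l = i") (auto simp: J_def intro: real_analytic_at_coord)
  qed (simp add: J0 w)
  then obtain R M where M: "ps_bounded R (\<lambda>z. w (J z)) M" unfolding real_analytic_at_iff_ps_bounded by auto
  obtain r \<Phi> A where P: "0 < r" "ps_bounded r \<Phi> A"
    "\<And>y. y \<in> cube r \<Longrightarrow> y $ k = 0 \<Longrightarrow> \<Phi> y = y $ i"
    "\<And>y t. y \<in> cube r \<Longrightarrow> t \<in> {-r..r} \<Longrightarrow>
       ((\<lambda>s. \<Phi> (vec_upd y k s)) has_real_derivative w (J (vec_join (\<Phi> (vec_upd y k t)) (vec_upd y k t)))) (at t within {-r..r})"
    by (rule ps_bounded_ode[OF M ps_bounded_coord[OF ps_bounded_pos[OF M], of i], of k]) (use ik in auto)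
  show ?thesis
  proof (rule that[OF P(1)])
    fix y :: "real^'n" assume y: "y \<in> ocube r"
    then have y': "y \<in> cube r" using ocube_cube by blast
    show ra: "real_analytic_at \<Phi> y" by (rule ps_bounded_real_analytic[OF P(2) y])
    show "\<Phi> y = y $ i" if "y $ k = 0" by (rule P(3)[OF y' that])
    have "\<bar>y $ k\<bar> < r" using y by (simp add: ocube_def)
    then have k: "y $ k \<in> {-r..r}" "y $ k \<in> interior {-r..r}" by auto
    have "((\<lambda>s. \<Phi> (vec_upd y k s)) has_real_derivative w (vec_upd y i (\<Phi> y))) (at (y $ k))"
      using P(4)[OF y' k(1)] unfolding at_within_interior[OF k(2)] by (simp add: Jj)
    then show "frechet_derivative \<Phi> (at y) (axis k 1) = w (vec_upd y i (\<Phi> y))"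
      by (rule frechet_derivative_axis_unique[OF ra])
  qed
qed

text \<open>Straightens the vector field \<open>\<partial>\<^sub>k + w \<partial>\<^sub>i\<close>: it is \<open>\<partial>\<^sub>k\<close> in the coordinates \<open>\<Theta>\<close>. The inverse of the
  flow \<open>\<Omega>\<close> is again obtained by solving a differential equation, that of a first integral along
  the lines of direction \<open>k\<close>.\<close>

lemma straightening:
  fixes w :: "real^'n::finite \<Rightarrow> real"
  assumes ik: "i \<noteq> k" and w: "real_analytic_at w 0" and B: "open B" "0 \<in> B"
  obtains D D' \<Theta> \<Omega> where "open D" "0 \<in> D" "D \<subseteq> B" "open D'" "\<Theta> 0 = 0"
    "\<And>x. x \<in> D \<Longrightarrow> \<Theta> x \<in> D' \<and> \<Omega> (\<Theta> x) = x" "\<And>y. y \<in> D' \<Longrightarrow> \<Omega> y \<in> D \<and> \<Theta> (\<Omega> y) = y"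
    "\<And>x l. x \<in> D \<Longrightarrow> real_analytic_at (\<lambda>x. \<Theta> x $ l) x" "\<And>y l. y \<in> D' \<Longrightarrow> real_analytic_at (\<lambda>y. \<Omega> y $ l) y"
    "\<And>x l. l \<noteq> i \<Longrightarrow> \<Theta> x $ l = x $ l" "\<And>y l. l \<noteq> i \<Longrightarrow> \<Omega> y $ l = y $ l"
    "\<And>y. y \<in> D' \<Longrightarrow> frechet_derivative (\<lambda>y. \<Omega> y $ i) (at y) (axis k 1) = w (\<Omega> y)"
    "\<And>y. y \<in> D' \<Longrightarrow> frechet_derivative (\<lambda>y. \<Omega> y $ i) (at y) (axis i 1) \<noteq> 0"
    "\<And>y. eventually (\<lambda>x. x $ i = 0 \<longrightarrow> w x = 0) (nhds 0) \<Longrightarrow> y \<in> D' \<Longrightarrow> y $ i = 0 \<Longrightarrow> \<Omega> y $ i = 0"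
proof -
  obtain r \<Phi> where r: "r > 0" "\<And>y. y \<in> ocube r \<Longrightarrow> real_analytic_at \<Phi> y"
    "\<And>y. y \<in> ocube r \<Longrightarrow> y $ k = 0 \<Longrightarrow> \<Phi> y = y $ i"
    "\<And>y. y \<in> ocube r \<Longrightarrow> frechet_derivative \<Phi> (at y) (axis k 1) = w (vec_upd y i (\<Phi> y))"
    by (rule straightening_ode[OF ik w]) blast
  have b0: "0 \<in> ocube s \<longleftrightarrow> s > 0" for s :: real by (simp add: ocube_def)
  have F0: "\<Phi> 0 = 0" using r(3)[of 0] r(1) by (simp add: b0)
  have raF: "real_analytic_at \<Phi> 0" using r(1,2) b0 by blast
  define \<Omega> where "\<Omega> = (\<lambda>y. vec_upd y i (\<Phi> y))"
  have O0: "\<Omega> 0 = 0" by (simp add: \<Omega>_def F0 vec_eq_iff)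
  have raO: "real_analytic_at (\<lambda>y. \<Omega> y $ l) y" if "y \<in> ocube r" for l y
    by (cases "l = i") (auto simp: \<Omega>_def intro: real_analytic_at_coord r(2)[OF that])
  \<comment> \<open>The derivative of the flow with respect to its starting coordinate. It is 1 at
    the origin because \<Phi> is the coordinate \<open>y $ i\<close> on the slice
    \<open>y $ k = 0\<close>.\<close>
  define q where "q = (\<lambda>y. frechet_derivative \<Phi> (at y) (axis i 1))"
  have raq: "real_analytic_at q 0" unfolding q_def by (rule real_analytic_at_frechet_axis[OF raF])
  have q0: "q 0 = 1"
    unfolding q_def
  proof (rule frechet_derivative_axis_unique[OF raF])
    have eq: "s = \<Phi> (vec_upd 0 i s)" if "s \<in> {-r<..<r}" for s
    proof -
      have "vec_upd 0 i s \<in> ocube r" using r(1) that by (intro vec_upd_ocube) (auto simp: b0)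
      then show ?thesis using r(3) ik by simp
    qed
    have "((\<lambda>s. \<Phi> (vec_upd 0 i s)) has_real_derivative 1) (at 0)"
      by (rule has_field_derivative_transform_within_open[OF DERIV_ident open_greaterThanLessThan _ eq])
        (use r(1) in auto)
    then show "((\<lambda>s. \<Phi> (vec_upd 0 i s)) has_real_derivative 1) (at (0 $ i))" by simp
  qed
  \<comment> \<open>Implicit differentiation: along a level set of \<Phi>, moving in direction
    \<open>k\<close> changes the coordinate \<open>i\<close> at the rate minus
    \<open>\<partial>\<^sub>k \<Phi> / \<partial>\<^sub>i \<Phi>\<close>. Solving for this slope
    yields the inverse of the flow, again analytic.\<close>
  define w2 where "w2 = (\<lambda>y. - w (\<Omega> y) / q y)"
  have "real_analytic_at (\<lambda>y. w (\<Omega> y)) 0"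
    by (rule real_analytic_at_compose) (use w O0 raO b0 r(1) in auto)
  then have "real_analytic_at w2 0"
    unfolding w2_def using raq q0 by (intro real_analytic_at_divide real_analytic_at_uminus) auto
  then obtain r2 \<psi> where r2: "r2 > 0" "\<And>y. y \<in> ocube r2 \<Longrightarrow> real_analytic_at \<psi> y"
    "\<And>y. y \<in> ocube r2 \<Longrightarrow> y $ k = 0 \<Longrightarrow> \<psi> y = y $ i"
    "\<And>y. y \<in> ocube r2 \<Longrightarrow> frechet_derivative \<psi> (at y) (axis k 1) = w2 (vec_upd y i (\<psi> y))"
    by (rule straightening_ode[OF ik]) blast
  define \<Theta> where "\<Theta> = (\<lambda>y. vec_upd y i (\<psi> y))"
  have T0: "\<Theta> 0 = 0" using r2(3)[of 0] r2(1) by (simp add: b0 \<Theta>_def vec_eq_iff)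
  have raT: "real_analytic_at (\<lambda>y. \<Theta> y $ l) y" if "y \<in> ocube r2" for l y
    by (cases "l = i") (auto simp: \<Theta>_def intro: real_analytic_at_coord r2(2)[OF that])
  \<comment> \<open>Invariance of the hyperplane is a conditional conclusion, but the neighbourhoods
    are chosen only once. The quotient \<open>w1\<close> is therefore fixed now, with its properties
    guarded by \<open>Z\<close>.\<close>
  define Z where "Z \<longleftrightarrow> eventually (\<lambda>x. x $ i = 0 \<longrightarrow> w x = 0) (nhds 0)"
  obtain w1 where w1: "Z \<Longrightarrow> eventually (\<lambda>x. real_analytic_at w1 x \<and> w x = x $ i * w1 x) (nhds 0)"
  proof (cases Z)
    case True
    then obtain g where "real_analytic_at g 0" "eventually (\<lambda>y. w y = y $ i * g y) (nhds 0)"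
      using real_analytic_at_divisible[OF w, of i] unfolding Z_def by blast
    then show ?thesis using that[of g] by (simp add: eventually_conj real_analytic_at_eventually)
  qed (use that in blast)
  have contO: "isCont \<Omega> y" if "y \<in> ocube r" for y by (rule real_analytic_at_vec_isCont[OF raO[OF that]])
  have contT: "isCont \<Theta> y" if "y \<in> ocube r2" for y by (rule real_analytic_at_vec_isCont[OF raT[OF that]])
  have tO: "filterlim \<Omega> (nhds 0) (nhds 0)"
    by (rule isCont_imp_filterlim_nhds[OF contO O0]) (use r(1) in \<open>simp add: b0\<close>)
  have tT: "filterlim \<Theta> (nhds 0) (nhds 0)"
    by (rule isCont_imp_filterlim_nhds[OF contT T0]) (use r2(1) in \<open>simp add: b0\<close>)
  have ev_box: "eventually (\<lambda>y. y \<in> ocube s) (nhds 0)" if "s > 0" for s :: real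
    using that open_ocube b0 eventually_nhds by blast
  have "eventually (\<lambda>y. q y > 0) (nhds 0)"
  proof -
    have "filterlim q (nhds 1) (nhds 0)"
      by (rule isCont_imp_filterlim_nhds[OF real_analytic_at_imp_isCont[OF raq] q0])
    then show ?thesis by (rule order_tendstoD) simp
  qed
  moreover have "Z \<Longrightarrow> eventually (\<lambda>y. real_analytic_at w1 (\<Omega> y) \<and> w (\<Omega> y) = \<Omega> y $ i * w1 (\<Omega> y)) (nhds 0)"
    using eventually_compose_filterlim[OF w1 tO] by simp
  then have "eventually (\<lambda>y. Z \<longrightarrow> real_analytic_at w1 (\<Omega> y) \<and> w (\<Omega> y) = \<Omega> y $ i * w1 (\<Omega> y)) (nhds 0)"
    by (cases Z) auto
  ultimately have "eventually (\<lambda>y. q y > 0 \<and> (Z \<longrightarrow> real_analytic_at w1 (\<Omega> y) \<and> w (\<Omega> y) = \<Omega> y $ i * w1 (\<Omega> y)) \<and> y \<in> ocube r) (nhds 0)"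
    using ev_box[OF r(1)] by eventually_elim auto
  then obtain \<rho> where \<rho>': "\<rho> > 0"
    "\<And>y. y \<in> ocube \<rho> \<Longrightarrow> q y > 0 \<and> (Z \<longrightarrow> real_analytic_at w1 (\<Omega> y) \<and> w (\<Omega> y) = \<Omega> y $ i * w1 (\<Omega> y)) \<and> y \<in> ocube r"
    by (rule eventually_nhds_ocube) (rule that; assumption)
  note \<rho> = \<rho>'(1) \<rho>'(2)[THEN conjunct1] \<rho>'(2)[THEN conjunct2, THEN conjunct2]
    \<rho>'(2)[THEN conjunct2, THEN conjunct1, rule_format]
  have "eventually (\<lambda>x. \<Theta> x \<in> ocube \<rho> \<and> x \<in> ocube r2 \<and> x \<in> ocube \<rho>) (nhds 0)"
    using eventually_compose_filterlim[OF ev_box[OF \<rho>(1)] tT] ev_box[OF r2(1)] ev_box[OF \<rho>(1)]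
    by eventually_elim auto
  then obtain \<epsilon> where \<epsilon>': "\<epsilon> > 0" "\<And>x. x \<in> ocube \<epsilon> \<Longrightarrow> \<Theta> x \<in> ocube \<rho> \<and> x \<in> ocube r2 \<and> x \<in> ocube \<rho>"
    by (rule eventually_nhds_ocube) (rule that; assumption)
  note \<epsilon> = \<epsilon>'(1) \<epsilon>'(2)[THEN conjunct1] \<epsilon>'(2)[THEN conjunct2, THEN conjunct1]
    \<epsilon>'(2)[THEN conjunct2, THEN conjunct2]
  \<comment> \<open>Along direction \<open>k\<close> the derivative of
    \<open>\<Phi> (\<Theta> x)\<close> is \<open>\<partial>\<^sub>k \<Phi>\<close> plus the slope
    \<open>w2\<close> times \<open>\<partial>\<^sub>i \<Phi>\<close>, which is zero by the choice of
    the slope. The constant value is found on the slice \<open>x $ k = 0\<close>, where both maps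
    are the identity.\<close>
  have FT: "\<Phi> (\<Theta> x) = x $ i" if x: "x \<in> ocube \<epsilon>" for x
  proof -
    have xk: "\<bar>x $ k\<bar> < \<epsilon>" using x by (simp add: ocube_def)
    have "\<exists>c. \<forall>s\<in>{-\<epsilon><..<\<epsilon>}. \<Phi> (\<Theta> (vec_upd x k s)) = c"
    proof (rule has_field_derivative_zero_constant)
      fix s assume s: "s \<in> {-\<epsilon><..<\<epsilon>}"
      define z where "z = vec_upd x k s"
      have z: "z \<in> ocube \<epsilon>" unfolding z_def using x s by (intro vec_upd_ocube) auto
      define a where "a = frechet_derivative \<psi> (at z) (axis k 1)"
      have "((\<lambda>t. \<psi> (vec_upd z k t)) has_real_derivative a) (at (z $ k))"
        unfolding a_def by (rule has_real_derivative_axis[OF r2(2)[OF \<epsilon>(3)[OF z]]])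
      then have "((\<lambda>t. \<psi> (vec_upd x k t)) has_derivative (\<lambda>h. h * a)) (at s)"
        by (simp add: z_def has_field_derivative_def mult_commute_abs)
      then have "((\<lambda>t. vec_upd x k t + (\<psi> (vec_upd x k t) - x $ i) *\<^sub>R axis i 1) has_derivative (\<lambda>h. h *\<^sub>R axis k 1 + (h * a - 0) *\<^sub>R axis i 1)) (at s)"
        by (intro has_derivative_add vec_upd_has_derivative has_derivative_scaleR_left has_derivative_diff has_derivative_const)
      moreover have "vec_upd x k t + (\<psi> (vec_upd x k t) - x $ i) *\<^sub>R axis i 1 = \<Theta> (vec_upd x k t)" for t
        using ik by (auto simp: \<Theta>_def vec_eq_iff axis_def)
      ultimately have dT: "((\<lambda>t. \<Theta> (vec_upd x k t)) has_derivative (\<lambda>h. h *\<^sub>R (axis k 1 + a *\<^sub>R axis i 1))) (at s)"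
        by (simp add: scaleR_add_right)
      have Tz: "\<Theta> z \<in> ocube \<rho>" by (rule \<epsilon>(2)[OF z])
      let ?d = "frechet_derivative \<Phi> (at (\<Theta> z))"
      have raFz: "real_analytic_at \<Phi> (\<Theta> z)" by (rule r(2)[OF \<rho>(3)[OF Tz]])
      have lin: "linear ?d" by (rule linear_frechet_derivative[OF real_analytic_at_differentiable[OF raFz]])
      have 1: "?d (axis k 1) = w (\<Omega> (\<Theta> z))" using r(4)[OF \<rho>(3)[OF Tz]] by (simp add: \<Omega>_def)
      have 2: "a = - w (\<Omega> (\<Theta> z)) / q (\<Theta> z)"
        unfolding a_def using r2(4)[OF \<epsilon>(3)[OF z]] by (simp add: w2_def \<Theta>_def)
      have "?d (axis k 1 + a *\<^sub>R axis i 1) = ?d (axis k 1) + a * q (\<Theta> z)"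
        using lin by (simp add: linear_add linear_scale q_def)
      also have "\<dots> = 0" unfolding 1 2 using \<rho>(2)[OF Tz] by simp
      finally have d0: "?d (axis k 1 + a *\<^sub>R axis i 1) = 0" .
      have "((\<lambda>t. \<Phi> (\<Theta> (vec_upd x k t))) has_derivative (\<lambda>h. ?d (h *\<^sub>R (axis k 1 + a *\<^sub>R axis i 1)))) (at s)"
        by (rule has_derivative_compose[OF dT]) (use real_analytic_at_has_derivative[OF raFz] in \<open>simp add: z_def\<close>)
      moreover have "(\<lambda>h. ?d (h *\<^sub>R (axis k 1 + a *\<^sub>R axis i 1))) = (*) 0"
        using lin d0 by (auto simp: linear_scale)
      ultimately have "((\<lambda>t. \<Phi> (\<Theta> (vec_upd x k t))) has_real_derivative 0) (at s)"
        by (simp add: has_field_derivative_def)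
      then show "((\<lambda>t. \<Phi> (\<Theta> (vec_upd x k t))) has_real_derivative 0) (at s within {-\<epsilon><..<\<epsilon>})"
        by (rule has_field_derivative_at_within)
    qed simp
    then obtain c where c: "\<And>s. s \<in> {-\<epsilon><..<\<epsilon>} \<Longrightarrow> \<Phi> (\<Theta> (vec_upd x k s)) = c" by blast
    have z: "vec_upd x k 0 \<in> ocube \<epsilon>" using x \<epsilon>(1) by (intro vec_upd_ocube) auto
    have "\<Theta> (vec_upd x k 0) = vec_upd x k 0"
      using r2(3)[OF \<epsilon>(3)[OF z]] ik by (auto simp: \<Theta>_def vec_eq_iff)
    moreover have "\<Phi> (vec_upd x k 0) = x $ i" using r(3)[OF \<rho>(3)[OF \<epsilon>(4)[OF z]]] ik by simp
    ultimately have "c = x $ i" using c[of 0] \<epsilon>(1) by simp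
    then show ?thesis using c[of "x $ k"] xk by (auto simp: abs_less_iff)
  qed
  have OT: "\<Omega> (\<Theta> x) = x" if x: "x \<in> ocube \<epsilon>" for x
    using FT[OF x] by (auto simp: \<Omega>_def \<Theta>_def vec_eq_iff)
  \<comment> \<open>\<Omega> changes only the coordinate \<open>i\<close>, and \<Phi> is strictly
    increasing in it since \<open>q > 0\<close>; the segment joining the two points stays in the
    cube.\<close>
  have inj: "y = z" if y: "y \<in> ocube \<rho>" and z: "z \<in> ocube \<rho>" and eq: "\<Omega> y = \<Omega> z" for y z
  proof -
    have l: "z $ l = y $ l" if "l \<noteq> i" for l
      using arg_cong[OF eq, of "\<lambda>v. v $ l"] that by (simp add: \<Omega>_def)
    have F: "\<Phi> y = \<Phi> z" using arg_cong[OF eq, of "\<lambda>v. v $ i"] by (simp add: \<Omega>_def)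
    have z': "vec_upd y i (z $ i) = z" using l by (auto simp: vec_eq_iff)
    have strict: "False" if st: "s < t" "\<bar>s\<bar> < \<rho>" "\<bar>t\<bar> < \<rho>" and e: "\<Phi> (vec_upd y i s) = \<Phi> (vec_upd y i t)" for s t
    proof -
      have "\<Phi> (vec_upd y i s) < \<Phi> (vec_upd y i t)"
      proof (rule DERIV_pos_imp_increasing[OF st(1)])
        fix u assume "s \<le> u" "u \<le> t"
        then have u: "vec_upd y i u \<in> ocube \<rho>" using st y by (intro vec_upd_ocube) auto
        from has_real_derivative_axis[OF r(2)[OF \<rho>(3)[OF u]], of i] \<rho>(2)[OF u]
        show "\<exists>d. ((\<lambda>u. \<Phi> (vec_upd y i u)) has_real_derivative d) (at u) \<and> 0 < d"
          by (auto simp: q_def)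
      qed
      then show False using e by simp
    qed
    have "\<bar>y $ i\<bar> < \<rho>" "\<bar>z $ i\<bar> < \<rho>" using y z by (auto simp: ocube_def)
    then have "y $ i = z $ i"
      using strict[of "y $ i" "z $ i"] strict[of "z $ i" "y $ i"] F z' by (force simp: not_less_iff_gr_or_eq)
    with z' show ?thesis by (metis vec_upd_self)
  qed
  \<comment> \<open>\<open>OT\<close> gives only a left inverse. Cutting down to points whose images
    stay in the small cube lets \<open>inj\<close> turn it into a two-sided one.\<close>
  define D where "D = {x \<in> ocube \<epsilon> \<inter> B. \<Theta> x \<in> ocube \<epsilon>}"
  define D' where "D' = {y \<in> ocube \<epsilon>. \<Omega> y \<in> D}"
  have D': "\<Theta> (\<Omega> y) = y" if "y \<in> D'" for y
  proof (rule inj)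
    show "\<Theta> (\<Omega> y) \<in> ocube \<rho>" "y \<in> ocube \<rho>" "\<Omega> (\<Theta> (\<Omega> y)) = \<Omega> y"
      using that \<epsilon> OT by (auto simp: D'_def D_def)
  qed
  have oD: "open D"
  proof -
    have "open (ocube \<epsilon> \<inter> B)" using open_ocube B(1) by blast
    moreover have "continuous_on (ocube \<epsilon> \<inter> B) \<Theta>"
      using contT \<epsilon>(3) by (intro continuous_at_imp_continuous_on) blast
    ultimately have "open ((ocube \<epsilon> \<inter> B) \<inter> \<Theta> -` ocube \<epsilon>)"
      by (intro continuous_open_preimage open_ocube)
    moreover have "D = (ocube \<epsilon> \<inter> B) \<inter> \<Theta> -` ocube \<epsilon>" by (auto simp: D_def)
    ultimately show ?thesis by simp
  qed
  have oD': "open D'"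
  proof -
    have "continuous_on (ocube \<epsilon>) \<Omega>"
      using contO \<rho>(3) \<epsilon>(4) by (intro continuous_at_imp_continuous_on) blast
    then have "open (ocube \<epsilon> \<inter> \<Omega> -` D)" by (intro continuous_open_preimage open_ocube oD)
    moreover have "D' = ocube \<epsilon> \<inter> \<Omega> -` D" by (auto simp: D'_def)
    ultimately show ?thesis by simp
  qed
  show ?thesis
  proof (rule that[of D D' \<Theta> \<Omega>])
    show "0 \<in> D" using B(2) \<epsilon>(1) by (simp add: D_def T0 b0)
    show "D \<subseteq> B" by (auto simp: D_def)
    show "\<Theta> 0 = 0" by (rule T0)
    show "\<Theta> x \<in> D' \<and> \<Omega> (\<Theta> x) = x" if "x \<in> D" for x
      using that OT by (auto simp: D'_def D_def)
    show "\<Omega> y \<in> D \<and> \<Theta> (\<Omega> y) = y" if "y \<in> D'" for y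
      using that D' by (auto simp: D'_def)
    show "real_analytic_at (\<lambda>x. \<Theta> x $ l) x" if "x \<in> D" for x l
      using that \<epsilon>(3) raT by (auto simp: D_def)
    have Dr: "y \<in> ocube r" if "y \<in> D'" for y using that \<rho>(3) \<epsilon>(4) by (auto simp: D'_def)
    show "real_analytic_at (\<lambda>y. \<Omega> y $ l) y" if "y \<in> D'" for y l by (rule raO[OF Dr[OF that]])
    have Oi: "(\<lambda>y. \<Omega> y $ i) = \<Phi>" by (simp add: \<Omega>_def)
    show "frechet_derivative (\<lambda>y. \<Omega> y $ i) (at y) (axis k 1) = w (\<Omega> y)" if "y \<in> D'" for y
      unfolding Oi using r(4)[OF Dr[OF that]] by (simp add: \<Omega>_def)
    show "frechet_derivative (\<lambda>y. \<Omega> y $ i) (at y) (axis i 1) \<noteq> 0" if "y \<in> D'" for y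
      unfolding Oi using \<rho>(2)[of y] that \<epsilon>(4)[of y] by (auto simp: D'_def q_def)
    \<comment> \<open>On the hyperplane \<open>y $ i = 0\<close> the flow solves a homogeneous
      linear equation in direction \<open>k\<close>, with coefficient \<open>w1\<close> along the
      trajectory and initial value 0.\<close>
    show "\<Omega> y $ i = 0" if ev: "eventually (\<lambda>x. x $ i = 0 \<longrightarrow> w x = 0) (nhds 0)" and y: "y \<in> D'" "y $ i = 0" for y
    proof -
      have Z: Z using ev by (simp add: Z_def)
      have ye: "y \<in> ocube \<epsilon>" using y(1) by (simp add: D'_def)
      define m where "m = \<bar>y $ k\<bar>"
      have m: "m < \<epsilon>" "0 \<le> m" using ye by (auto simp: ocube_def m_def)
      have z: "vec_upd y k s \<in> ocube \<rho>" if "s \<in> {-m..m}" for s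
        using that m ye by (intro \<epsilon>(4) vec_upd_ocube) auto
      have "\<Phi> (vec_upd y k (y $ k)) = 0"
      proof (rule linear_ode_zero[where f = "\<lambda>s. \<Phi> (vec_upd y k s)" and a = "-m" and b = m and c = 0 and g = "\<lambda>s. w1 (\<Omega> (vec_upd y k s))"])
        fix s assume s: "s \<in> {-m..m}"
        from has_real_derivative_axis[OF r(2)[OF \<rho>(3)[OF z[OF s]]], of k]
        have "((\<lambda>s. \<Phi> (vec_upd y k s)) has_real_derivative w (\<Omega> (vec_upd y k s))) (at s)"
          using r(4)[OF \<rho>(3)[OF z[OF s]]] by (simp add: \<Omega>_def)
        then have "((\<lambda>s. \<Phi> (vec_upd y k s)) has_real_derivative w (\<Omega> (vec_upd y k s))) (at s within {-m..m})"
          by (rule has_field_derivative_at_within)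
        moreover have "w (\<Omega> (vec_upd y k s)) = \<Phi> (vec_upd y k s) * w1 (\<Omega> (vec_upd y k s))"
          using \<rho>(4)[OF z[OF s] Z] by (simp add: \<Omega>_def)
        ultimately show "((\<lambda>s. \<Phi> (vec_upd y k s)) has_real_derivative \<Phi> (vec_upd y k s) * w1 (\<Omega> (vec_upd y k s))) (at s within {-m..m})" by simp
      next
        show "continuous_on {-m..m} (\<lambda>s. w1 (\<Omega> (vec_upd y k s)))"
        proof (intro continuous_at_imp_continuous_on ballI)
          fix s assume s: "s \<in> {-m..m}"
          have 1: "isCont (\<lambda>s. vec_upd y k s) s" by (rule has_derivative_continuous[OF vec_upd_has_derivative])
          have 2: "isCont \<Omega> (vec_upd y k s)" by (rule contO[OF \<rho>(3)[OF z[OF s]]])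
          have 3: "isCont w1 (\<Omega> (vec_upd y k s))"
            using \<rho>(4)[OF z[OF s] Z] real_analytic_at_imp_isCont by blast
          show "isCont (\<lambda>s. w1 (\<Omega> (vec_upd y k s))) s"
            by (rule continuous_within_compose3[OF 3 continuous_within_compose3[OF 2 1]])
        qed
      next
        have z0: "vec_upd y k 0 \<in> ocube \<rho>" using m by (intro z) auto
        show "\<Phi> (vec_upd y k 0) = 0" using r(3)[OF \<rho>(3)[OF z0]] y(2) ik by simp
      qed (use m in \<open>auto simp: m_def\<close>)
      then show ?thesis by (simp add: \<Omega>_def)
    qed
  qed (auto simp: oD oD' \<Theta>_def \<Omega>_def)
qed

section \<open>Charts and tangent vectors\<close>

lemma has_derivative_cong_nhds:
  assumes "eventually (\<lambda>y. f y = g y) (nhds x)"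
  shows "(f has_derivative D) (at x) \<longleftrightarrow> (g has_derivative D) (at x)"
proof -
  have e: "eventually (\<lambda>y. f y = g y) (at x)" "f x = g x"
    using assms eventually_nhds_x_imp_x by (auto simp: eventually_at_filter elim: eventually_mono)
  have e': "eventually (\<lambda>y. g y = f y) (at x)" using e(1) by eventually_elim simp
  show ?thesis
    using has_derivative_transform_eventually[OF _ e(1), of D] e(2)
      has_derivative_transform_eventually[OF _ e', of D] by auto
qed

lemma frechet_derivative_cong_nhds:
  assumes "eventually (\<lambda>y. f y = g y) (nhds x)"
  shows "frechet_derivative f (at x) = frechet_derivative g (at x)"
  unfolding frechet_derivative_def has_derivative_cong_nhds[OF assms] ..

lemma has_derivative_vec_componentwise:
  fixes h :: "real^'k::finite \<Rightarrow> real^'n::finite"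
  assumes "\<And>j. ((\<lambda>x. h x $ j) has_derivative D j) (at x)"
  shows "(h has_derivative (\<lambda>v. \<chi> j. D j v)) (at x)"
  unfolding has_derivative_componentwise_within[of h]
proof
  fix b :: "real^'n" assume "b \<in> Basis"
  then obtain j where "b = axis j 1" by (auto simp: Basis_vec_def)
  then show "((\<lambda>x. h x \<bullet> b) has_derivative (\<lambda>v. (\<chi> j. D j v) \<bullet> b)) (at x)"
    using assms[of j] by (simp add: inner_axis)
qed

lemma frechet_derivative_chain:
  fixes h :: "real^'k::finite \<Rightarrow> real^'n::finite"
  assumes h: "\<And>j. real_analytic_at (\<lambda>x. h x $ j) x" and F: "real_analytic_at F (h x)"
  shows "frechet_derivative (\<lambda>x. F (h x)) (at x) v
    = frechet_derivative F (at (h x)) (\<chi> j. frechet_derivative (\<lambda>x. h x $ j) (at x) v)"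
proof -
  have "(h has_derivative (\<lambda>v. \<chi> j. frechet_derivative (\<lambda>x. h x $ j) (at x) v)) (at x)"
    by (rule has_derivative_vec_componentwise[OF real_analytic_at_has_derivative[OF h]])
  from has_derivative_compose[OF this real_analytic_at_has_derivative[OF F]]
  show ?thesis by (simp add: frechet_derivative_at[symmetric])
qed

lemma frechet_derivative_coord: "frechet_derivative (\<lambda>x::real^'n::finite. x $ i) (at x) v = v $ i"
proof -
  have "((\<lambda>x::real^'n. x $ i) has_derivative (\<lambda>v. v $ i)) (at x)"
    by (rule bounded_linear_imp_has_derivative[OF bounded_linear_vec_nth])
  then show ?thesis by (simp add: frechet_derivative_at[symmetric])
qed

lemma frechet_derivative_lincomb:
  assumes "real_analytic_at f x"
  shows "frechet_derivative f (at x) (a *\<^sub>R v + b *\<^sub>R w) = a * frechet_derivative f (at x) v + b * frechet_derivative f (at x) w"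
  using linear_frechet_derivative[OF real_analytic_at_differentiable[OF assms]]
  by (simp add: linear_add linear_scale)

section \<open>Charts as homeomorphisms onto open subsets of Euclidean space\<close>

context
  fixes M :: "('a, 'n::finite) mfd" and U :: "'a set" and \<phi> :: "'a \<Rightarrow> real^'n"
  assumes ch: "chart M U \<phi>"
begin

lemma chart_openin: "openin (mtop M) U" and chart_open_image: "open (\<phi> ` U)"
  and chart_homeo: "homeomorphic_map (subtopology (mtop M) U) (top_of_set (\<phi> ` U)) \<phi>"
  using ch by (auto simp: chart_def)

lemma chart_subset: "U \<subseteq> pts M" using chart_openin openin_subset by blast

lemma chart_topspace: "topspace (subtopology (mtop M) U) = U" using chart_subset by auto

lemma chart_inj: "inj_on \<phi> U"
  using homeomorphic_imp_injective_map[OF chart_homeo] chart_topspace by simp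

lemma chart_inv [simp]: "q \<in> U \<Longrightarrow> inv_into U \<phi> (\<phi> q) = q"
  using chart_inj by simp

lemma chart_image_open:
  assumes "openin (mtop M) W" shows "open (\<phi> ` (W \<inter> U))"
proof -
  have "openin (subtopology (mtop M) U) (W \<inter> U)" using assms by (rule openin_subtopology_Int)
  then have "openin (top_of_set (\<phi> ` U)) (\<phi> ` (W \<inter> U))"
    using homeomorphic_imp_open_map[OF chart_homeo] by (simp add: open_map_def)
  then show ?thesis using openin_open_trans chart_open_image by blast
qed

lemma chart_vimage_open:
  assumes "open S" shows "openin (mtop M) {q\<in>U. \<phi> q \<in> S}"
proof -
  have "openin (top_of_set (\<phi> ` U)) (\<phi> ` U \<inter> S)" using assms by (rule openin_open_Int)
  then have "openin (subtopology (mtop M) U) {q \<in> topspace (subtopology (mtop M) U). \<phi> q \<in> \<phi> ` U \<inter> S}"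
    using homeomorphic_imp_continuous_map[OF chart_homeo] unfolding continuous_map_def by blast
  moreover have "{q \<in> topspace (subtopology (mtop M) U). \<phi> q \<in> \<phi> ` U \<inter> S} = {q\<in>U. \<phi> q \<in> S}"
    unfolding chart_topspace by auto
  ultimately show ?thesis using openin_trans_full chart_openin by metis
qed

lemma eventually_chart_range: "p \<in> U \<Longrightarrow> eventually (\<lambda>x. x \<in> \<phi> ` U) (nhds (\<phi> p))"
  using chart_open_image eventually_nhds by blast

lemma near_chart:
  assumes "p \<in> U" shows "near M p P \<longleftrightarrow> eventually (\<lambda>x. P (inv_into U \<phi> x)) (nhds (\<phi> p))"
proof
  assume "near M p P"
  then obtain W where W: "openin (mtop M) W" "p \<in> W" "\<forall>q\<in>W. P q" unfolding near_def by blast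
  show "eventually (\<lambda>x. P (inv_into U \<phi> x)) (nhds (\<phi> p))"
    unfolding eventually_nhds
    by (rule exI[of _ "\<phi> ` (W \<inter> U)"]) (use W assms chart_image_open in auto)
next
  assume "eventually (\<lambda>x. P (inv_into U \<phi> x)) (nhds (\<phi> p))"
  then obtain S where S: "open S" "\<phi> p \<in> S" "\<forall>x\<in>S. P (inv_into U \<phi> x)" unfolding eventually_nhds by blast
  show "near M p P" unfolding near_def
  proof (intro exI conjI ballI)
    show "openin (mtop M) {q\<in>U. \<phi> q \<in> S}" by (rule chart_vimage_open[OF S(1)])
    fix q assume "q \<in> {q\<in>U. \<phi> q \<in> S}"
    then show "P q" using S(3)[rule_format, of "\<phi> q"] by simp
  qed (use S assms in auto)
qed

end

lemma near_mono: "near M p P \<Longrightarrow> (\<And>q. P q \<Longrightarrow> Q q) \<Longrightarrow> near M p Q"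
  unfolding near_def by blast

lemma near_conj: "near M p P \<Longrightarrow> near M p Q \<Longrightarrow> near M p (\<lambda>q. P q \<and> Q q)"
  unfolding near_def by (metis Int_iff openin_Int)

lemma near_openin: "openin (mtop M) W \<Longrightarrow> p \<in> W \<Longrightarrow> near M p (\<lambda>q. q \<in> W)"
  unfolding near_def by blast

lemma atlas_chart: "analytic_manifold M \<Longrightarrow> (V, \<psi>) \<in> atlas M \<Longrightarrow> chart M V \<psi>"
  unfolding analytic_manifold_def by blast

lemma atlas_cover:
  assumes "analytic_manifold M" "p \<in> pts M" obtains V \<psi> where "(V, \<psi>) \<in> atlas M" "p \<in> V"
proof -
  have "p \<in> (\<Union>(U, \<phi>)\<in>atlas M. U)" using assms unfolding analytic_manifold_def by simp
  then show ?thesis using that by auto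
qed

lemma chart_transition:
  assumes "chart M U \<phi>" "(V, \<psi>) \<in> atlas M" "p \<in> U" "p \<in> V"
  shows "real_analytic_at (\<lambda>x. \<phi> (inv_into V \<psi> x) $ i) (\<psi> p)" "real_analytic_at (\<lambda>x. \<psi> (inv_into U \<phi> x) $ i) (\<phi> p)"
  using assms unfolding chart_def by blast+

lemma chart_change:
  assumes U: "chart M U \<phi>" and V: "chart M V \<psi>" and p: "p \<in> U" "p \<in> V"
  shows "eventually (\<lambda>x. f (inv_into U \<phi> x) = f (inv_into V \<psi> (\<psi> (inv_into U \<phi> x)))) (nhds (\<phi> p))"
proof -
  have "near M p (\<lambda>q. q \<in> V)" by (rule near_openin[OF chart_openin[OF V] p(2)])
  then have "eventually (\<lambda>x. inv_into U \<phi> x \<in> V) (nhds (\<phi> p))" using near_chart[OF U p(1)] by simp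
  then show ?thesis by eventually_elim (simp add: chart_inv[OF V])
qed

text \<open>Transition maps are analytic in both directions, so one chart decides, and it may come
  from the maximal atlas and not only from \<open>atlas M\<close>. The coordinates constructed later
  are of this kind.\<close>

lemma analytic_at_iff_chart:
  assumes M: "analytic_manifold M" and U: "chart M U \<phi>" and p: "p \<in> U"
  shows "analytic_at M f p \<longleftrightarrow> real_analytic_at (\<lambda>x. f (inv_into U \<phi> x)) (\<phi> p)"
proof
  assume f: "analytic_at M f p"
  then have "p \<in> pts M" by (simp add: analytic_at_def)
  then obtain V \<psi> where V: "(V, \<psi>) \<in> atlas M" "p \<in> V" by (rule atlas_cover[OF M])
  note ch = atlas_chart[OF M V(1)]
  have "real_analytic_at (\<lambda>x. f (inv_into V \<psi> x)) (\<psi> (inv_into U \<phi> (\<phi> p)))"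
    using f V p by (auto simp: analytic_at_def chart_inv[OF U])
  then have "real_analytic_at (\<lambda>x. f (inv_into V \<psi> (\<psi> (inv_into U \<phi> x)))) (\<phi> p)"
    by (rule real_analytic_at_compose) (rule chart_transition(2)[OF U V(1) p V(2)])
  then show "real_analytic_at (\<lambda>x. f (inv_into U \<phi> x)) (\<phi> p)"
    by (rule real_analytic_at_cong) (use chart_change[OF U ch p V(2), of f] in eventually_elim, simp)
next
  assume f: "real_analytic_at (\<lambda>x. f (inv_into U \<phi> x)) (\<phi> p)"
  show "analytic_at M f p" unfolding analytic_at_def
  proof (intro conjI ballI, goal_cases)
    case 1 show ?case using chart_subset[OF U] p by blast
  next
    case (2 z)
    obtain V \<psi> where z: "z = (V, \<psi>)" by (cases z)
    have "real_analytic_at (\<lambda>x. f (inv_into V \<psi> x)) (\<psi> p)" if "p \<in> V"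
    proof -
      have V: "(V, \<psi>) \<in> atlas M" using 2 z by simp
      note ch = atlas_chart[OF M V]
      have "real_analytic_at (\<lambda>x. f (inv_into U \<phi> x)) (\<phi> (inv_into V \<psi> (\<psi> p)))"
        using f that by (simp add: chart_inv[OF ch])
      then have "real_analytic_at (\<lambda>x. f (inv_into U \<phi> (\<phi> (inv_into V \<psi> x)))) (\<psi> p)"
        by (rule real_analytic_at_compose) (rule chart_transition(1)[OF U V p that])
      then show ?thesis
        by (rule real_analytic_at_cong) (use chart_change[OF ch U that p, of f] in eventually_elim, simp)
    qed
    then show ?case by (simp add: z)
  qed
qed

lemma analytic_at_pts: "analytic_at M f p \<Longrightarrow> p \<in> pts M" by (simp add: analytic_at_def)

lemma analytic_at_cong:
  assumes M: "analytic_manifold M" and f: "analytic_at M f p" and n: "near M p (\<lambda>q. f q = g q)"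
  shows "analytic_at M g p"
proof -
  obtain V \<psi> where V: "(V, \<psi>) \<in> atlas M" "p \<in> V" by (rule atlas_cover[OF M analytic_at_pts[OF f]])
  note ch = atlas_chart[OF M V(1)]
  show ?thesis
    using f n unfolding analytic_at_iff_chart[OF M ch V(2)] near_chart[OF ch V(2)]
    by (rule real_analytic_at_cong)
qed

lemma analytic_at_compose:
  fixes F :: "real^'k::finite \<Rightarrow> real"
  assumes M: "analytic_manifold M" and p: "p \<in> pts M"
    and F: "real_analytic_at F (h p)" and h: "\<And>j. analytic_at M (\<lambda>q. h q $ j) p"
  shows "analytic_at M (\<lambda>q. F (h q)) p"
proof -
  obtain V \<psi> where V: "(V, \<psi>) \<in> atlas M" "p \<in> V" by (rule atlas_cover[OF M p])
  note ch = atlas_chart[OF M V(1)]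
  show ?thesis
    using F h unfolding analytic_at_iff_chart[OF M ch V(2)]
    by (intro real_analytic_at_compose[where F = F and h = "\<lambda>x. h (inv_into V \<psi> x)"])
      (simp_all add: chart_inv[OF ch V(2)])
qed

lemma near_analytic_at:
  assumes M: "analytic_manifold M" and f: "analytic_at M f p"
  shows "near M p (analytic_at M f)"
proof -
  obtain V \<psi> where V: "(V, \<psi>) \<in> atlas M" "p \<in> V" by (rule atlas_cover[OF M analytic_at_pts[OF f]])
  note ch = atlas_chart[OF M V(1)]
  have "eventually (real_analytic_at (\<lambda>x. f (inv_into V \<psi> x))) (nhds (\<psi> p))"
    using f real_analytic_at_eventually unfolding analytic_at_iff_chart[OF M ch V(2)] by blast
  with eventually_chart_range[OF ch V(2)]
  have "eventually (\<lambda>x. analytic_at M f (inv_into V \<psi> x)) (nhds (\<psi> p))"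
  proof eventually_elim
    case (elim x)
    then show ?case using analytic_at_iff_chart[OF M ch, of "inv_into V \<psi> x" f]
      by (simp add: inv_into_into f_inv_into_f)
  qed
  then show ?thesis unfolding near_chart[OF ch V(2)] .
qed

lemma eventually_chart_coord:
  assumes "chart M U \<phi>" "p \<in> U"
  shows "eventually (\<lambda>x. \<phi> (inv_into U \<phi> x) = x) (nhds (\<phi> p))"
  using eventually_chart_range[OF assms] by eventually_elim (simp add: f_inv_into_f)

lemma analytic_at_chart_coord:
  assumes M: "analytic_manifold M" and U: "chart M U \<phi>" and p: "p \<in> U"
  shows "analytic_at M (\<lambda>q. \<phi> q $ i) p"
  unfolding analytic_at_iff_chart[OF assms]
  by (rule real_analytic_at_cong[OF real_analytic_at_coord])
    (use eventually_chart_coord[OF U p] in eventually_elim, simp)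

section \<open>Tangent vectors in coordinates\<close>

lemma chart_vector_coord:
  assumes M: "analytic_manifold M" and U: "chart M U \<phi>" and p: "p \<in> U"
  shows "chart_vector M U \<phi> p v (\<lambda>q. \<phi> q $ i) = v $ i"
proof -
  have "eventually (\<lambda>x. \<phi> (inv_into U \<phi> x) $ i = x $ i) (nhds (\<phi> p))"
    using eventually_chart_coord[OF U p] by eventually_elim simp
  from frechet_derivative_cong_nhds[OF this] show ?thesis
    by (simp add: chart_vector_def analytic_at_chart_coord[OF assms] frechet_derivative_coord)
qed

lemma chart_vector_chain:
  fixes F :: "real^'k::finite \<Rightarrow> real"
  assumes M: "analytic_manifold M" and U: "chart M U \<phi>" and p: "p \<in> U"
    and F: "real_analytic_at F (h p)" and h: "\<And>j. analytic_at M (\<lambda>q. h q $ j) p"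
  shows "chart_vector M U \<phi> p v (\<lambda>q. F (h q))
    = frechet_derivative F (at (h p)) (\<chi> j. chart_vector M U \<phi> p v (\<lambda>q. h q $ j))"
proof -
  have an: "analytic_at M (\<lambda>q. F (h q)) p"
    by (rule analytic_at_compose[where F = F and h = h, OF M _ F h]) (use chart_subset[OF U] p in auto)
  have "frechet_derivative (\<lambda>x. F (h (inv_into U \<phi> x))) (at (\<phi> p)) v
    = frechet_derivative F (at (h (inv_into U \<phi> (\<phi> p)))) (\<chi> j. frechet_derivative (\<lambda>x. h (inv_into U \<phi> x) $ j) (at (\<phi> p)) v)"
    by (rule frechet_derivative_chain)
      (use F h in \<open>auto simp: chart_inv[OF U p] analytic_at_iff_chart[OF M U p]\<close>)
  then show ?thesis using an h by (simp add: chart_vector_def chart_inv[OF U p])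
qed

text \<open>Tangent vectors are normalised to 0 on functions that are not analytic at
  \<open>p\<close>, so locality requires the analyticity of \<open>f\<close> and \<open>g\<close> at
  \<open>p\<close> to be equivalent as well.\<close>

lemma chart_vector_cong:
  assumes M: "analytic_manifold M" and U: "chart M U \<phi>" and p: "p \<in> U"
    and n: "near M p (\<lambda>q. f q = g q)"
  shows "chart_vector M U \<phi> p v f = chart_vector M U \<phi> p v g"
proof -
  have n': "near M p (\<lambda>q. g q = f q)" by (rule near_mono[OF n]) simp
  have "analytic_at M f p \<longleftrightarrow> analytic_at M g p"
    using analytic_at_cong[OF M _ n] analytic_at_cong[OF M _ n'] by blast
  moreover have "frechet_derivative (\<lambda>x. f (inv_into U \<phi> x)) (at (\<phi> p)) = frechet_derivative (\<lambda>x. g (inv_into U \<phi> x)) (at (\<phi> p))"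
    by (rule frechet_derivative_cong_nhds) (use n near_chart[OF U p] in simp)
  ultimately show ?thesis by (simp add: chart_vector_def)
qed

text \<open>An equality of functionals on all functions: on those analytic at \<open>p\<close> it is
  the chain rule, on the others both sides are 0 by the normalisation.\<close>

lemma chart_vector_change:
  assumes M: "analytic_manifold M" and U: "chart M U \<phi>" and p: "p \<in> U"
    and V: "chart M V \<psi>" and pV: "p \<in> V"
  shows "chart_vector M U \<phi> p v = chart_vector M V \<psi> p (\<chi> j. chart_vector M U \<phi> p v (\<lambda>q. \<psi> q $ j))"
proof
  fix f
  show "chart_vector M U \<phi> p v f = chart_vector M V \<psi> p (\<chi> j. chart_vector M U \<phi> p v (\<lambda>q. \<psi> q $ j)) f"
  proof (cases "analytic_at M f p")
    case True
    have "near M p (\<lambda>q. q \<in> V)" by (rule near_openin[OF chart_openin[OF V] pV])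
    then have n: "near M p (\<lambda>q. f q = f (inv_into V \<psi> (\<psi> q)))"
      by (rule near_mono) (simp add: chart_inv[OF V])
    have "chart_vector M U \<phi> p v f = chart_vector M U \<phi> p v (\<lambda>q. f (inv_into V \<psi> (\<psi> q)))"
      by (rule chart_vector_cong[OF M U p n])
    also have "\<dots> = frechet_derivative (\<lambda>x. f (inv_into V \<psi> x)) (at (\<psi> p)) (\<chi> j. chart_vector M U \<phi> p v (\<lambda>q. \<psi> q $ j))"
      by (rule chart_vector_chain[OF M U p, where F = "\<lambda>x. f (inv_into V \<psi> x)"])
        (use True in \<open>auto simp: analytic_at_iff_chart[OF M V pV, symmetric] analytic_at_chart_coord[OF M V pV]\<close>)
    also have "\<dots> = chart_vector M V \<psi> p (\<chi> j. chart_vector M U \<phi> p v (\<lambda>q. \<psi> q $ j)) f"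
      using True by (simp add: chart_vector_def)
    finally show ?thesis .
  qed (simp add: chart_vector_def)
qed

lemma chart_vector_tangent:
  assumes M: "analytic_manifold M" and U: "chart M U \<phi>" and p: "p \<in> U"
  shows "chart_vector M U \<phi> p v \<in> tangent_space M p"
proof -
  have "p \<in> pts M" using chart_subset[OF U] p by blast
  then obtain V \<psi> where V: "(V, \<psi>) \<in> atlas M" "p \<in> V" by (rule atlas_cover[OF M])
  show ?thesis
    unfolding tangent_space_def mem_Collect_eq
    using chart_vector_change[OF M U p atlas_chart[OF M V(1)] V(2)] V by blast
qed

lemma tangent_repr:
  assumes M: "analytic_manifold M" and U: "chart M U \<phi>" and p: "p \<in> U" and \<xi>: "\<xi> \<in> tangent_space M p"
  shows "\<xi> = chart_vector M U \<phi> p (\<chi> i. \<xi> (\<lambda>q. \<phi> q $ i))"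
proof -
  obtain V \<psi> v where V: "(V, \<psi>) \<in> atlas M" "p \<in> V" "\<xi> = chart_vector M V \<psi> p v"
    using \<xi> unfolding tangent_space_def by blast
  show ?thesis unfolding V(3) by (rule chart_vector_change[OF M atlas_chart[OF M V(1)] V(2) U p])
qed

lemma tangent_chain:
  fixes F :: "real^'k::finite \<Rightarrow> real"
  assumes M: "analytic_manifold M" and \<xi>: "\<xi> \<in> tangent_space M p"
    and F: "real_analytic_at F (h p)" and h: "\<And>j. analytic_at M (\<lambda>q. h q $ j) p"
  shows "\<xi> (\<lambda>q. F (h q)) = frechet_derivative F (at (h p)) (\<chi> j. \<xi> (\<lambda>q. h q $ j))"
proof -
  obtain V \<psi> v where V: "(V, \<psi>) \<in> atlas M" "p \<in> V" "\<xi> = chart_vector M V \<psi> p v"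
    using \<xi> unfolding tangent_space_def by blast
  show ?thesis unfolding V(3) by (rule chart_vector_chain[OF M atlas_chart[OF M V(1)] V(2) F h])
qed

lemma tangent_cong:
  assumes M: "analytic_manifold M" and \<xi>: "\<xi> \<in> tangent_space M p" and n: "near M p (\<lambda>q. f q = g q)"
  shows "\<xi> f = \<xi> g"
proof -
  obtain V \<psi> v where V: "(V, \<psi>) \<in> atlas M" "p \<in> V" "\<xi> = chart_vector M V \<psi> p v"
    using \<xi> unfolding tangent_space_def by blast
  show ?thesis unfolding V(3) by (rule chart_vector_cong[OF M atlas_chart[OF M V(1)] V(2) n])
qed

lemma chart_vector_lincomb:
  assumes M: "analytic_manifold M" and U: "chart M U \<phi>" and p: "p \<in> U"
  shows "lincomb x (chart_vector M U \<phi> p v) y (chart_vector M U \<phi> p w) = chart_vector M U \<phi> p (x *\<^sub>R v + y *\<^sub>R w)"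
  by (auto simp: lincomb_def chart_vector_def fun_eq_iff frechet_derivative_lincomb analytic_at_iff_chart[OF M U p])

section \<open>Forms, metrics and pull-backs\<close>

lemma analytic_at_const: "analytic_manifold M \<Longrightarrow> p \<in> pts M \<Longrightarrow> analytic_at M (\<lambda>_. c) p"
  by (simp add: analytic_at_def)

lemma analytic_at_add:
  assumes M: "analytic_manifold M" and f: "analytic_at M f p" and g: "analytic_at M g p"
  shows "analytic_at M (\<lambda>q. f q + g q) p"
proof -
  obtain V \<psi> where V: "(V, \<psi>) \<in> atlas M" "p \<in> V" by (rule atlas_cover[OF M analytic_at_pts[OF f]])
  show ?thesis
    using f g unfolding analytic_at_iff_chart[OF M atlas_chart[OF M V(1)] V(2)] by (rule real_analytic_at_add)
qed

lemma analytic_at_mult: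
  assumes M: "analytic_manifold M" and f: "analytic_at M f p" and g: "analytic_at M g p"
  shows "analytic_at M (\<lambda>q. f q * g q) p"
proof -
  obtain V \<psi> where V: "(V, \<psi>) \<in> atlas M" "p \<in> V" by (rule atlas_cover[OF M analytic_at_pts[OF f]])
  show ?thesis
    using f g unfolding analytic_at_iff_chart[OF M atlas_chart[OF M V(1)] V(2)] by (rule real_analytic_at_mult)
qed

lemma analytic_at_power:
  assumes M: "analytic_manifold M" and f: "analytic_at M f p"
  shows "analytic_at M (\<lambda>q. f q ^ n) p"
proof (induction n)
  case 0 show ?case using analytic_at_const[OF M analytic_at_pts[OF f], of 1] by simp
next
  case (Suc n) show ?case using analytic_at_mult[OF M f Suc] by simp
qed

lemma analytic_at_divide:
  assumes M: "analytic_manifold M" and f: "analytic_at M f p" and g: "analytic_at M g p" "g p \<noteq> 0"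
  shows "analytic_at M (\<lambda>q. f q / g q) p"
proof -
  obtain V \<psi> where V: "(V, \<psi>) \<in> atlas M" "p \<in> V" by (rule atlas_cover[OF M analytic_at_pts[OF f]])
  note ch = atlas_chart[OF M V(1)]
  show ?thesis
    using f g unfolding analytic_at_iff_chart[OF M ch V(2)]
    by (intro real_analytic_at_divide) (simp_all add: chart_inv[OF ch V(2)])
qed

lemma analytic_at_sum:
  assumes M: "analytic_manifold M" and p: "p \<in> pts M" and S: "finite S"
    and f: "\<And>i. i \<in> S \<Longrightarrow> analytic_at M (f i) p"
  shows "analytic_at M (\<lambda>q. \<Sum>i\<in>S. f i q) p"
  using S f
proof (induction S rule: finite_induct)
  case empty then show ?case using analytic_at_const[OF M p, of 0] by simp
next
  case (insert i S)
  then have "analytic_at M (\<lambda>q. f i q + (\<Sum>i\<in>S. f i q)) p" by (intro analytic_at_add[OF M]) auto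
  then show ?case using insert.hyps by simp
qed

lemma chart_vector_analytic:
  assumes M: "analytic_manifold M" and U: "chart M U \<phi>" and p: "p \<in> U" and f: "analytic_at M f p"
  shows "analytic_at M (\<lambda>q. chart_vector M U \<phi> q (axis i 1) f) p"
  unfolding analytic_at_iff_chart[OF M U p]
proof (rule real_analytic_at_cong)
  show "real_analytic_at (\<lambda>x. frechet_derivative (\<lambda>x. f (inv_into U \<phi> x)) (at x) (axis i 1)) (\<phi> p)"
    by (rule real_analytic_at_frechet_axis) (use f analytic_at_iff_chart[OF M U p] in blast)
  have "eventually (\<lambda>x. analytic_at M f (inv_into U \<phi> x)) (nhds (\<phi> p))"
    using near_analytic_at[OF M f] near_chart[OF U p] by blast
  with eventually_chart_coord[OF U p]
  show "eventually (\<lambda>x. frechet_derivative (\<lambda>x. f (inv_into U \<phi> x)) (at x) (axis i 1)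
      = chart_vector M U \<phi> (inv_into U \<phi> x) (axis i 1) f) (nhds (\<phi> p))"
    by eventually_elim (simp add: chart_vector_def)
qed

lemma linear_axis_expand:
  fixes f :: "real^'n::finite \<Rightarrow> real"
  assumes "linear f" shows "f v = (\<Sum>k\<in>UNIV. v $ k * f (axis k 1))"
proof -
  have "f v = f (\<Sum>k\<in>UNIV. (v $ k) *\<^sub>R axis k 1)"
    using basis_expansion[of v] by (simp add: scalar_mult_eq_scaleR)
  also have "\<dots> = (\<Sum>k\<in>UNIV. v $ k * f (axis k 1))"
    using assms by (simp add: linear_sum linear_scale)
  finally show ?thesis .
qed

lemma linear_form_chart:
  assumes M: "analytic_manifold M" and U: "chart M U \<phi>" and p: "p \<in> U"
    and \<omega>: "linear_form_on (tangent_space M p) \<omega>"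
  shows "linear (\<lambda>v. \<omega> (chart_vector M U \<phi> p v))"
proof (rule linearI)
  have l: "\<omega> (chart_vector M U \<phi> p (x *\<^sub>R v + y *\<^sub>R w)) = x * \<omega> (chart_vector M U \<phi> p v) + y * \<omega> (chart_vector M U \<phi> p w)"
    for x y v w
    using \<omega> chart_vector_tangent[OF M U p] unfolding chart_vector_lincomb[OF M U p, symmetric] linear_form_on_def by blast
  show "\<omega> (chart_vector M U \<phi> p (v + w)) = \<omega> (chart_vector M U \<phi> p v) + \<omega> (chart_vector M U \<phi> p w)" for v w
    using l[of 1 v 1 w] by simp
  show "\<omega> (chart_vector M U \<phi> p (c *\<^sub>R v)) = c *\<^sub>R \<omega> (chart_vector M U \<phi> p v)" for c v
    using l[of c v 0 v] by simp
qed

lemma one_form_expand: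
  assumes M: "analytic_manifold M" and U: "chart M U \<phi>" and p: "p \<in> U"
    and \<omega>: "linear_form_on (tangent_space M p) \<omega>" and \<xi>: "\<xi> \<in> tangent_space M p"
  shows "\<omega> \<xi> = (\<Sum>k\<in>UNIV. \<xi> (\<lambda>q. \<phi> q $ k) * \<omega> (chart_vector M U \<phi> p (axis k 1)))"
proof -
  have "\<omega> \<xi> = \<omega> (chart_vector M U \<phi> p (\<chi> i. \<xi> (\<lambda>q. \<phi> q $ i)))"
    by (rule arg_cong[OF tangent_repr[OF M U p \<xi>]])
  also have "\<dots> = (\<Sum>k\<in>UNIV. (\<chi> i. \<xi> (\<lambda>q. \<phi> q $ i)) $ k * \<omega> (chart_vector M U \<phi> p (axis k 1)))"
    by (rule linear_axis_expand[OF linear_form_chart[OF M U p \<omega>]])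
  finally show ?thesis by simp
qed

text \<open>Analyticity of a form is defined by its coefficients in atlas charts; the transformation
  law, whose Jacobian entries are analytic, carries it over to an arbitrary chart.\<close>

lemma one_form_chart_analytic:
  assumes M: "analytic_manifold M" and U: "chart M U \<phi>" and p: "p \<in> U" and \<mu>: "analytic_one_form M U \<mu>"
  shows "analytic_at M (\<lambda>q. \<mu> q (chart_vector M U \<phi> q (axis i 1))) p"
proof -
  have pM: "p \<in> pts M" using chart_subset[OF U] p by blast
  obtain V \<psi> where V: "(V, \<psi>) \<in> atlas M" "p \<in> V" by (rule atlas_cover[OF M pM])
  note ch = atlas_chart[OF M V(1)]
  have an: "analytic_at M (\<lambda>q. \<mu> q (chart_vector M V \<psi> q v)) p" for v
    using \<mu> V p unfolding analytic_one_form_def by blast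
  have "analytic_at M (\<lambda>q. \<Sum>k\<in>UNIV. chart_vector M U \<phi> q (axis i 1) (\<lambda>q. \<psi> q $ k) * \<mu> q (chart_vector M V \<psi> q (axis k 1))) p"
    by (intro analytic_at_sum M pM finite analytic_at_mult chart_vector_analytic[OF M U p] an
        analytic_at_chart_coord[OF M ch V(2)])
  moreover have "near M p (\<lambda>q. (\<Sum>k\<in>UNIV. chart_vector M U \<phi> q (axis i 1) (\<lambda>q. \<psi> q $ k) * \<mu> q (chart_vector M V \<psi> q (axis k 1)))
      = \<mu> q (chart_vector M U \<phi> q (axis i 1)))"
  proof (rule near_mono[OF near_conj[OF near_openin near_openin]])
    show "openin (mtop M) U" "openin (mtop M) V" by (rule chart_openin[OF U] chart_openin[OF ch])+
    fix q assume q: "q \<in> U \<and> q \<in> V"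
    then have "linear_form_on (tangent_space M q) (\<mu> q)" using \<mu> unfolding analytic_one_form_def by blast
    from one_form_expand[OF M ch _ this chart_vector_tangent[OF M U]] q
    show "(\<Sum>k\<in>UNIV. chart_vector M U \<phi> q (axis i 1) (\<lambda>q. \<psi> q $ k) * \<mu> q (chart_vector M V \<psi> q (axis k 1)))
      = \<mu> q (chart_vector M U \<phi> q (axis i 1))" by simp
  qed (use p V in auto)
  ultimately show ?thesis by (rule analytic_at_cong[OF M])
qed

text \<open>A pointwise notion that includes continuity at \<open>p\<close>, so that composites and
  pull-backs need no bookkeeping of domains.\<close>

definition analytic_map_at :: "('a, 'n::finite) mfd \<Rightarrow> ('b, 'k::finite) mfd \<Rightarrow> ('a \<Rightarrow> 'b) \<Rightarrow> 'a \<Rightarrow> bool" where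
  "analytic_map_at M M' f p \<longleftrightarrow> p \<in> pts M \<and> f p \<in> pts M' \<and>
     (\<forall>W. openin (mtop M') W \<and> f p \<in> W \<longrightarrow> near M p (\<lambda>q. f q \<in> W)) \<and>
     (\<forall>V \<psi> i. (V, \<psi>) \<in> atlas M' \<and> f p \<in> V \<longrightarrow> analytic_at M (\<lambda>q. \<psi> (f q) $ i) p)"

lemma analytic_map_imp_at:
  assumes "analytic_map M (pts M) M' f" "p \<in> pts M" shows "analytic_map_at M M' f p"
proof -
  have c: "continuous_map (mtop M) (mtop M') f" using assms(1) by (simp add: analytic_map_def)
  have "near M p (\<lambda>q. f q \<in> W)" if "openin (mtop M') W" "f p \<in> W" for W
    unfolding near_def
    by (rule exI[of _ "{q \<in> pts M. f q \<in> W}"])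
      (use c that assms(2) openin_continuous_map_preimage in auto)
  moreover have "f p \<in> pts M'" using c assms(2) by (auto simp: continuous_map_def)
  ultimately show ?thesis using assms unfolding analytic_map_at_def analytic_map_def by blast
qed

lemma analytic_map_at_comp:
  assumes M: "analytic_manifold M" and M': "analytic_manifold M'"
    and f: "analytic_map_at M M' f p" and g: "analytic_at M' g (f p)"
  shows "analytic_at M (\<lambda>q. g (f q)) p"
proof -
  obtain V \<psi> where V: "(V, \<psi>) \<in> atlas M'" "f p \<in> V" by (rule atlas_cover[OF M' analytic_at_pts[OF g]])
  note ch = atlas_chart[OF M' V(1)]
  have "analytic_at M (\<lambda>q. g (inv_into V \<psi> (\<psi> (f q)))) p"
    by (rule analytic_at_compose[where F = "\<lambda>x. g (inv_into V \<psi> x)" and h = "\<lambda>q. \<psi> (f q)", OF M])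
      (use f g V in \<open>auto simp: analytic_map_at_def analytic_at_iff_chart[OF M' ch V(2), symmetric]\<close>)
  moreover have "near M p (\<lambda>q. f q \<in> V)"
    using f V chart_openin[OF ch] by (auto simp: analytic_map_at_def)
  then have "near M p (\<lambda>q. g (inv_into V \<psi> (\<psi> (f q))) = g (f q))"
    by (rule near_mono) (simp add: chart_inv[OF ch])
  ultimately show ?thesis by (rule analytic_at_cong[OF M])
qed

lemma analytic_map_at_trans:
  assumes M: "analytic_manifold M" and M': "analytic_manifold M'"
    and f: "analytic_map_at M M' f p" and g: "analytic_map_at M' M'' g (f p)"
  shows "analytic_map_at M M'' (g \<circ> f) p"
proof -
  have "near M p (\<lambda>q. g (f q) \<in> W)" if "openin (mtop M'') W" "g (f p) \<in> W" for W
  proof -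
    have "near M' (f p) (\<lambda>q. g q \<in> W)" using g that by (auto simp: analytic_map_at_def)
    then obtain W' where "openin (mtop M') W'" "f p \<in> W'" "\<forall>q\<in>W'. g q \<in> W" unfolding near_def by blast
    moreover from this have "near M p (\<lambda>q. f q \<in> W')" using f by (auto simp: analytic_map_at_def)
    ultimately show ?thesis by (auto elim: near_mono)
  qed
  moreover have "analytic_at M (\<lambda>q. \<psi> (g (f q)) $ i) p" if "(V, \<psi>) \<in> atlas M''" "g (f p) \<in> V" for V \<psi> i
    by (rule analytic_map_at_comp[OF M M' f]) (use g that in \<open>auto simp: analytic_map_at_def\<close>)
  ultimately show ?thesis using f g by (auto simp: analytic_map_at_def)
qed

section \<open>Push-forwards of tangent vectors and pull-backs of metrics\<close>

lemma pushforward_chart: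
  assumes M: "analytic_manifold M" and M': "analytic_manifold M'"
    and f: "analytic_map_at M M' f p" and \<xi>: "\<xi> \<in> tangent_space M p" and V: "(V, \<psi>) \<in> atlas M'" "f p \<in> V"
  shows "pushforward M' f p \<xi> = chart_vector M' V \<psi> (f p) (\<chi> k. \<xi> (\<lambda>q. \<psi> (f q) $ k))"
proof
  fix g
  note ch = atlas_chart[OF M' V(1)]
  show "pushforward M' f p \<xi> g = chart_vector M' V \<psi> (f p) (\<chi> k. \<xi> (\<lambda>q. \<psi> (f q) $ k)) g"
  proof (cases "analytic_at M' g (f p)")
    case True
    have "near M p (\<lambda>q. f q \<in> V)"
      using f V chart_openin[OF ch] by (auto simp: analytic_map_at_def)
    then have "near M p (\<lambda>q. g (f q) = g (inv_into V \<psi> (\<psi> (f q))))"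
      by (rule near_mono) (simp add: chart_inv[OF ch])
    from tangent_cong[OF M \<xi> this]
    have "\<xi> (\<lambda>q. g (f q)) = \<xi> (\<lambda>q. g (inv_into V \<psi> (\<psi> (f q))))" .
    also have "\<dots> = frechet_derivative (\<lambda>x. g (inv_into V \<psi> x)) (at (\<psi> (f p))) (\<chi> k. \<xi> (\<lambda>q. \<psi> (f q) $ k))"
      by (rule tangent_chain[OF M \<xi>, where F = "\<lambda>x. g (inv_into V \<psi> x)" and h = "\<lambda>q. \<psi> (f q)"])
        (use f True V in \<open>auto simp: analytic_map_at_def analytic_at_iff_chart[OF M' ch V(2), symmetric]\<close>)
    finally show ?thesis using True by (simp add: pushforward_def chart_vector_def)
  qed (simp add: pushforward_def chart_vector_def)
qed

lemma pushforward_tangent: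
  assumes M: "analytic_manifold M" and M': "analytic_manifold M'"
    and f: "analytic_map_at M M' f p" and \<xi>: "\<xi> \<in> tangent_space M p"
  shows "pushforward M' f p \<xi> \<in> tangent_space M' (f p)"
proof -
  have "f p \<in> pts M'" using f by (simp add: analytic_map_at_def)
  then obtain V \<psi> where V: "(V, \<psi>) \<in> atlas M'" "f p \<in> V" by (rule atlas_cover[OF M'])
  show ?thesis unfolding pushforward_chart[OF M M' f \<xi> V]
    by (rule chart_vector_tangent[OF M' atlas_chart[OF M' V(1)] V(2)])
qed

lemma pushforward_lincomb:
  "pushforward M' f p (lincomb x \<xi> y \<eta>) = lincomb x (pushforward M' f p \<xi>) y (pushforward M' f p \<eta>)"
  by (auto simp: pushforward_def lincomb_def)

lemma riemannian_form:
  assumes "riemannian_metric M g" "p \<in> pts M" "\<xi> \<in> tangent_space M p"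
  shows "linear_form_on (tangent_space M p) (g p \<xi>)" "\<And>\<eta>. \<eta> \<in> tangent_space M p \<Longrightarrow> g p \<xi> \<eta> = g p \<eta> \<xi>"
  using assms unfolding riemannian_metric_def by blast+

lemma metric_expand:
  assumes M: "analytic_manifold M" and g: "riemannian_metric M g" and U: "chart M U \<phi>" and p: "p \<in> U"
  shows "g p (chart_vector M U \<phi> p v) (chart_vector M U \<phi> p w)
    = (\<Sum>k\<in>UNIV. \<Sum>l\<in>UNIV. v $ k * (w $ l * g p (chart_vector M U \<phi> p (axis k 1)) (chart_vector M U \<phi> p (axis l 1))))"
proof -
  have pM: "p \<in> pts M" using chart_subset[OF U] p by blast
  note T = chart_vector_tangent[OF M U p]
  let ?c = "chart_vector M U \<phi> p"
  have lin: "linear (\<lambda>w. g p (?c v) (?c w))" for v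
    by (rule linear_form_chart[OF M U p riemannian_form(1)[OF g pM T]])
  have "g p (?c v) (?c w) = g p (?c w) (?c v)" for v w by (rule riemannian_form(2)[OF g pM T T])
  then have lin': "linear (\<lambda>v. g p (?c v) (?c w))" for w using lin[of w] by simp
  have "g p (?c v) (?c w) = (\<Sum>k\<in>UNIV. v $ k * g p (?c (axis k 1)) (?c w))"
    by (rule linear_axis_expand[OF lin'])
  also have "\<dots> = (\<Sum>k\<in>UNIV. v $ k * (\<Sum>l\<in>UNIV. w $ l * g p (?c (axis k 1)) (?c (axis l 1))))"
    by (intro sum.cong refl arg_cong2[where f = "(*)"] linear_axis_expand[OF lin])
  finally show ?thesis by (simp add: sum_distrib_left)
qed

text \<open>In a target chart the coefficients are polynomial in the Jacobian entries
  \<open>J\<close> and the metric coefficients \<open>G\<close>. They are thus analytic even where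
  the differential of \<open>f\<close> drops rank, in particular on the exceptional divisor.\<close>

lemma pullback_metric_analytic:
  assumes M: "analytic_manifold M" and M': "analytic_manifold M'" and g: "riemannian_metric M' g"
    and U: "chart M U \<phi>" and p: "p \<in> U" and f: "\<And>q. q \<in> U \<Longrightarrow> analytic_map_at M M' f q"
  shows "analytic_at M (\<lambda>q. pullback_metric M' g f q (chart_vector M U \<phi> q (axis i 1)) (chart_vector M U \<phi> q (axis j 1))) p"
proof -
  have pM: "p \<in> pts M" using chart_subset[OF U] p by blast
  have "f p \<in> pts M'" using f[OF p] by (simp add: analytic_map_at_def)
  then obtain V \<psi> where V: "(V, \<psi>) \<in> atlas M'" "f p \<in> V" by (rule atlas_cover[OF M'])
  note ch = atlas_chart[OF M' V(1)]
  define J where "J = (\<lambda>i k q. chart_vector M U \<phi> q (axis i 1) (\<lambda>q. \<psi> (f q) $ k))"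
  define G where "G = (\<lambda>k l m. g m (chart_vector M' V \<psi> m (axis k 1)) (chart_vector M' V \<psi> m (axis l 1)))"
  have J: "analytic_at M (J i k) p" for i k
    unfolding J_def by (rule chart_vector_analytic[OF M U p]) (use f[OF p] V in \<open>auto simp: analytic_map_at_def\<close>)
  have "analytic_at M' (G k l) (f p)" for k l
    using g V unfolding riemannian_metric_def G_def by blast
  then have G: "analytic_at M (\<lambda>q. G k l (f q)) p" for k l by (rule analytic_map_at_comp[OF M M' f[OF p]])
  have "analytic_at M (\<lambda>q. \<Sum>k\<in>UNIV. \<Sum>l\<in>UNIV. J i k q * (J j l q * G k l (f q))) p"
    by (intro analytic_at_sum M pM finite analytic_at_mult J G)
  moreover have "near M p (\<lambda>q. f q \<in> V)"
    using f[OF p] V chart_openin[OF ch] by (auto simp: analytic_map_at_def)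
  then have "near M p (\<lambda>q. f q \<in> V \<and> q \<in> U)"
    by (rule near_conj[OF _ near_openin[OF chart_openin[OF U] p]])
  then have "near M p (\<lambda>q. (\<Sum>k\<in>UNIV. \<Sum>l\<in>UNIV. J i k q * (J j l q * G k l (f q)))
      = pullback_metric M' g f q (chart_vector M U \<phi> q (axis i 1)) (chart_vector M U \<phi> q (axis j 1)))"
  proof (rule near_mono)
    fix q assume q: "f q \<in> V \<and> q \<in> U"
    have T: "chart_vector M U \<phi> q v \<in> tangent_space M q" for v by (rule chart_vector_tangent[OF M U]) (use q in blast)
    show "(\<Sum>k\<in>UNIV. \<Sum>l\<in>UNIV. J i k q * (J j l q * G k l (f q)))
      = pullback_metric M' g f q (chart_vector M U \<phi> q (axis i 1)) (chart_vector M U \<phi> q (axis j 1))"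
      unfolding pullback_metric_def pushforward_chart[OF M M' f[OF conjunct2[OF q]] T V(1) conjunct1[OF q]]
      by (subst metric_expand[OF M' g ch conjunct1[OF q]]) (simp add: J_def G_def)
  qed
  ultimately show ?thesis by (rule analytic_at_cong[OF M])
qed

lemma pullback_metric_expand:
  fixes M :: "('a, 2) mfd"
  assumes M: "analytic_manifold M" and M': "analytic_manifold M'" and g: "riemannian_metric M' g"
    and U: "chart M U \<phi>" and p: "p \<in> U" and f: "analytic_map_at M M' f p"
    and \<xi>: "\<xi> \<in> tangent_space M p" and \<eta>: "\<eta> \<in> tangent_space M p"
  shows "pullback_metric M' g f p \<xi> \<eta> = (\<Sum>k\<in>UNIV. \<Sum>l\<in>UNIV. \<xi> (\<lambda>q. \<phi> q $ k) * (\<eta> (\<lambda>q. \<phi> q $ l) *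
     pullback_metric M' g f p (chart_vector M U \<phi> p (axis k 1)) (chart_vector M U \<phi> p (axis l 1))))"
proof -
  have fM: "f p \<in> pts M'" using f by (simp add: analytic_map_at_def)
  note P = pushforward_tangent[OF M M' f]
  have L: "linear_form_on (tangent_space M p) (pullback_metric M' g f p \<xi>)" if "\<xi> \<in> tangent_space M p" for \<xi>
    unfolding linear_form_on_def
  proof (intro ballI allI)
    fix \<eta> \<zeta> x y assume "\<eta> \<in> tangent_space M p" "\<zeta> \<in> tangent_space M p"
    with riemannian_form(1)[OF g fM P[OF that]] P
    show "pullback_metric M' g f p \<xi> (lincomb x \<eta> y \<zeta>) = x * pullback_metric M' g f p \<xi> \<eta> + y * pullback_metric M' g f p \<xi> \<zeta>"
      unfolding pullback_metric_def pushforward_lincomb linear_form_on_def by blast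
  qed
  have sym: "pullback_metric M' g f p \<xi> \<eta> = pullback_metric M' g f p \<eta> \<xi>"
    if "\<xi> \<in> tangent_space M p" "\<eta> \<in> tangent_space M p" for \<xi> \<eta>
    unfolding pullback_metric_def by (rule riemannian_form(2)[OF g fM]) (intro P that)+
  note T = chart_vector_tangent[OF M U p]
  note E = one_form_expand[OF M U p L]
  have "pullback_metric M' g f p \<xi> \<eta> = pullback_metric M' g f p \<eta> \<xi>" by (rule sym[OF \<xi> \<eta>])
  also have "\<dots> = (\<Sum>k\<in>UNIV. \<xi> (\<lambda>q. \<phi> q $ k) * pullback_metric M' g f p \<eta> (chart_vector M U \<phi> p (axis k 1)))"
    by (rule E[OF \<eta> \<xi>])
  also have "\<dots> = (\<Sum>k\<in>UNIV. \<xi> (\<lambda>q. \<phi> q $ k) * (\<Sum>l\<in>UNIV. \<eta> (\<lambda>q. \<phi> q $ l) *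
     pullback_metric M' g f p (chart_vector M U \<phi> p (axis k 1)) (chart_vector M U \<phi> p (axis l 1))))"
    by (intro sum.cong refl arg_cong2[where f = "(*)"] trans[OF sym[OF \<eta> T] E[OF T \<eta>]])
  finally show ?thesis by (simp add: sum_distrib_left)
qed

text \<open>The limit of a sequence of blowings-up is related to its divisors only over relatively
  compact open sets. The preimage of a closed ball under a chart is compact, and it is closed
  because the manifold is Hausdorff.\<close>

lemma relatively_compact_neighbourhood:
  assumes M: "analytic_manifold M" and p: "p \<in> pts M"
  obtains V where "openin (mtop M) V" "p \<in> V" "compactin (mtop M) (mtop M closure_of V)"
proof -
  obtain U \<phi> where U: "(U, \<phi>) \<in> atlas M" "p \<in> U" by (rule atlas_cover[OF M p])
  note ch = atlas_chart[OF M U(1)]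
  obtain e where e: "e > 0" "cball (\<phi> p) e \<subseteq> \<phi> ` U"
    using chart_open_image[OF ch] U(2) by (meson imageI open_contains_cball)
  define K where "K = {q\<in>U. \<phi> q \<in> cball (\<phi> p) e}"
  have K: "\<phi> ` K = cball (\<phi> p) e" using e(2) by (auto simp: K_def)
  have "compactin (top_of_set (\<phi> ` U)) (\<phi> ` K)"
    unfolding K compactin_subtopology using e(2) by simp
  then have "compactin (subtopology (mtop M) U) K"
    using homeomorphic_map_compactness[OF chart_homeo[OF ch], of K] chart_topspace[OF ch] by (auto simp: K_def)
  then have cK: "compactin (mtop M) K" by (simp add: compactin_subtopology)
  have clK: "closedin (mtop M) K"
    by (rule compactin_imp_closedin[OF _ cK]) (use M in \<open>simp add: analytic_manifold_def\<close>)
  define V where "V = {q\<in>U. \<phi> q \<in> ball (\<phi> p) e}"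
  have "mtop M closure_of V \<subseteq> K" by (rule closure_of_minimal[OF _ clK]) (auto simp: V_def K_def)
  then have "compactin (mtop M) (mtop M closure_of V)" by (rule closed_compactin[OF cK]) simp
  moreover have "openin (mtop M) V" unfolding V_def by (rule chart_vimage_open[OF ch]) simp
  ultimately show ?thesis using that[of V] U(2) e(1) by (auto simp: V_def)
qed

text \<open>If \<open>b q\<close> were in \<open>E\<^sub>1\<close>, every \<open>\<tau> j q\<close>
  would lie in the total divisor \<open>D j\<close>, as \<open>D (Suc j)\<close> contains the
  preimage of \<open>D j\<close>; but for large \<open>j\<close> this means
  \<open>q \<in> E\<close>. The consequence of interest is that off \<open>E\<close> the fibre of
  the Gauss extension at \<open>b q\<close> is the true tangent plane.\<close>

lemma point_blowings_up_exceptional: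
  assumes b: "point_blowings_up S\<^sub>1 E\<^sub>1 S E b" and M: "analytic_manifold S\<^sub>1"
    and q: "q \<in> pts S" "q \<notin> E"
  shows "b q \<in> pts S\<^sub>1 - E\<^sub>1"
proof -
  obtain M X D C \<beta> \<tau> where B: "blowup_sequence M X D C \<beta>" "blowup_limit M X D C \<beta> S E \<tau>"
    "M 0 = S\<^sub>1" "D 0 = E\<^sub>1" "\<tau> 0 = b"
    using b unfolding point_blowings_up_def by blast
  note L = B(2)[unfolded blowup_limit_def B(3), THEN conjunct2]
  have map: "analytic_map S (pts S) (M j) (\<tau> j)" and \<tau>: "\<beta> j (\<tau> (Suc j) q) = \<tau> j q" for j
    using L[THEN conjunct1, rule_format, of j] q(1) by simp_all
  have pt: "\<tau> j q \<in> pts (M j)" for j using analytic_map_imp_at[OF map q(1)] by (simp add: analytic_map_at_def)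
  have bq: "b q \<in> pts S\<^sub>1" using pt[of 0] B by simp
  moreover have "b q \<notin> E\<^sub>1"
  proof
    assume "b q \<in> E\<^sub>1"
    have D: "\<tau> j q \<in> D j" for j
    proof (induction j)
      case 0 then show ?case using \<open>b q \<in> E\<^sub>1\<close> B by simp
    next
      case (Suc j)
      have "D (Suc j) = {q\<in>pts (M (Suc j)). \<beta> j q \<in> D j \<union> C j}"
        using B(1)[unfolded blowup_sequence_def, rule_format, of j] by simp
      then show ?case using pt \<tau> Suc by simp
    qed
    obtain V where V: "openin (mtop S\<^sub>1) V" "b q \<in> V" "compactin (mtop S\<^sub>1) (mtop S\<^sub>1 closure_of V)"
      by (rule relatively_compact_neighbourhood[OF M bq])
    then obtain n where "\<forall>j\<ge>n. \<forall>p\<in>pts S. \<tau> 0 p \<in> V \<longrightarrow> (p \<in> E \<longleftrightarrow> \<tau> j p \<in> D j)"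
      using L[THEN conjunct2, rule_format, of V] by auto
    then show False using D[of n] V(2) q B(5) by auto
  qed
  ultimately show ?thesis by blast
qed

lemma tangent_zero:
  assumes "\<xi> \<in> tangent_space M p" shows "\<xi> (\<lambda>_. 0) = 0"
proof -
  obtain V \<psi> v where V: "\<xi> = chart_vector M V \<psi> p v" using assms unfolding tangent_space_def by blast
  have "((\<lambda>x. 0::real) has_derivative (\<lambda>_. 0)) (at (\<psi> p))" by simp
  from frechet_derivative_at[OF this] show ?thesis unfolding V chart_vector_def by (metis (no_types))
qed

text \<open>A function vanishing on \<open>X\<close> near the image point pulls back to a function
  that is locally zero, and every tangent vector annihilates it.\<close>

lemma pushforward_tangent_to:
  assumes M: "analytic_manifold M" and M': "analytic_manifold M'"
    and f: "analytic_map_at M M' f p" and X: "f ` pts M \<subseteq> X" and \<xi>: "\<xi> \<in> tangent_space M p"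
  shows "pushforward M' f p \<xi> \<in> tangent_to M' X (f p)"
  unfolding tangent_to_def mem_Collect_eq
proof (intro conjI allI impI)
  show "pushforward M' f p \<xi> \<in> tangent_space M' (f p)" by (rule pushforward_tangent[OF M M' f \<xi>])
  fix h assume h: "analytic_at M' h (f p) \<and> near M' (f p) (\<lambda>q. q \<in> X \<longrightarrow> h q = 0)"
  then obtain W where W: "openin (mtop M') W" "f p \<in> W" "\<forall>q\<in>W. q \<in> X \<longrightarrow> h q = 0" unfolding near_def by blast
  have "near M p (\<lambda>q. f q \<in> W)" using f W by (auto simp: analytic_map_at_def)
  moreover have "near M p (\<lambda>q. q \<in> pts M)" by (rule near_openin) (use f in \<open>auto simp: analytic_map_at_def\<close>)
  ultimately have "near M p (\<lambda>q. f q \<in> W \<and> q \<in> pts M)" by (rule near_conj)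
  then have "near M p (\<lambda>q. h (f q) = 0)" by (rule near_mono) (use W X in auto)
  from tangent_cong[OF M \<xi> this] show "pushforward M' f p \<xi> h = 0"
    using tangent_zero[OF \<xi>] by (simp add: pushforward_def)
qed

section \<open>Orthogonal coordinates\<close>

text \<open>\<Theta> and \<Omega> are mutually inverse only between \<open>D\<close> and
  \<open>D'\<close>, so the domain is cut down to the preimage of \<open>D\<close>; there the new
  inverse chart is the old one after \<Omega>.\<close>

lemma chart_compose:
  fixes M :: "('a, 'n::finite) mfd"
  assumes M: "analytic_manifold M" and U: "chart M U \<phi>"
    and D: "open D" "D \<subseteq> \<phi> ` U" and D': "open D'"
    and TO: "\<And>x. x \<in> D \<Longrightarrow> \<Theta> x \<in> D' \<and> \<Omega> (\<Theta> x) = x" "\<And>y. y \<in> D' \<Longrightarrow> \<Omega> y \<in> D \<and> \<Theta> (\<Omega> y) = y"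
    and ra: "\<And>x l. x \<in> D \<Longrightarrow> real_analytic_at (\<lambda>x. \<Theta> x $ l) x" "\<And>y l. y \<in> D' \<Longrightarrow> real_analytic_at (\<lambda>y. \<Omega> y $ l) y"
  shows "chart M {q\<in>U. \<phi> q \<in> D} (\<lambda>q. \<Theta> (\<phi> q))"
proof -
  let ?U = "{q\<in>U. \<phi> q \<in> D}" and ?\<phi> = "\<lambda>q. \<Theta> (\<phi> q)"
  have op: "openin (mtop M) ?U" by (rule chart_vimage_open[OF U D(1)])
  have im: "\<phi> ` ?U = D" using D(2) by auto
  have imT: "\<Theta> ` D = D'" using TO by (auto simp: image_iff) metis
  have "?\<phi> ` ?U = \<Theta> ` (\<phi> ` ?U)" by (simp only: image_image)
  then have im': "?\<phi> ` ?U = D'" by (simp only: im imT)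
  have h1: "homeomorphic_map (subtopology (mtop M) ?U) (top_of_set D) \<phi>"
  proof -
    have e: "U \<inter> ?U = ?U" "\<phi> ` U \<inter> D = D" using D(2) by auto
    have "homeomorphic_map (subtopology (subtopology (mtop M) U) ?U) (subtopology (top_of_set (\<phi> ` U)) D) \<phi>"
      by (rule homeomorphic_map_subtopologies[OF chart_homeo[OF U]])
        (simp only: chart_topspace[OF U] topspace_euclidean_subtopology e im)
    moreover note e
    ultimately show ?thesis by (simp add: subtopology_subtopology)
  qed
  have "continuous_on D \<Theta>" "continuous_on D' \<Omega>"
    by (intro continuous_at_imp_continuous_on ballI real_analytic_at_vec_isCont ra; assumption)+
  then have "homeomorphic_maps (top_of_set D) (top_of_set D') \<Theta> \<Omega>"
    unfolding homeomorphic_maps_def using TO by auto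
  then have h2: "homeomorphic_map (top_of_set D) (top_of_set D') \<Theta>" using homeomorphic_map_maps by blast
  have hom: "homeomorphic_map (subtopology (mtop M) ?U) (top_of_set D') ?\<phi>"
    using homeomorphic_map_compose[OF h1 h2] by (simp add: o_def)
  have inj: "inj_on ?\<phi> ?U"
    by (rule inj_onI) (metis (mono_tags, lifting) TO(1) chart_inv[OF U] mem_Collect_eq)
  have inv: "inv_into ?U ?\<phi> y = inv_into U \<phi> (\<Omega> y)" if "y \<in> D'" for y
  proof -
    have y: "\<Omega> y \<in> D" "\<Theta> (\<Omega> y) = y" using TO(2)[OF that] by auto
    then obtain q where q: "q \<in> U" "\<phi> q = \<Omega> y" using D(2) by (metis image_iff subsetD)
    have "inv_into ?U ?\<phi> (?\<phi> q) = q" by (rule inv_into_f_f[OF inj]) (use q y in auto)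
    moreover have "?\<phi> q = y" using q y by simp
    moreover have "inv_into U \<phi> (\<Omega> y) = q" using chart_inv[OF U q(1)] q(2) by simp
    ultimately show ?thesis by simp
  qed
  show ?thesis unfolding chart_def im'
  proof (intro conjI op D' hom ballI)
    fix z assume z: "z \<in> atlas M"
    obtain V \<psi> where V: "z = (V, \<psi>)" by (cases z)
    have "real_analytic_at (\<lambda>x. \<Theta> (\<phi> (inv_into V \<psi> x)) $ i) (\<psi> p) \<and>
      real_analytic_at (\<lambda>x. \<psi> (inv_into ?U ?\<phi> x) $ i) (\<Theta> (\<phi> p))"
      if p: "p \<in> U" "\<phi> p \<in> D" "p \<in> V" for p i
    proof
      have VA: "(V, \<psi>) \<in> atlas M" using z V by simp
      note tr = chart_transition[OF U VA p(1,3)]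
      have pV: "inv_into V \<psi> (\<psi> p) = p" by (rule chart_inv[OF atlas_chart[OF M VA] p(3)])
      show "real_analytic_at (\<lambda>x. \<Theta> (\<phi> (inv_into V \<psi> x)) $ i) (\<psi> p)"
        by (rule real_analytic_at_compose[where F = "\<lambda>x. \<Theta> x $ i" and h = "\<lambda>x. \<phi> (inv_into V \<psi> x)"])
          (use ra(1)[OF p(2)] tr(1) in \<open>simp_all add: pV\<close>)
      have T: "\<Theta> (\<phi> p) \<in> D'" "\<Omega> (\<Theta> (\<phi> p)) = \<phi> p" using TO(1)[OF p(2)] by auto
      have "real_analytic_at (\<lambda>y. \<psi> (inv_into U \<phi> (\<Omega> y)) $ i) (\<Theta> (\<phi> p))"
        by (rule real_analytic_at_compose[where F = "\<lambda>x. \<psi> (inv_into U \<phi> x) $ i" and h = \<Omega>])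
          (use ra(2)[OF T(1)] tr(2) T(2) in simp_all)
      moreover have "eventually (\<lambda>y. y \<in> D') (nhds (\<Theta> (\<phi> p)))" using D' T(1) eventually_nhds by blast
      then have "eventually (\<lambda>y. \<psi> (inv_into U \<phi> (\<Omega> y)) $ i = \<psi> (inv_into ?U ?\<phi> y) $ i) (nhds (\<Theta> (\<phi> p)))"
        by eventually_elim (simp add: inv)
      ultimately show "real_analytic_at (\<lambda>x. \<psi> (inv_into ?U ?\<phi> x) $ i) (\<Theta> (\<phi> p))" by (rule real_analytic_at_cong)
    qed
    then show "case z of (V, \<psi>) \<Rightarrow> \<forall>p\<in>?U \<inter> V. \<forall>i.
        real_analytic_at (\<lambda>x. \<Theta> (\<phi> (inv_into V \<psi> x)) $ i) (\<psi> p) \<and>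
        real_analytic_at (\<lambda>x. \<psi> (inv_into ?U ?\<phi> x) $ i) (\<Theta> (\<phi> p))"
      by (auto simp: V)
  qed
qed

lemma chart_restrict:
  assumes M: "analytic_manifold M" and U: "chart M U \<phi>" and W: "openin (mtop M) W"
  shows "chart M (W \<inter> U) \<phi>"
proof -
  have "chart M {q\<in>U. \<phi> q \<in> \<phi> ` (W \<inter> U)} (\<lambda>q. (\<lambda>x. x) (\<phi> q))"
    by (rule chart_compose[where \<Theta> = "\<lambda>x. x" and \<Omega> = "\<lambda>x. x",
          OF M U chart_image_open[OF U W] _ chart_image_open[OF U W] _ _ real_analytic_at_coord real_analytic_at_coord])
      blast+
  moreover have "{q\<in>U. \<phi> q \<in> \<phi> ` (W \<inter> U)} = W \<inter> U"
    using inj_on_image_mem_iff[OF chart_inj[OF U], of _ "W \<inter> U"] by auto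
  ultimately show ?thesis by simp
qed

lemma near_ex_chart:
  assumes M: "analytic_manifold M" and U: "chart_at M p U \<phi>" and n: "near M p P"
  obtains U' where "chart_at M p U' \<phi>" "U' \<subseteq> U" "\<And>q. q \<in> U' \<Longrightarrow> P q"
proof -
  obtain W where W: "openin (mtop M) W" "p \<in> W" "\<forall>q\<in>W. P q" using n unfolding near_def by blast
  show ?thesis
    by (rule that[of "W \<inter> U"])
      (use W U chart_restrict[OF M _ W(1)] in \<open>auto simp: chart_at_def\<close>)
qed

lemma analytic_at_positive_near:
  assumes M: "analytic_manifold M" and f: "analytic_at M f p" "f p > 0"
  shows "near M p (\<lambda>q. f q > 0)"
proof -
  obtain V \<psi> where V: "(V, \<psi>) \<in> atlas M" "p \<in> V" by (rule atlas_cover[OF M analytic_at_pts[OF f(1)]])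
  note ch = atlas_chart[OF M V(1)]
  have "isCont (\<lambda>x. f (inv_into V \<psi> x)) (\<psi> p)"
    using f(1) real_analytic_at_imp_isCont unfolding analytic_at_iff_chart[OF M ch V(2)] by blast
  from isCont_imp_filterlim_nhds[OF this] have "filterlim (\<lambda>x. f (inv_into V \<psi> x)) (nhds (f p)) (nhds (\<psi> p))"
    by (simp add: chart_inv[OF ch V(2)])
  then show ?thesis unfolding near_chart[OF ch V(2)] using f(2) by (rule order_tendstoD)
qed

text \<open>For a function vanishing on \<open>y $ i = 0\<close>, the quotient by
  \<open>y $ i\<close> takes at the origin the value of the partial derivative in direction
  \<open>i\<close>, as seen along the \<open>i\<close>-th axis.\<close>

lemma divisible_unit:
  fixes f :: "real^'n::finite \<Rightarrow> real"
  assumes f: "real_analytic_at f 0" and z: "eventually (\<lambda>y. y $ i = 0 \<longrightarrow> f y = 0) (nhds 0)"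
    and d: "frechet_derivative f (at 0) (axis i 1) \<noteq> 0"
  obtains g where "real_analytic_at g 0" "g 0 \<noteq> 0" "eventually (\<lambda>y. f y = y $ i * g y) (nhds 0)"
proof -
  obtain g where g: "real_analytic_at g 0" "eventually (\<lambda>y. f y = y $ i * g y) (nhds 0)"
    by (rule real_analytic_at_divisible[OF f z])
  have e0: "vec_upd (0::real^'n) i 0 = 0" by (simp add: vec_eq_iff)
  have c: "isCont (\<lambda>s. vec_upd (0::real^'n) i s) 0" by (rule has_derivative_continuous[OF vec_upd_has_derivative])
  have lim: "filterlim (\<lambda>s. vec_upd (0::real^'n) i s) (nhds 0) (nhds 0)"
    by (rule isCont_imp_filterlim_nhds[where f = "\<lambda>s. vec_upd (0::real^'n) i s", OF c e0])
  have gc: "isCont g (vec_upd 0 i 0)" unfolding e0 by (rule real_analytic_at_imp_isCont[OF g(1)])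
  have "isCont (\<lambda>s. g (vec_upd 0 i s)) 0" by (rule continuous_within_compose3[OF gc c])
  then have "(\<lambda>s. g (vec_upd 0 i s)) \<midarrow>0\<rightarrow> g 0" by (simp add: isCont_def e0)
  moreover have "eventually (\<lambda>s. f (vec_upd 0 i s) = s * g (vec_upd 0 i s)) (nhds 0)"
    using eventually_compose_filterlim[OF g(2) lim] by simp
  then have "eventually (\<lambda>s. g (vec_upd 0 i s) = (f (vec_upd 0 i (0 + s)) - f (vec_upd 0 i 0)) / s) (at 0)"
    using eventually_nhds_x_imp_x by (fastforce simp: eventually_at_filter elim: eventually_mono)
  ultimately have "(\<lambda>s. (f (vec_upd 0 i (0 + s)) - f (vec_upd 0 i 0)) / s) \<midarrow>0\<rightarrow> g 0"
    by (rule Lim_transform_eventually)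
  then have "((\<lambda>s. f (vec_upd 0 i s)) has_real_derivative g 0) (at (0 $ i))" by (simp add: DERIV_def)
  from frechet_derivative_axis_unique[OF f this] d have "g 0 \<noteq> 0" by simp
  with g that show ?thesis by blast
qed

text \<open>Completing the square with pivot \<open>P\<close> replaces the differential of
  \<open>\<phi> $ i\<close> by itself plus \<open>F / P\<close> times that of
  \<open>\<phi> $ k\<close>. This form is \<open>f\<close> times an exact one when the new
  coordinate is a first integral of the field with components \<open>- F / P\<close> in direction
  \<open>i\<close> and 1 in direction \<open>k\<close>. The indices are left open because the two
  cases of the theorem exchange them; \<open>Q\<close> is a mere number since the coordinates do not
  depend on it. The last conclusion says that the hypersurface \<open>\<phi> $ i = 0\<close> keeps
  its equation up to the unit \<open>g\<close> when \<open>F\<close> vanishes on it.\<close>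

lemma diagonalise:
  fixes M :: "('a, 2) mfd" and i k :: 2
  assumes M: "analytic_manifold M" and U: "chart_at M a U \<phi>" and ik: "i \<noteq> k"
    and an: "\<And>q. q \<in> U \<Longrightarrow> analytic_at M P q" "\<And>q. q \<in> U \<Longrightarrow> analytic_at M F q"
    and Pa: "P a > 0"
  obtains U' \<phi>' f g where "chart_at M a U' \<phi>'" "U' \<subseteq> U"
    "\<And>q. q \<in> U' \<Longrightarrow> P q > 0 \<and> analytic_at M f q \<and> f q \<noteq> 0 \<and> \<phi>' q $ k = \<phi> q $ k"
    "\<And>q Q \<xi> \<eta>. q \<in> U' \<Longrightarrow> \<xi> \<in> tangent_space M q \<Longrightarrow> \<eta> \<in> tangent_space M q \<Longrightarrow>
       P q * (\<xi> (\<lambda>x. \<phi> x $ i) * \<eta> (\<lambda>x. \<phi> x $ i))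
       + F q * (\<xi> (\<lambda>x. \<phi> x $ i) * \<eta> (\<lambda>x. \<phi> x $ k) + \<xi> (\<lambda>x. \<phi> x $ k) * \<eta> (\<lambda>x. \<phi> x $ i))
       + Q * (\<xi> (\<lambda>x. \<phi> x $ k) * \<eta> (\<lambda>x. \<phi> x $ k))
       = P q * (f q)\<^sup>2 * (\<xi> (\<lambda>x. \<phi>' x $ i) * \<eta> (\<lambda>x. \<phi>' x $ i))
       + (Q - (F q)\<^sup>2 / P q) * (\<xi> (\<lambda>x. \<phi>' x $ k) * \<eta> (\<lambda>x. \<phi>' x $ k))"
    "\<And>q. near M a (\<lambda>q. \<phi> q $ i = 0 \<longrightarrow> F q = 0) \<Longrightarrow> q \<in> U' \<Longrightarrow>
       analytic_at M g q \<and> g q \<noteq> 0 \<and> \<phi> q $ i = \<phi>' q $ i * g q"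
proof -
  have ch: "chart M U \<phi>" and aU: "a \<in> U" and a0: "\<phi> a = 0" using U by (auto simp: chart_at_def)
  have nP: "near M a (\<lambda>q. P q > 0)" by (rule analytic_at_positive_near[OF M an(1)[OF aU] Pa])
  then obtain W where W: "openin (mtop M) W" "a \<in> W" "\<forall>q\<in>W. P q > 0" unfolding near_def by blast
  define B where "B = \<phi> ` (W \<inter> U)"
  have B: "open B" "0 \<in> B" using chart_image_open[OF ch W(1)] W(2) aU a0 by (auto simp: B_def image_iff)
  define w where "w = (\<lambda>x. - F (inv_into U \<phi> x) / P (inv_into U \<phi> x))"
  have raw: "real_analytic_at w 0"
    unfolding w_def
    using an(1,2)[OF aU] Pa chart_inv[OF ch aU] unfolding analytic_at_iff_chart[OF M ch aU] a0
    by (intro real_analytic_at_divide real_analytic_at_uminus) auto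
  obtain D D' \<Theta> \<Omega> where S: "open D" "0 \<in> D" "D \<subseteq> B" "open D'" "\<Theta> 0 = 0"
    "\<And>x. x \<in> D \<Longrightarrow> \<Theta> x \<in> D' \<and> \<Omega> (\<Theta> x) = x" "\<And>y. y \<in> D' \<Longrightarrow> \<Omega> y \<in> D \<and> \<Theta> (\<Omega> y) = y"
    "\<And>x l. x \<in> D \<Longrightarrow> real_analytic_at (\<lambda>x. \<Theta> x $ l) x" "\<And>y l. y \<in> D' \<Longrightarrow> real_analytic_at (\<lambda>y. \<Omega> y $ l) y"
    "\<And>x l. l \<noteq> i \<Longrightarrow> \<Theta> x $ l = x $ l" "\<And>y l. l \<noteq> i \<Longrightarrow> \<Omega> y $ l = y $ l"
    "\<And>y. y \<in> D' \<Longrightarrow> frechet_derivative (\<lambda>y. \<Omega> y $ i) (at y) (axis k 1) = w (\<Omega> y)"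
    "\<And>y. y \<in> D' \<Longrightarrow> frechet_derivative (\<lambda>y. \<Omega> y $ i) (at y) (axis i 1) \<noteq> 0"
    "\<And>y. eventually (\<lambda>x. x $ i = 0 \<longrightarrow> w x = 0) (nhds 0) \<Longrightarrow> y \<in> D' \<Longrightarrow> y $ i = 0 \<Longrightarrow> \<Omega> y $ i = 0"
    by (rule straightening[OF ik raw B]) (rule that; assumption)
  define V where "V = {q\<in>U. \<phi> q \<in> D}"
  define \<phi>' where "\<phi>' = (\<lambda>q. \<Theta> (\<phi> q))"
  have DU: "D \<subseteq> \<phi> ` U" using S(3) by (auto simp: B_def)
  have ch': "chart M V \<phi>'" unfolding V_def \<phi>'_def by (rule chart_compose[OF M ch S(1) DU S(4,6,7,8,9)])
  have aV: "a \<in> V" using aU a0 S(2) by (simp add: V_def)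
  have a0': "\<phi>' a = 0" by (simp add: \<phi>'_def a0 S(5))
  have VW: "q \<in> W" if "q \<in> V" for q
  proof -
    have "\<phi> q \<in> \<phi> ` (W \<inter> U)" using that S(3) by (auto simp: V_def B_def)
    then show ?thesis using that inj_on_image_mem_iff[OF chart_inj[OF ch], of q "W \<inter> U"] by (auto simp: V_def)
  qed
  have \<phi>'D: "\<phi>' q \<in> D'" "\<Omega> (\<phi>' q) = \<phi> q" if "q \<in> V" for q using that S(6) by (auto simp: V_def \<phi>'_def)
  define f where "f = (\<lambda>q. frechet_derivative (\<lambda>y. \<Omega> y $ i) (at (\<phi>' q)) (axis i 1))"
  have anf: "analytic_at M f q" if "q \<in> V" for q
    unfolding f_def
    by (rule analytic_at_compose[where F = "\<lambda>y. frechet_derivative (\<lambda>y. \<Omega> y $ i) (at y) (axis i 1)" and h = \<phi>', OF M])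
      (use that chart_subset[OF ch'] in \<open>auto intro: real_analytic_at_frechet_axis S(9)[OF \<phi>'D(1)] analytic_at_chart_coord[OF M ch']\<close>)
  have fd: "\<xi> (\<lambda>x. \<phi> x $ i) = f q * \<xi> (\<lambda>x. \<phi>' x $ i) - F q / P q * \<xi> (\<lambda>x. \<phi>' x $ k)"
    if q: "q \<in> V" and \<xi>: "\<xi> \<in> tangent_space M q" for q \<xi>
  proof -
    have "near M q (\<lambda>x. x \<in> V)" by (rule near_openin[OF chart_openin[OF ch'] q])
    then have "near M q (\<lambda>x. \<phi> x $ i = \<Omega> (\<phi>' x) $ i)" by (rule near_mono) (simp add: \<phi>'D)
    from tangent_cong[OF M \<xi> this] have "\<xi> (\<lambda>x. \<phi> x $ i) = \<xi> (\<lambda>x. \<Omega> (\<phi>' x) $ i)" .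
    also have "\<dots> = frechet_derivative (\<lambda>y. \<Omega> y $ i) (at (\<phi>' q)) (\<chi> j. \<xi> (\<lambda>x. \<phi>' x $ j))"
      by (rule tangent_chain[OF M \<xi>, where F = "\<lambda>y. \<Omega> y $ i" and h = \<phi>'])
        (use S(9)[OF \<phi>'D(1)[OF q]] analytic_at_chart_coord[OF M ch' q] in auto)
    also have "\<dots> = (\<Sum>j\<in>UNIV. (\<chi> j. \<xi> (\<lambda>x. \<phi>' x $ j)) $ j * frechet_derivative (\<lambda>y. \<Omega> y $ i) (at (\<phi>' q)) (axis j 1))"
      by (rule linear_axis_expand[OF linear_frechet_derivative[OF real_analytic_at_differentiable[OF S(9)[OF \<phi>'D(1)[OF q]]]]])
    also have "\<dots> = (\<Sum>j\<in>{i,k}. \<xi> (\<lambda>x. \<phi>' x $ j) * frechet_derivative (\<lambda>y. \<Omega> y $ i) (at (\<phi>' q)) (axis j 1))"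
      using ik exhaust_2 by (intro sum.cong) (auto, metis)
    also have "\<dots> = \<xi> (\<lambda>x. \<phi>' x $ i) * f q + \<xi> (\<lambda>x. \<phi>' x $ k) * w (\<phi> q)"
      using ik S(12)[OF \<phi>'D(1)[OF q]] \<phi>'D(2)[OF q] by (simp add: f_def)
    finally show ?thesis using chart_inv[OF ch, of q] q by (simp add: w_def V_def)
  qed
  have k': "\<phi>' q $ k = \<phi> q $ k" for q using S(10)[of k "\<phi> q"] ik by (auto simp: \<phi>'_def)
  have main: "P q * (\<xi> (\<lambda>x. \<phi> x $ i) * \<eta> (\<lambda>x. \<phi> x $ i))
       + F q * (\<xi> (\<lambda>x. \<phi> x $ i) * \<eta> (\<lambda>x. \<phi> x $ k) + \<xi> (\<lambda>x. \<phi> x $ k) * \<eta> (\<lambda>x. \<phi> x $ i))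
       + Q * (\<xi> (\<lambda>x. \<phi> x $ k) * \<eta> (\<lambda>x. \<phi> x $ k))
       = P q * (f q)\<^sup>2 * (\<xi> (\<lambda>x. \<phi>' x $ i) * \<eta> (\<lambda>x. \<phi>' x $ i))
       + (Q - (F q)\<^sup>2 / P q) * (\<xi> (\<lambda>x. \<phi>' x $ k) * \<eta> (\<lambda>x. \<phi>' x $ k))"
    if q: "q \<in> V" and \<xi>: "\<xi> \<in> tangent_space M q" and \<eta>: "\<eta> \<in> tangent_space M q" for q Q \<xi> \<eta>
  proof -
    have P: "P q \<noteq> 0" using W(3) VW[OF q] by force
    have alg: "p * ((u * x - F / p * y) * (u * x' - F / p * y')) + F * ((u * x - F / p * y) * y' + y * (u * x' - F / p * y')) + Q * (y * y')
      = p * u\<^sup>2 * (x * x') + (Q - F\<^sup>2 / p) * (y * y')" if "p \<noteq> 0" for p u x x' y y' F :: real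
      using that by (simp add: field_simps power2_eq_square)
    show ?thesis unfolding fd[OF q \<xi>] fd[OF q \<eta>] k'[symmetric] by (rule alg[OF P])
  qed
  \<comment> \<open>As in the straightening, the unit is chosen before it is known whether the
    condition holds, so that one chart serves both cases.\<close>
  define Z where "Z \<longleftrightarrow> near M a (\<lambda>q. \<phi> q $ i = 0 \<longrightarrow> F q = 0)"
  obtain g where g: "Z \<Longrightarrow> near M a (\<lambda>q. analytic_at M g q \<and> g q \<noteq> 0 \<and> \<phi> q $ i = \<phi>' q $ i * g q)"
  proof (cases Z)
    case True
    then have "eventually (\<lambda>x. \<phi> (inv_into U \<phi> x) $ i = 0 \<longrightarrow> F (inv_into U \<phi> x) = 0) (nhds 0)"
      unfolding Z_def near_chart[OF ch aU] a0 .
    moreover have "eventually (\<lambda>x. \<phi> (inv_into U \<phi> x) = x) (nhds 0)"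
      using eventually_chart_coord[OF ch aU] a0 by simp
    ultimately have "eventually (\<lambda>x. x $ i = 0 \<longrightarrow> w x = 0) (nhds 0)"
      by eventually_elim (auto simp: w_def)
    note Oz = S(14)[OF this]
    have D0: "0 \<in> D'" using \<phi>'D(1)[OF aV] a0' by simp
    have ev: "eventually (\<lambda>y. y $ i = 0 \<longrightarrow> \<Omega> y $ i = 0) (nhds 0)"
      unfolding eventually_nhds by (rule exI[of _ D']) (use S(4) D0 Oz in auto)
    obtain g where g: "real_analytic_at g 0" "g 0 \<noteq> 0" "eventually (\<lambda>y. \<Omega> y $ i = y $ i * g y) (nhds 0)"
      by (rule divisible_unit[OF S(9)[OF D0] ev S(13)[OF D0]])
    define G where "G = (\<lambda>q. g (\<phi>' q))"
    have "analytic_at M G a"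
      unfolding G_def
      by (rule analytic_at_compose[where F = g and h = \<phi>', OF M])
        (use aV chart_subset[OF ch'] g(1) a0' analytic_at_chart_coord[OF M ch' aV] in auto)
    then have 1: "near M a (analytic_at M G)" by (rule near_analytic_at[OF M])
    \<comment> \<open>Squaring turns non-vanishing into positivity, which
      \<open>analytic_at_positive_near\<close> spreads to a neighbourhood.\<close>
    have "analytic_at M (\<lambda>q. G q * G q) a" by (rule analytic_at_mult[OF M]) fact+
    moreover have "G a \<noteq> 0" using g(2) by (simp add: G_def a0')
    then have "0 < G a * G a" unfolding zero_less_mult_iff by arith
    ultimately have "near M a (\<lambda>q. 0 < G q * G q)" by (rule analytic_at_positive_near[OF M])
    then have 2: "near M a (\<lambda>q. G q \<noteq> 0)" by (rule near_mono) auto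
    have e: "eventually (\<lambda>x. x \<in> \<phi>' ` V) (nhds 0)" using eventually_chart_range[OF ch' aV] a0' by simp
    have "eventually (\<lambda>y. \<phi> (inv_into V \<phi>' y) $ i = \<phi>' (inv_into V \<phi>' y) $ i * G (inv_into V \<phi>' y)) (nhds 0)"
      using e g(3)
    proof eventually_elim
      case (elim y)
      then obtain q where q: "q \<in> V" "y = \<phi>' q" by blast
      then show ?case using elim(2) \<phi>'D(2)[OF q(1)] chart_inv[OF ch' q(1)] by (simp add: G_def)
    qed
    then have 3: "near M a (\<lambda>q. \<phi> q $ i = \<phi>' q $ i * G q)" unfolding near_chart[OF ch' aV] a0' .
    show ?thesis by (rule that[of G]) (rule near_conj[OF 1 near_conj[OF 2 3]])
  qed (use that in blast)
  define R where "R = (\<lambda>q. Z \<longrightarrow> analytic_at M g q \<and> g q \<noteq> 0 \<and> \<phi> q $ i = \<phi>' q $ i * g q)"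
  have nR: "near M a R"
  proof (cases Z)
    case True from g[OF this] show ?thesis by (rule near_mono) (simp add: R_def)
  next
    case False
    have "near M a (\<lambda>q. q \<in> V)" by (rule near_openin[OF chart_openin[OF ch'] aV])
    then show ?thesis by (rule near_mono) (simp add: R_def False)
  qed
  have cat: "chart_at M a V \<phi>'" using ch' aV a0' by (simp add: chart_at_def)
  obtain U' where U': "chart_at M a U' \<phi>'" "U' \<subseteq> V" "\<And>q. q \<in> U' \<Longrightarrow> R q"
    by (rule near_ex_chart[OF M cat nR]) (rule that; assumption)
  show ?thesis
  proof (rule that[of U' \<phi>' f g])
    show "chart_at M a U' \<phi>'" by (rule U'(1))
    show "U' \<subseteq> U" using U'(2) by (auto simp: V_def)
    fix q assume q: "q \<in> U'"
    then have qV: "q \<in> V" using U'(2) by blast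
    show "P q > 0 \<and> analytic_at M f q \<and> f q \<noteq> 0 \<and> \<phi>' q $ k = \<phi> q $ k"
      using W(3) VW[OF qV] anf[OF qV] S(13)[OF \<phi>'D(1)[OF qV]] k' by (simp add: f_def)
  next
    fix q assume q: "q \<in> U'" and Z: "near M a (\<lambda>q. \<phi> q $ i = 0 \<longrightarrow> F q = 0)"
    show "analytic_at M g q \<and> g q \<noteq> 0 \<and> \<phi> q $ i = \<phi>' q $ i * g q"
      using U'(3)[OF q] Z by (simp add: R_def Z_def)
  next
    fix q Q \<xi> \<eta> assume q: "q \<in> U'" and "\<xi> \<in> tangent_space M q" "\<eta> \<in> tangent_space M q"
    then show "P q * (\<xi> (\<lambda>x. \<phi> x $ i) * \<eta> (\<lambda>x. \<phi> x $ i))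
       + F q * (\<xi> (\<lambda>x. \<phi> x $ i) * \<eta> (\<lambda>x. \<phi> x $ k) + \<xi> (\<lambda>x. \<phi> x $ k) * \<eta> (\<lambda>x. \<phi> x $ i))
       + Q * (\<xi> (\<lambda>x. \<phi> x $ k) * \<eta> (\<lambda>x. \<phi> x $ k))
       = P q * (f q)\<^sup>2 * (\<xi> (\<lambda>x. \<phi>' x $ i) * \<eta> (\<lambda>x. \<phi>' x $ i))
       + (Q - (F q)\<^sup>2 / P q) * (\<xi> (\<lambda>x. \<phi>' x $ k) * \<eta> (\<lambda>x. \<phi>' x $ k))"
      using U'(2) by (intro main) auto
  qed
qed

section \<open>The pulled-back metric\<close>

text \<open>The coordinate line in direction 2 through \<open>q\<close> lies locally in
  \<open>H\<close>, so a function vanishing on \<open>H\<close> is constantly 0 along it.\<close>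

lemma chart_vector_tangent_to:
  fixes M :: "('a, 2) mfd"
  assumes M: "analytic_manifold M" and U: "chart M U \<phi>" and q: "q \<in> U" "\<phi> q $ 1 = 0"
    and H: "near M q (\<lambda>x. \<phi> x $ 1 = 0 \<longrightarrow> x \<in> H)"
  shows "chart_vector M U \<phi> q (axis 2 1) \<in> tangent_to M H q"
  unfolding tangent_to_def mem_Collect_eq
proof (intro conjI allI impI)
  show "chart_vector M U \<phi> q (axis 2 1) \<in> tangent_space M q" by (rule chart_vector_tangent[OF M U q(1)])
  fix f assume f: "analytic_at M f q \<and> near M q (\<lambda>x. x \<in> H \<longrightarrow> f x = 0)"
  let ?f = "\<lambda>x. f (inv_into U \<phi> x)"
  have ra: "real_analytic_at ?f (\<phi> q)" using f unfolding analytic_at_iff_chart[OF M U q(1)] by blast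
  have "near M q (\<lambda>x. (\<phi> x $ 1 = 0 \<longrightarrow> x \<in> H) \<and> (x \<in> H \<longrightarrow> f x = 0))" using H f by (intro near_conj) auto
  then have "near M q (\<lambda>x. \<phi> x $ 1 = 0 \<longrightarrow> f x = 0)" by (rule near_mono) auto
  then have "eventually (\<lambda>x. \<phi> (inv_into U \<phi> x) $ 1 = 0 \<longrightarrow> ?f x = 0) (nhds (\<phi> q))"
    unfolding near_chart[OF U q(1)] .
  with eventually_chart_coord[OF U q(1)]
  have ev: "eventually (\<lambda>x. x $ 1 = 0 \<longrightarrow> ?f x = 0) (nhds (\<phi> q))" by eventually_elim simp
  have e0: "vec_upd (\<phi> q) 2 (\<phi> q $ 2) = \<phi> q" by simp
  have c: "isCont (\<lambda>s. vec_upd (\<phi> q) 2 s) (\<phi> q $ 2)" by (rule has_derivative_continuous[OF vec_upd_has_derivative])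
  have "eventually (\<lambda>s. ?f (vec_upd (\<phi> q) 2 s) = 0) (nhds (\<phi> q $ 2))"
    using eventually_compose_filterlim[OF ev isCont_imp_filterlim_nhds[where f = "\<lambda>s. vec_upd (\<phi> q) 2 s", OF c e0]] q(2)
    by simp
  then have ev0: "eventually (\<lambda>s. 0 = ?f (vec_upd (\<phi> q) 2 s)) (nhds (\<phi> q $ 2))" by eventually_elim simp
  have "((\<lambda>s. ?f (vec_upd (\<phi> q) 2 s)) has_real_derivative 0) (at (\<phi> q $ 2))"
    using DERIV_const[of 0 "at (\<phi> q $ 2)"] unfolding has_field_derivative_def has_derivative_cong_nhds[OF ev0] .
  from frechet_derivative_axis_unique[OF ra this]
  show "chart_vector M U \<phi> q (axis 2 1) f = 0" by (simp add: chart_vector_def)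
qed

lemma tangent_to_mono: "H \<subseteq> E \<Longrightarrow> tangent_to M H p \<subseteq> tangent_to M E p"
  unfolding tangent_to_def by (auto elim!: near_mono)

text \<open>Adaptedness comes with a chart of its own, whose index set \<open>I\<close> may differ
  from \<open>{1}\<close>. It is nonempty since \<open>a\<close> lies on the divisor, and it has a
  single element since at a corner one branch would cross the leaf, and then so would the whole
  divisor: tangent vectors to a branch are tangent to the divisor. A single branch that does not
  cross is invariant, and near \<open>a\<close> it is the set \<open>\<phi> $ 1 = 0\<close>.\<close>

lemma adapted_not_crossing:
  fixes M :: "('a, 2) mfd"
  assumes M: "analytic_manifold M" and U: "divisor_chart M E a U \<phi> {1}"
    and ad: "adapted_at M E \<mu> a" and nv: "\<not> vanishes_at M \<mu> a" and nc: "\<not> crosses_leaf M E \<mu> a"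
  shows "near M a (\<lambda>q. \<phi> q $ 1 = 0 \<longrightarrow> \<mu> q (chart_vector M U \<phi> q (axis 2 1)) = 0)"
proof -
  have ch: "chart M U \<phi>" "a \<in> U" "\<phi> a = 0" and E: "E \<inter> U = {q\<in>U. \<phi> q $ 1 = 0}"
    using U by (auto simp: divisor_chart_def chart_at_def)
  have "a \<in> E \<inter> U" unfolding E using ch(2,3) by simp
  then have aE: "a \<in> E" by blast
  let ?reg = "\<lambda>I H. (\<forall>i. I = {i} \<longrightarrow> invariant_curve M (H i) \<mu> \<or> crosses_leaf M (H i) \<mu> a) \<and>
              (\<forall>i j. i \<noteq> j \<and> I = {i, j} \<longrightarrow>
                 invariant_curve M (H i) \<mu> \<and> crosses_leaf M (H j) \<mu> a \<or>
                 invariant_curve M (H j) \<mu> \<and> crosses_leaf M (H i) \<mu> a)"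
  obtain U' \<phi>' I H where A: "divisor_chart M E a U' \<phi>' I \<and> (\<forall>i\<in>I. H i = {q\<in>U'. \<phi>' q $ i = 0}) \<and> ?reg I H"
    using ad unfolding adapted_at_def if_not_P[OF nv] by (elim exE) (rule that)
  have U': "divisor_chart M E a U' \<phi>' I" and R: "?reg I H"
    and H: "\<And>i. i \<in> I \<Longrightarrow> H i = {q\<in>U'. \<phi>' q $ i = 0}"
    by (rule A[THEN conjunct1] A[THEN conjunct2, THEN conjunct2] A[THEN conjunct2, THEN conjunct1, rule_format], assumption?)+
  have 1: "I = {i} \<Longrightarrow> invariant_curve M (H i) \<mu> \<or> crosses_leaf M (H i) \<mu> a" for i
    by (rule R[THEN conjunct1, rule_format])
  have 2: "i \<noteq> j \<Longrightarrow> I = {i, j} \<Longrightarrow>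
                 invariant_curve M (H i) \<mu> \<and> crosses_leaf M (H j) \<mu> a \<or>
                 invariant_curve M (H j) \<mu> \<and> crosses_leaf M (H i) \<mu> a" for i j
    by (rule R[THEN conjunct2, rule_format]) (rule conjI)
  have ch': "chart M U' \<phi>'" "a \<in> U'" and E': "E \<inter> U' = {q\<in>U'. \<exists>i\<in>I. \<phi>' q $ i = 0}"
    using U' by (auto simp: divisor_chart_def chart_at_def)
  have "H i \<subseteq> E \<inter> U'" if "i \<in> I" for i unfolding E' H[OF that] using that by blast
  then have nc': "\<not> crosses_leaf M (H i) \<mu> a" if "i \<in> I" for i
    using nc tangent_to_mono[of "H i" E M a] that unfolding crosses_leaf_def by blast
  have "a \<in> E \<inter> U'" using aE ch'(2) by blast
  then have "I \<noteq> {}" unfolding E' by blast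
  moreover have "I \<subseteq> {1, 2}" using exhaust_2 by blast
  then have "I = {} \<or> I = {1} \<or> I = {2} \<or> I = {1, 2}" by blast
  moreover have "I \<noteq> {1, 2}" using 2[of 1 2] nc' by auto
  ultimately obtain i where i: "I = {i}" by blast
  have inv: "invariant_curve M (H i) \<mu>" using 1[OF i] nc'[of i] i by blast
  have HE: "H i = E \<inter> U'" unfolding E' using H[of i] i by simp
  show ?thesis
    unfolding near_def
  proof (intro exI conjI ballI impI)
    show "openin (mtop M) (U \<inter> U')" by (intro openin_Int chart_openin[OF ch(1)] chart_openin[OF ch'(1)])
    show "a \<in> U \<inter> U'" using ch ch' by blast
    fix q assume q: "q \<in> U \<inter> U'" "\<phi> q $ 1 = 0"
    have "near M q (\<lambda>x. x \<in> U \<inter> U')"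
      by (rule near_openin[OF _ q(1)]) (intro openin_Int chart_openin[OF ch(1)] chart_openin[OF ch'(1)])
    then have "near M q (\<lambda>x. \<phi> x $ 1 = 0 \<longrightarrow> x \<in> H i)"
      by (rule near_mono) (use E HE in blast)
    then have "chart_vector M U \<phi> q (axis 2 1) \<in> tangent_to M (H i) q"
      using q by (intro chart_vector_tangent_to[OF M ch(1)]) auto
    moreover have "q \<in> H i" using q E HE by blast
    ultimately show "\<mu> q (chart_vector M U \<phi> q (axis 2 1)) = 0" using inv unfolding invariant_curve_def by blast
  qed
qed

text \<open>Both functions are continuous at \<open>q\<close>, which is approached off the
  hypersurface along the \<open>i\<close>-th coordinate line.\<close>

lemma analytic_eq_off_hypersurface:
  assumes M: "analytic_manifold M" and U: "chart M U \<phi>" and q: "q \<in> U" "\<phi> q $ i = 0"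
    and f: "analytic_at M f q" and g: "analytic_at M g q"
    and eq: "\<And>x. x \<in> U \<Longrightarrow> \<phi> x $ i \<noteq> 0 \<Longrightarrow> f x = g x"
  shows "f q = g q"
proof -
  let ?h = "\<lambda>s. inv_into U \<phi> (vec_upd (\<phi> q) i s)"
  have e0: "vec_upd (\<phi> q) i 0 = \<phi> q" using q(2) vec_upd_self[of "\<phi> q" i] by simp
  have c: "isCont (\<lambda>s. vec_upd (\<phi> q) i s) 0" by (rule has_derivative_continuous[OF vec_upd_has_derivative])
  have lim: "(\<lambda>s. k (?h s)) \<midarrow>0\<rightarrow> k q" if k: "analytic_at M k q" for k
  proof -
    have "isCont (\<lambda>x. k (inv_into U \<phi> x)) (vec_upd (\<phi> q) i 0)"
      unfolding e0 by (rule real_analytic_at_imp_isCont) (use k analytic_at_iff_chart[OF M U q(1)] in blast)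
    from continuous_within_compose3[OF this c] show ?thesis
      unfolding isCont_def by (simp add: e0 chart_inv[OF U q(1)])
  qed
  have "eventually (\<lambda>s. vec_upd (\<phi> q) i s \<in> \<phi> ` U) (nhds 0)"
    by (rule eventually_compose_filterlim[OF eventually_chart_range[OF U q(1)]
          isCont_imp_filterlim_nhds[where f = "\<lambda>s. vec_upd (\<phi> q) i s", OF c e0]])
  then have "eventually (\<lambda>s. f (?h s) = g (?h s)) (at 0)"
    unfolding eventually_at_filter
  proof eventually_elim
    case (elim s)
    then show ?case using eq[of "?h s"] by (auto simp: inv_into_into f_inv_into_f)
  qed
  from Lim_transform_eventually[OF lim[OF f] this] have "(\<lambda>s. g (?h s)) \<midarrow>0\<rightarrow> f q" .
  then show ?thesis using lim[OF g] LIM_unique by blast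
qed

text \<open>The coframe identity holds on fibres of \<open>T\<close>, and push-forwards are known to
  lie in these fibres only off the divisor, where \<open>T\<close> is the tangent plane of the
  surface. The formula is proved there and extended to the divisor coefficient by
  coefficient.\<close>

lemma pullback_metric_forms:
  fixes S :: "('y, 2) mfd" and X\<^sub>1 :: "('x, 2) mfd" and M\<^sub>0 :: "('m, 'n::finite) mfd"
  assumes M\<^sub>0: "analytic_manifold M\<^sub>0" and g: "riemannian_metric M\<^sub>0 g\<^sub>0"
    and res: "gauss_regular_resolution M\<^sub>0 X\<^sub>0 X\<^sub>1 E\<^sub>1 \<sigma> T" and bl: "point_blowings_up X\<^sub>1 E\<^sub>1 S E b"
    and U: "chart S U \<phi>" and E: "E \<inter> U = {q\<in>U. \<phi> q $ 1 = 0}"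
    and co: "orthogonal_coframe M\<^sub>0 g\<^sub>0 X\<^sub>1 \<sigma> T W \<omega>1 \<omega>2" and bU: "b ` U \<subseteq> W"
    and \<mu>: "analytic_one_form S U \<mu>1" "analytic_one_form S U \<mu>2"
    and om: "\<And>q \<xi>. q \<in> U \<Longrightarrow> \<xi> \<in> tangent_space S q \<Longrightarrow>
      \<omega>1 (b q) (pushforward M\<^sub>0 (\<sigma> \<circ> b) q \<xi>) = (\<phi> q $ 1) ^ r * \<mu>1 q \<xi> \<and>
      \<omega>2 (b q) (pushforward M\<^sub>0 (\<sigma> \<circ> b) q \<xi>) = (\<phi> q $ 1) ^ s * \<mu>2 q \<xi>"
    and q: "q \<in> U" and \<xi>: "\<xi> \<in> tangent_space S q" and \<eta>: "\<eta> \<in> tangent_space S q"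
  shows "pullback_metric M\<^sub>0 g\<^sub>0 (\<sigma> \<circ> b) q \<xi> \<eta>
    = ((\<phi> q $ 1) ^ r)\<^sup>2 * (\<mu>1 q \<xi> * \<mu>1 q \<eta>) + ((\<phi> q $ 1) ^ s)\<^sup>2 * (\<mu>2 q \<xi> * \<mu>2 q \<eta>)"
proof -
  let ?k = "pullback_metric M\<^sub>0 g\<^sub>0 (\<sigma> \<circ> b)"
  let ?R = "\<lambda>q \<xi> \<eta>. ((\<phi> q $ 1) ^ r)\<^sup>2 * (\<mu>1 q \<xi> * \<mu>1 q \<eta>) + ((\<phi> q $ 1) ^ s)\<^sup>2 * (\<mu>2 q \<xi> * \<mu>2 q \<eta>)"
  have rs: "resolution_of_surface M\<^sub>0 X\<^sub>0 X\<^sub>1 E\<^sub>1 \<sigma>" and ge: "gauss_extension M\<^sub>0 X\<^sub>0 X\<^sub>1 E\<^sub>1 \<sigma> T"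
    using res by (auto simp: gauss_regular_resolution_def)
  have X1: "analytic_manifold X\<^sub>1" and sX: "\<sigma> ` pts X\<^sub>1 \<subseteq> X\<^sub>0" using rs by (auto simp: resolution_of_surface_def)
  have S: "analytic_manifold S" using bl by (auto simp: point_blowings_up_def)
  have m1: "analytic_map X\<^sub>1 (pts X\<^sub>1) M\<^sub>0 \<sigma>"
  proof -
    obtain M X D C \<beta> \<tau> where "blowup_limit M X D C \<beta> X\<^sub>1 E\<^sub>1 \<tau>" "M 0 = M\<^sub>0" "\<tau> 0 = \<sigma>"
      using rs unfolding resolution_of_surface_def by (elim conjE exE) (rule that)
    then show ?thesis unfolding blowup_limit_def by metis
  qed
  have m2: "analytic_map S (pts S) X\<^sub>1 b"
  proof -
    obtain M X D C \<beta> \<tau> where "blowup_limit M X D C \<beta> S E \<tau>" "M 0 = X\<^sub>1" "\<tau> 0 = b"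
      using bl unfolding point_blowings_up_def by (elim conjE exE) (rule that)
    then show ?thesis unfolding blowup_limit_def by metis
  qed
  have map: "analytic_map_at S M\<^sub>0 (\<sigma> \<circ> b) q" if "q \<in> pts S" for q
  proof -
    have b: "analytic_map_at S X\<^sub>1 b q" by (rule analytic_map_imp_at[OF m2 that])
    then have "b q \<in> pts X\<^sub>1" by (simp add: analytic_map_at_def)
    from analytic_map_at_trans[OF S X1 b analytic_map_imp_at[OF m1 this]] show ?thesis .
  qed
  have US: "q \<in> pts S" if "q \<in> U" for q using chart_subset[OF U] that by blast
  have bX: "b p \<in> pts X\<^sub>1" if "p \<in> pts S" for p
    using analytic_map_imp_at[OF m2 that] by (simp add: analytic_map_at_def)
  have im: "(\<sigma> \<circ> b) ` pts S \<subseteq> X\<^sub>0" using sX bX by auto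
  have off: "?k q \<xi> \<eta> = ?R q \<xi> \<eta>"
    if q: "q \<in> U" "\<phi> q $ 1 \<noteq> 0" and \<xi>: "\<xi> \<in> tangent_space S q" and \<eta>: "\<eta> \<in> tangent_space S q" for q \<xi> \<eta>
  proof -
    have "q \<notin> E" using E q by blast
    from point_blowings_up_exceptional[OF bl X1 US[OF q(1)] this]
    have "T (b q) = tangent_to M\<^sub>0 X\<^sub>0 (\<sigma> (b q))" using ge unfolding gauss_extension_def by blast
    then have P: "pushforward M\<^sub>0 (\<sigma> \<circ> b) q \<zeta> \<in> T (b q)" if "\<zeta> \<in> tangent_space S q" for \<zeta>
      using pushforward_tangent_to[OF S M\<^sub>0 map[OF US[OF q(1)]] im that] by simp
    have "b q \<in> W" using bU q by blast
    then have "g\<^sub>0 (\<sigma> (b q)) (pushforward M\<^sub>0 (\<sigma> \<circ> b) q \<xi>) (pushforward M\<^sub>0 (\<sigma> \<circ> b) q \<eta>)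
      = \<omega>1 (b q) (pushforward M\<^sub>0 (\<sigma> \<circ> b) q \<xi>) * \<omega>1 (b q) (pushforward M\<^sub>0 (\<sigma> \<circ> b) q \<eta>)
      + \<omega>2 (b q) (pushforward M\<^sub>0 (\<sigma> \<circ> b) q \<xi>) * \<omega>2 (b q) (pushforward M\<^sub>0 (\<sigma> \<circ> b) q \<eta>)"
      using co P[OF \<xi>] P[OF \<eta>] unfolding orthogonal_coframe_def by blast
    then show ?thesis
      using om[OF q(1) \<xi>] om[OF q(1) \<eta>] by (simp add: pullback_metric_def power2_eq_square mult_ac)
  qed
  let ?d = "\<lambda>k q. chart_vector S U \<phi> q (axis k 1)"
  \<comment> \<open>Both sides are bilinear, so crossing the divisor is needed only for the
    coordinate frame, where the two sides are analytic functions of the point.\<close>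
  have basis: "?k q (?d k q) (?d l q) = ?R q (?d k q) (?d l q)" for k l
  proof (cases "\<phi> q $ 1 = 0")
    case True
    show ?thesis
    proof (rule analytic_eq_off_hypersurface[OF S U q True,
          where f = "\<lambda>q. ?k q (?d k q) (?d l q)" and g = "\<lambda>q. ?R q (?d k q) (?d l q)"])
      show "analytic_at S (\<lambda>q. ?k q (?d k q) (?d l q)) q"
        by (rule pullback_metric_analytic[OF S M\<^sub>0 g U q map[OF US]])
      have p: "analytic_at S (\<lambda>q. (\<phi> q $ 1) ^ n) q" for n
        by (rule analytic_at_compose[where F = "\<lambda>x. x $ 1 ^ n" and h = \<phi>, OF S US[OF q]])
          (intro real_analytic_at_power real_analytic_at_coord analytic_at_chart_coord[OF S U q])+
      show "analytic_at S (\<lambda>q. ?R q (?d k q) (?d l q)) q"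
        unfolding power2_eq_square
        by (intro analytic_at_add analytic_at_mult S p one_form_chart_analytic[OF S U q] \<mu>)
      show "?k x (?d k x) (?d l x) = ?R x (?d k x) (?d l x)" if "x \<in> U" "\<phi> x $ 1 \<noteq> 0" for x
        by (rule off[OF that]; rule chart_vector_tangent[OF S U that(1)])
    qed
  next
    case False
    show ?thesis by (rule off[OF q False]; rule chart_vector_tangent[OF S U q])
  qed
  have l: "linear_form_on (tangent_space S q) (\<mu>1 q)" "linear_form_on (tangent_space S q) (\<mu>2 q)"
    using \<mu> q unfolding analytic_one_form_def by blast+
  have ex: "\<mu>1 q \<zeta> = \<zeta> (\<lambda>q. \<phi> q $ 1) * \<mu>1 q (?d 1 q) + \<zeta> (\<lambda>q. \<phi> q $ 2) * \<mu>1 q (?d 2 q)"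
    "\<mu>2 q \<zeta> = \<zeta> (\<lambda>q. \<phi> q $ 1) * \<mu>2 q (?d 1 q) + \<zeta> (\<lambda>q. \<phi> q $ 2) * \<mu>2 q (?d 2 q)"
    if "\<zeta> \<in> tangent_space S q" for \<zeta>
    using one_form_expand[OF S U q l(1) that] one_form_expand[OF S U q l(2) that] by (simp_all only: sum_2)
  have "?k q \<xi> \<eta> = (\<Sum>k\<in>UNIV. \<Sum>l\<in>UNIV. \<xi> (\<lambda>q. \<phi> q $ k) * (\<eta> (\<lambda>q. \<phi> q $ l) * ?R q (?d k q) (?d l q)))"
    unfolding basis[symmetric] by (rule pullback_metric_expand[OF S M\<^sub>0 g U q map[OF US[OF q]] \<xi> \<eta>])
  also have "\<dots> = ?R q \<xi> \<eta>"
    unfolding sum_2 ex[OF \<xi>] ex[OF \<eta>] by (simp add: algebra_simps)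
  finally show ?thesis .
qed

theorem propositionB14:
  fixes M\<^sub>0 :: "('m, 'n::finite) mfd"
    and g\<^sub>0 :: "'m \<Rightarrow> 'm tvec \<Rightarrow> 'm tvec \<Rightarrow> real"
    and \<I> :: "'m \<Rightarrow> ('m \<Rightarrow> real) set" and X\<^sub>0 :: "'m set"
    and X\<^sub>1 :: "('x, 2) mfd" and E\<^sub>1 :: "'x set" and \<sigma>\<^sub>1 :: "'x \<Rightarrow> 'm"
    and T :: "'x \<Rightarrow> 'm tvec set"
    and Xt :: "('y, 2) mfd" and Et :: "'y set" and \<beta>t :: "'y \<Rightarrow> 'x"
    and a :: 'y and U :: "'y set" and \<phi> :: "'y \<Rightarrow> real^2"
    and \<mu>1 \<mu>2 :: "'y \<Rightarrow> 'y tvec \<Rightarrow> real"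
    and r s t \<rho> :: nat
  assumes "analytic_manifold M\<^sub>0" and "connected_space (mtop M\<^sub>0)"
    and "riemannian_metric M\<^sub>0 g\<^sub>0"
    and "analytic_surface_in M\<^sub>0 \<I> X\<^sub>0"
    and "gauss_regular_resolution M\<^sub>0 X\<^sub>0 X\<^sub>1 E\<^sub>1 \<sigma>\<^sub>1 T"
    and "\<forall>p\<in>pts X\<^sub>1. \<exists>W \<omega>1 \<omega>2. p \<in> W \<and> orthogonal_coframe M\<^sub>0 g\<^sub>0 X\<^sub>1 \<sigma>\<^sub>1 T W \<omega>1 \<omega>2"
    and "point_blowings_up X\<^sub>1 E\<^sub>1 Xt Et \<beta>t"
    and "monomialized_everywhere M\<^sub>0 g\<^sub>0 X\<^sub>1 \<sigma>\<^sub>1 T Xt Et \<beta>t"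
    and "monomial_presentation M\<^sub>0 g\<^sub>0 X\<^sub>1 \<sigma>\<^sub>1 T Xt Et \<beta>t a U \<phi> {1} \<mu>1 \<mu>2
           (\<lambda>_. r) (\<lambda>_. s) (\<lambda>_. t)"
    and "r \<le> s" and "\<not> vanishes_at Xt \<mu>1 a"
    and "crosses_leaf Xt Et \<mu>1 a \<longrightarrow> r = s \<and> t = 0"
    and "\<rho> \<ge> 2 * s + 2 * t + 1"
  shows "normal_form_at Xt Et (pullback_metric M\<^sub>0 g\<^sub>0 (\<sigma>\<^sub>1 \<circ> \<beta>t)) a
           (2 * r) (2 * s + 2 * t) \<rho>"
proof -
  note M\<^sub>0 = assms(1) and g\<^sub>0 = assms(3) and res = assms(5) and bl = assms(7) and pres = assms(9)
    and rs = assms(10) and nv = assms(11) and cross = assms(12)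
  have S: "analytic_manifold Xt" using bl by (auto simp: point_blowings_up_def)
  let ?\<kappa> = "pullback_metric M\<^sub>0 g\<^sub>0 (\<sigma>\<^sub>1 \<circ> \<beta>t)"
  note pr = pres[unfolded monomial_presentation_def]
  have div: "divisor_chart Xt Et a U \<phi> {1}" by (rule pr[THEN conjunct1])
  have fol: "adapted_foliation_on Xt Et U \<mu>1" "adapted_foliation_on Xt Et U \<mu>2"
    by (rule pr[THEN conjunct2, THEN conjunct1] pr[THEN conjunct2, THEN conjunct2, THEN conjunct1])+
  have \<mu>: "analytic_one_form Xt U \<mu>1" "analytic_one_form Xt U \<mu>2"
    using fol by (simp_all add: adapted_foliation_on_def)
  have cat: "chart_at Xt a U \<phi>" and E: "Et \<inter> U = {q\<in>U. \<phi> q $ 1 = 0}"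
    using div by (simp_all add: divisor_chart_def)
  have ch: "chart Xt U \<phi>" and aU: "a \<in> U" and a0: "\<phi> a = 0" using cat by (auto simp: chart_at_def)
  obtain W \<omega>1 \<omega>2 where co: "orthogonal_coframe M\<^sub>0 g\<^sub>0 X\<^sub>1 \<sigma>\<^sub>1 T W \<omega>1 \<omega>2 \<and> \<beta>t ` U \<subseteq> W \<and>
        (\<forall>q\<in>U. \<forall>\<xi>\<in>tangent_space Xt q.
           \<omega>1 (\<beta>t q) (pushforward M\<^sub>0 (\<sigma>\<^sub>1 \<circ> \<beta>t) q \<xi>) = monomial_in \<phi> {1} (\<lambda>_. r) q * \<mu>1 q \<xi> \<and>
           \<omega>2 (\<beta>t q) (pushforward M\<^sub>0 (\<sigma>\<^sub>1 \<circ> \<beta>t) q \<xi>) = monomial_in \<phi> {1} (\<lambda>_. s) q * \<mu>2 q \<xi>)"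
    using pr[THEN conjunct2, THEN conjunct2, THEN conjunct2, THEN conjunct1] by (elim exE) (rule that)
  obtain \<epsilon> where \<epsilon>: "\<forall>q\<in>U. analytic_at Xt \<epsilon> q \<and> \<epsilon> q \<noteq> 0 \<and>
        (\<forall>\<xi>\<in>tangent_space Xt q. \<forall>\<eta>\<in>tangent_space Xt q.
           \<mu>1 q \<xi> * \<mu>2 q \<eta> - \<mu>1 q \<eta> * \<mu>2 q \<xi> =
           \<epsilon> q * monomial_in \<phi> {1} (\<lambda>_. t) q *
             (\<xi> (\<lambda>x. \<phi> x $ 1) * \<eta> (\<lambda>x. \<phi> x $ 2) - \<eta> (\<lambda>x. \<phi> x $ 1) * \<xi> (\<lambda>x. \<phi> x $ 2)))"
    using pr[THEN conjunct2, THEN conjunct2, THEN conjunct2, THEN conjunct2] by (elim exE) (rule that)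
  define k where "k = s - r"
  have s: "s = r + k" using rs by (simp add: k_def)
  define u where "u = (\<lambda>q. \<phi> q $ 1)"
  define D where "D = (\<lambda>i q. chart_vector Xt U \<phi> q (axis i 1))"
  define m1 where "m1 = (\<lambda>i q. \<mu>1 q (D i q))"
  define m2 where "m2 = (\<lambda>i q. \<mu>2 q (D i q))"
  define P where "P = (\<lambda>q. m1 1 q ^ 2 + u q ^ (2 * k) * m2 1 q ^ 2)"
  define F where "F = (\<lambda>q. m1 1 q * m1 2 q + u q ^ (2 * k) * (m2 1 q * m2 2 q))"
  define Q where "Q = (\<lambda>q. m1 2 q ^ 2 + u q ^ (2 * k) * m2 2 q ^ 2)"
  have anu: "analytic_at Xt u q" if "q \<in> U" for q
    unfolding u_def by (rule analytic_at_chart_coord[OF S ch that])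
  have anm: "analytic_at Xt (m1 i) q" "analytic_at Xt (m2 i) q" if "q \<in> U" for i q
    unfolding m1_def m2_def D_def by (rule one_form_chart_analytic[OF S ch that \<mu>(1)] one_form_chart_analytic[OF S ch that \<mu>(2)])+
  have an: "analytic_at Xt P q" "analytic_at Xt F q" "analytic_at Xt Q q" if "q \<in> U" for q
    unfolding P_def F_def Q_def
    by (intro analytic_at_add analytic_at_mult analytic_at_power S anu[OF that] anm[OF that])+
  have an\<epsilon>: "analytic_at Xt \<epsilon> q" and \<epsilon>0: "\<epsilon> q \<noteq> 0" if "q \<in> U" for q using \<epsilon> that by blast+
  have DT: "D i q \<in> tangent_space Xt q" if "q \<in> U" for i q
    unfolding D_def by (rule chart_vector_tangent[OF S ch that])
  have det: "m1 1 q * m2 2 q - m1 2 q * m2 1 q = \<epsilon> q * u q ^ t" if "q \<in> U" for q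
  proof -
    have "\<mu>1 q (D 1 q) * \<mu>2 q (D 2 q) - \<mu>1 q (D 2 q) * \<mu>2 q (D 1 q) =
           \<epsilon> q * monomial_in \<phi> {1} (\<lambda>_. t) q *
             (D 1 q (\<lambda>x. \<phi> x $ 1) * D 2 q (\<lambda>x. \<phi> x $ 2) - D 2 q (\<lambda>x. \<phi> x $ 1) * D 1 q (\<lambda>x. \<phi> x $ 2))"
      using \<epsilon> that DT[OF that] by blast
    then show ?thesis
      by (simp add: D_def chart_vector_coord[OF S ch that] m1_def m2_def u_def monomial_in_def axis_def)
  qed
  \<comment> \<open>\<open>P\<close>, \<open>F\<close>, \<open>Q\<close> form the Gram matrix of the
    columns of the 2x2 coefficient matrix of the forms \<open>\<mu>1\<close> and
    \<open>u ^ k * \<mu>2\<close>, so its determinant is the square of the determinant of that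
    matrix, which the presentation gives.\<close>
  have gram: "P q * Q q - (F q)^2 = u q ^ (2 * k + 2 * t) * (\<epsilon> q)^2" if "q \<in> U" for q
  proof -
    have "P q * Q q - (F q)^2 = u q ^ (2 * k) * (m1 1 q * m2 2 q - m1 2 q * m2 1 q)^2"
      by (simp add: P_def Q_def F_def power2_eq_square algebra_simps)
    moreover have "(\<epsilon> q * u q ^ t)^2 = u q ^ (2 * t) * (\<epsilon> q)^2"
      unfolding power_mult_distrib power_even_eq by (rule mult.commute)
    ultimately show ?thesis unfolding det[OF that] by (simp only: power_add mult.assoc)
  qed
  have l: "linear_form_on (tangent_space Xt q) (\<mu>1 q)" "linear_form_on (tangent_space Xt q) (\<mu>2 q)" if "q \<in> U" for q
    using \<mu> that unfolding analytic_one_form_def by blast+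
  have ex: "\<mu>1 q \<zeta> = \<zeta> (\<lambda>q. \<phi> q $ 1) * m1 1 q + \<zeta> (\<lambda>q. \<phi> q $ 2) * m1 2 q"
    "\<mu>2 q \<zeta> = \<zeta> (\<lambda>q. \<phi> q $ 1) * m2 1 q + \<zeta> (\<lambda>q. \<phi> q $ 2) * m2 2 q"
    if "q \<in> U" "\<zeta> \<in> tangent_space Xt q" for q \<zeta>
    using one_form_expand[OF S ch that(1) l(1)[OF that(1)] that(2)] one_form_expand[OF S ch that(1) l(2)[OF that(1)] that(2)]
    by (simp_all only: sum_2 m1_def m2_def D_def)
  have \<kappa>: "?\<kappa> q \<xi> \<eta> = u q ^ (2 * r) *
      (P q * (\<xi> (\<lambda>x. \<phi> x $ 1) * \<eta> (\<lambda>x. \<phi> x $ 1))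
       + F q * (\<xi> (\<lambda>x. \<phi> x $ 1) * \<eta> (\<lambda>x. \<phi> x $ 2) + \<xi> (\<lambda>x. \<phi> x $ 2) * \<eta> (\<lambda>x. \<phi> x $ 1))
       + Q q * (\<xi> (\<lambda>x. \<phi> x $ 2) * \<eta> (\<lambda>x. \<phi> x $ 2)))"
    if q: "q \<in> U" and \<xi>: "\<xi> \<in> tangent_space Xt q" and \<eta>: "\<eta> \<in> tangent_space Xt q" for q \<xi> \<eta>
  proof -
    have om: "\<omega>1 (\<beta>t q) (pushforward M\<^sub>0 (\<sigma>\<^sub>1 \<circ> \<beta>t) q \<xi>) = (\<phi> q $ 1) ^ r * \<mu>1 q \<xi> \<and>
      \<omega>2 (\<beta>t q) (pushforward M\<^sub>0 (\<sigma>\<^sub>1 \<circ> \<beta>t) q \<xi>) = (\<phi> q $ 1) ^ s * \<mu>2 q \<xi>"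
      if "q \<in> U" "\<xi> \<in> tangent_space Xt q" for q \<xi>
      using co[THEN conjunct2, THEN conjunct2, rule_format, OF that] by (simp add: monomial_in_def)
    have k0: "?\<kappa> q \<xi> \<eta> = ((\<phi> q $ 1) ^ r)\<^sup>2 * (\<mu>1 q \<xi> * \<mu>1 q \<eta>) + ((\<phi> q $ 1) ^ s)\<^sup>2 * (\<mu>2 q \<xi> * \<mu>2 q \<eta>)"
      by (rule pullback_metric_forms[OF M\<^sub>0 g\<^sub>0 res bl ch E co[THEN conjunct1] co[THEN conjunct2, THEN conjunct1] \<mu> om q \<xi> \<eta>])
    have k1: "((\<phi> q $ 1) ^ r)\<^sup>2 = u q ^ (2 * r)" "((\<phi> q $ 1) ^ s)\<^sup>2 = u q ^ (2 * r) * u q ^ (2 * k)"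
      by (simp_all only: u_def s power_add power_mult_distrib power_even_eq)
    show ?thesis
      unfolding k0 k1 ex[OF q \<xi>] ex[OF q \<eta>] P_def F_def Q_def by (simp add: algebra_simps power2_eq_square)
  qed
  show ?thesis
  proof (cases "r = s \<and> t = 0")
    case True
    then have k: "k = 0" "t = 0" "r = s" by (auto simp: k_def)
    \<comment> \<open>The determinant is nonzero at \<open>a\<close>, so the
      \<open>v\<close>-components of the two forms cannot both vanish there.\<close>
    have Qa: "Q a > 0"
    proof -
      have "m1 1 a * m2 2 a - m1 2 a * m2 1 a \<noteq> 0" using det[OF aU] \<epsilon>0[OF aU] k by simp
      then have "m1 2 a \<noteq> 0 \<or> m2 2 a \<noteq> 0" by auto
      then show ?thesis unfolding Q_def k by (simp add: sum_power2_gt_zero_iff)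
    qed
    have ne: "(2::2) \<noteq> 1" by simp
    \<comment> \<open>The indices are exchanged: \<open>Q\<close> is the pivot and the second
      coordinate moves, so \<open>u\<close>, and with it the equation of the divisor, is
      unchanged.\<close>
    obtain U' \<phi>' f g where U': "chart_at Xt a U' \<phi>'" "U' \<subseteq> U"
      "\<And>q. q \<in> U' \<Longrightarrow> Q q > 0 \<and> analytic_at Xt f q \<and> f q \<noteq> 0 \<and> \<phi>' q $ 1 = \<phi> q $ 1"
      "\<And>q R \<xi> \<eta>. q \<in> U' \<Longrightarrow> \<xi> \<in> tangent_space Xt q \<Longrightarrow> \<eta> \<in> tangent_space Xt q \<Longrightarrow>
       Q q * (\<xi> (\<lambda>x. \<phi> x $ 2) * \<eta> (\<lambda>x. \<phi> x $ 2))
       + F q * (\<xi> (\<lambda>x. \<phi> x $ 2) * \<eta> (\<lambda>x. \<phi> x $ 1) + \<xi> (\<lambda>x. \<phi> x $ 1) * \<eta> (\<lambda>x. \<phi> x $ 2))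
       + R * (\<xi> (\<lambda>x. \<phi> x $ 1) * \<eta> (\<lambda>x. \<phi> x $ 1))
       = Q q * (f q)\<^sup>2 * (\<xi> (\<lambda>x. \<phi>' x $ 2) * \<eta> (\<lambda>x. \<phi>' x $ 2))
       + (R - (F q)\<^sup>2 / Q q) * (\<xi> (\<lambda>x. \<phi>' x $ 1) * \<eta> (\<lambda>x. \<phi>' x $ 1))"
      "\<And>q. near Xt a (\<lambda>q. \<phi> q $ 2 = 0 \<longrightarrow> F q = 0) \<Longrightarrow> q \<in> U' \<Longrightarrow>
       analytic_at Xt g q \<and> g q \<noteq> 0 \<and> \<phi> q $ 2 = \<phi>' q $ 2 * g q"
      by (rule diagonalise[where P = Q and F = F, OF S cat ne an(3) an(2) Qa]) (assumption, assumption, (rule that; assumption))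
    show ?thesis
      unfolding normal_form_at_def
    proof (intro exI conjI ballI)
      have "Et \<inter> U' = {q\<in>U'. \<phi>' q $ 1 = 0}" using E U'(2,3) by auto
      then show "divisor_chart Xt Et a U' \<phi>' {1}" using U'(1) by (simp add: divisor_chart_def)
    next
      fix q assume q: "q \<in> U'"
      then have qU: "q \<in> U" using U'(2) by blast
      note f = U'(3)[OF q]
      show "analytic_at Xt (\<lambda>q. (\<epsilon> q)^2 / Q q) q"
        using f by (intro analytic_at_divide analytic_at_power S an\<epsilon>[OF qU] an[OF qU]) auto
      show "analytic_at Xt (\<lambda>q. Q q * (f q)^2) q"
        using f by (intro analytic_at_mult analytic_at_power S an[OF qU]) auto
      show "analytic_at Xt (\<lambda>_. 0) q" by (rule analytic_at_const[OF S analytic_at_pts[OF an\<epsilon>[OF qU]]])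
      show "0 < (\<epsilon> q)^2 / Q q" "0 < Q q * (f q)^2" using f \<epsilon>0[OF qU] by simp_all
      fix \<xi> \<eta> assume \<xi>: "\<xi> \<in> tangent_space Xt q" and \<eta>: "\<eta> \<in> tangent_space Xt q"
      \<comment> \<open>For \<open>k = t = 0\<close> the Gram determinant is
        \<open>(\<epsilon> q)^2\<close>; divided by the pivot it becomes the remaining diagonal
        coefficient.\<close>
      have G: "P q - (F q)\<^sup>2 / Q q = (\<epsilon> q)^2 / Q q" using gram[OF qU] f k by (simp add: field_simps)
      have e: "2 * s + 2 * t = 2 * r" using k by simp
      have "?\<kappa> q \<xi> \<eta> = \<phi>' q $ 1 ^ (2 * r) *
        (Q q * (f q)\<^sup>2 * (\<xi> (\<lambda>x. \<phi>' x $ 2) * \<eta> (\<lambda>x. \<phi>' x $ 2))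
       + (\<epsilon> q)^2 / Q q * (\<xi> (\<lambda>x. \<phi>' x $ 1) * \<eta> (\<lambda>x. \<phi>' x $ 1)))"
        unfolding \<kappa>[OF qU \<xi> \<eta>] G[symmetric] U'(4)[OF q \<xi> \<eta>, symmetric] using f by (simp add: u_def algebra_simps)
      then show "let u = \<lambda>x. \<phi>' x $ 1; v = \<lambda>x. \<phi>' x $ 2
        in ?\<kappa> q \<xi> \<eta> = (\<epsilon> q)^2 / Q q * u q ^ (2 * r) * (\<xi> u * \<eta> u)
           + Q q * (f q)^2 * u q ^ (2 * s + 2 * t) * (\<xi> v * \<eta> v) + u q ^ \<rho> * 0 * (\<xi> u * \<eta> v + \<xi> v * \<eta> u)"
        unfolding e Let_def by (simp add: algebra_simps)
    qed
  next
    case False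
    then have "\<not> crosses_leaf Xt Et \<mu>1 a" using cross by blast
    moreover have "adapted_at Xt Et \<mu>1 a" using fol(1) aU by (simp add: adapted_foliation_on_def)
    ultimately have inv: "near Xt a (\<lambda>q. u q = 0 \<longrightarrow> m1 2 q = 0)"
      unfolding u_def m1_def D_def by (intro adapted_not_crossing[OF S div _ nv])
    then have m2a: "m1 2 a = 0" using a0 unfolding near_def by (auto simp: u_def)
    \<comment> \<open>\<open>\<mu>1\<close> does not vanish at \<open>a\<close> but annihilates the
      direction of the divisor, so its \<open>u\<close>-component must be nonzero; this makes
      \<open>P\<close> a unit.\<close>
    have m1a: "m1 1 a \<noteq> 0"
    proof
      assume "m1 1 a = 0"
      then have "vanishes_at Xt \<mu>1 a" unfolding vanishes_at_def using ex(1)[OF aU] m2a by simp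
      with nv show False by blast
    qed
    have u2k: "u q ^ (2 * k) \<ge> 0" for q by (simp add: power_mult)
    have Pa: "P a > 0" unfolding P_def by (rule add_pos_nonneg) (use m1a u2k in auto)
    have ne: "(1::2) \<noteq> 2" by simp
    obtain U' \<phi>' f g where U': "chart_at Xt a U' \<phi>'" "U' \<subseteq> U"
      "\<And>q. q \<in> U' \<Longrightarrow> P q > 0 \<and> analytic_at Xt f q \<and> f q \<noteq> 0 \<and> \<phi>' q $ 2 = \<phi> q $ 2"
      "\<And>q R \<xi> \<eta>. q \<in> U' \<Longrightarrow> \<xi> \<in> tangent_space Xt q \<Longrightarrow> \<eta> \<in> tangent_space Xt q \<Longrightarrow>
       P q * (\<xi> (\<lambda>x. \<phi> x $ 1) * \<eta> (\<lambda>x. \<phi> x $ 1))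
       + F q * (\<xi> (\<lambda>x. \<phi> x $ 1) * \<eta> (\<lambda>x. \<phi> x $ 2) + \<xi> (\<lambda>x. \<phi> x $ 2) * \<eta> (\<lambda>x. \<phi> x $ 1))
       + R * (\<xi> (\<lambda>x. \<phi> x $ 2) * \<eta> (\<lambda>x. \<phi> x $ 2))
       = P q * (f q)\<^sup>2 * (\<xi> (\<lambda>x. \<phi>' x $ 1) * \<eta> (\<lambda>x. \<phi>' x $ 1))
       + (R - (F q)\<^sup>2 / P q) * (\<xi> (\<lambda>x. \<phi>' x $ 2) * \<eta> (\<lambda>x. \<phi>' x $ 2))"
      "\<And>q. near Xt a (\<lambda>q. \<phi> q $ 1 = 0 \<longrightarrow> F q = 0) \<Longrightarrow> q \<in> U' \<Longrightarrow>
       analytic_at Xt g q \<and> g q \<noteq> 0 \<and> \<phi> q $ 1 = \<phi>' q $ 1 * g q"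
      by (rule diagonalise[where P = P and F = F, OF S cat ne an(1) an(2) Pa]) (assumption, assumption, (rule that; assumption))
    have "near Xt a (\<lambda>q. m1 1 q ^ 2 > 0)"
      by (rule analytic_at_positive_near[OF S analytic_at_power[OF S anm(1)[OF aU]]]) (use m1a in simp)
    then have "near Xt a (\<lambda>q. (u q = 0 \<longrightarrow> m1 2 q = 0) \<and> m1 1 q ^ 2 > 0 \<and> q \<in> U)"
      by (intro near_conj inv near_openin[OF chart_openin[OF ch] aU])
    then have nF: "near Xt a (\<lambda>q. \<phi> q $ 1 = 0 \<longrightarrow> F q = 0)"
    proof (rule near_mono, intro impI)
      fix q assume H: "(u q = 0 \<longrightarrow> m1 2 q = 0) \<and> m1 1 q ^ 2 > 0 \<and> q \<in> U" and "\<phi> q $ 1 = 0"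
      then have u0: "u q = 0" and b0: "m1 2 q = 0" and n0: "m1 1 q \<noteq> 0" and qU: "q \<in> U" by (auto simp: u_def)
      \<comment> \<open>Either \<open>k > 0\<close> and the power of \<open>u\<close> vanishes, or
        \<open>k = 0\<close>, hence \<open>t > 0\<close>, and the determinant vanishes on the
        divisor; as \<open>m1 2 q = 0\<close> it reduces there to
        \<open>m1 1 q * m2 2 q\<close>.\<close>
      have "u q ^ (2 * k) * (m1 1 q * m2 2 q) = 0"
      proof (cases "k = 0")
        case True
        then have "t \<noteq> 0" using False s by auto
        then show ?thesis using det[OF qU] b0 u0 by simp
      qed (use u0 in simp)
      then have "u q ^ (2 * k) * m2 2 q = 0" using n0 by auto
      then show "F q = 0" using b0 by (auto simp: F_def)
    qed
    note g = U'(5)[OF nF]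
    show ?thesis
      unfolding normal_form_at_def
    proof (intro exI conjI ballI)
      have "Et \<inter> U' = {q\<in>U'. \<phi>' q $ 1 = 0}"
      proof -
        have "Et \<inter> U' = {q\<in>U'. \<phi> q $ 1 = 0}" using E U'(2) by blast
        also have "\<dots> = {q\<in>U'. \<phi>' q $ 1 = 0}" using g by auto
        finally show ?thesis .
      qed
      then show "divisor_chart Xt Et a U' \<phi>' {1}" using U'(1) by (simp add: divisor_chart_def)
    next
      fix q assume q: "q \<in> U'"
      then have qU: "q \<in> U" using U'(2) by blast
      note f = U'(3)[OF q] and gq = g[OF q]
      \<comment> \<open>The old \<open>u\<close> is the new one times the unit \<open>g\<close>, so
        rewriting its powers releases powers of \<open>g\<close>. The exponents being even, these
        are positive and can be absorbed into the diagonal units.\<close>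
      show "analytic_at Xt (\<lambda>q. g q ^ (2 * r) * (P q * (f q)^2)) q"
        using f gq by (intro analytic_at_mult analytic_at_power S an[OF qU]) auto
      show "analytic_at Xt (\<lambda>q. g q ^ (2 * s + 2 * t) * ((\<epsilon> q)^2 / P q)) q"
        using f gq by (intro analytic_at_mult analytic_at_divide analytic_at_power S an[OF qU] an\<epsilon>[OF qU]) auto
      show "analytic_at Xt (\<lambda>_. 0) q" by (rule analytic_at_const[OF S analytic_at_pts[OF an\<epsilon>[OF qU]]])
      have gp: "g q ^ (2 * n) > 0" for n using gq by (simp add: power_mult)
      show "0 < g q ^ (2 * r) * (P q * (f q)^2)" using f gp by simp
      show "0 < g q ^ (2 * s + 2 * t) * ((\<epsilon> q)^2 / P q)"
        using f gp[of "s + t"] \<epsilon>0[OF qU] by (simp add: distrib_left)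
      fix \<xi> \<eta> assume \<xi>: "\<xi> \<in> tangent_space Xt q" and \<eta>: "\<eta> \<in> tangent_space Xt q"
      have uq: "u q = \<phi>' q $ 1 * g q" using gq by (simp add: u_def)
      have G: "Q q - (F q)\<^sup>2 / P q = u q ^ (2 * k + 2 * t) * ((\<epsilon> q)^2 / P q)"
        using gram[OF qU] f by (simp add: field_simps)
      have "?\<kappa> q \<xi> \<eta> = u q ^ (2 * r) *
        (P q * (f q)\<^sup>2 * (\<xi> (\<lambda>x. \<phi>' x $ 1) * \<eta> (\<lambda>x. \<phi>' x $ 1))
       + u q ^ (2 * k + 2 * t) * ((\<epsilon> q)^2 / P q) * (\<xi> (\<lambda>x. \<phi>' x $ 2) * \<eta> (\<lambda>x. \<phi>' x $ 2)))"
        unfolding \<kappa>[OF qU \<xi> \<eta>] U'(4)[OF q \<xi> \<eta>] G ..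
      \<comment> \<open>The factor \<open>u ^ (2 * r)\<close> taken out of the metric meets the one
        from the Gram determinant, and \<open>2 * r + 2 * k + 2 * t\<close> is
        \<open>2 * s + 2 * t\<close>.\<close>
      also have "\<dots> = u q ^ (2 * r) * (P q * (f q)\<^sup>2) * (\<xi> (\<lambda>x. \<phi>' x $ 1) * \<eta> (\<lambda>x. \<phi>' x $ 1))
       + u q ^ (2 * s + 2 * t) * ((\<epsilon> q)^2 / P q) * (\<xi> (\<lambda>x. \<phi>' x $ 2) * \<eta> (\<lambda>x. \<phi>' x $ 2))"
        by (simp add: s power_add distrib_left algebra_simps)
      finally show "let u = \<lambda>x. \<phi>' x $ 1; v = \<lambda>x. \<phi>' x $ 2
        in ?\<kappa> q \<xi> \<eta> = g q ^ (2 * r) * (P q * (f q)^2) * u q ^ (2 * r) * (\<xi> u * \<eta> u)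
           + g q ^ (2 * s + 2 * t) * ((\<epsilon> q)^2 / P q) * u q ^ (2 * s + 2 * t) * (\<xi> v * \<eta> v)
           + u q ^ \<rho> * 0 * (\<xi> u * \<eta> v + \<xi> v * \<eta> u)"
        unfolding Let_def uq power_mult_distrib by (simp add: mult_ac)
    qed
  qed
qed

end
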